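(* Let $\epsilon>0$ and let $M$ be a constant. Let $\{f_k\}$ be a sequence of functions on $\mathbb{R}^n$ which are normalized and centered in $L^2(dm)$, i.e. $\int |f_k|^2\,dm=1$ and $\int x|f_k|^2\,dm=0$, and suppose that $$\int_{\mathbb{R}^n}|f_k|^2e^{-(2\pi-\epsilon)|x|^2}\,dx\le M\quad\text{for all }k.$$ If $\delta_c(f_k)\to0$ as $k\to\infty$, then $f_k\to1$ in $L^2(dm)$.
   Context: On $\mathbb{R}^n$, $dm=2^{n/2}e^{-2\pi|x|^2}dx$, a Gaussian probability measure. For $f\in L^2(dm)$ normalized by $\int|f|^2\,dm=1$, the deficit is $\delta_c(f)=\frac{1}{2\pi}\int|\nabla f|^2\,dm-\int|f|^2\log|f|^2\,dm$.
   Formalization: As stated it fails for f_k = -1 (normalized, centered, deficit 0, moment bound holds if ε < 2π). Proved instead: f_k → 1 in L²(dm) when all f_k ≥ 0, and, for arbitrary complex f_k, c_k f_k → 1 in L²(dm) for suitable constants with |c_k| = 1. *)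

theory Defs
  imports "HOL-Analysis.Analysis"
begin

text \<open>The Gaussian probability measure $dm = 2^{n/2} e^{-2\pi|x|^2} dx$, where $n$ is the
  cardinality of the index type.\<close>

definition gauss_m :: "(real ^ 'n) measure" where
  "gauss_m = density lborel
     (\<lambda>x. ennreal (2 powr (real CARD('n) / 2) * exp (- (2 * pi * (norm x)\<^sup>2))))"

text \<open>The gradient is the weak one, since membership in $L^2(dm)$ provides no classical
  derivatives. Test functions are real-valued and range over $C^1_c$ (this gives the same weak
  derivatives as $C^\infty_c$); the second argument is the classical gradient of the first.\<close>

definition test_function :: "(real ^ 'n \<Rightarrow> real) \<Rightarrow> (real ^ 'n \<Rightarrow> real ^ 'n) \<Rightarrow> bool" where
  "test_function \<phi> \<phi>' \<longleftrightarrow>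
     (\<forall>x. (\<phi> has_derivative (\<lambda>h. \<phi>' x \<bullet> h)) (at x)) \<and>
     continuous_on UNIV \<phi>' \<and> compact (closure {x. \<phi> x \<noteq> 0})"

definition loc_integrable :: "(real ^ 'n \<Rightarrow> 'b::{banach, second_countable_topology}) \<Rightarrow> bool" where
  "loc_integrable f \<longleftrightarrow> (\<forall>K. compact K \<longrightarrow> set_integrable lborel K f)"

definition is_weak_gradient :: "(real ^ 'n \<Rightarrow> complex) \<Rightarrow> (real ^ 'n \<Rightarrow> complex ^ 'n) \<Rightarrow> bool" where
  "is_weak_gradient f g \<longleftrightarrow>
     f \<in> borel_measurable borel \<and> g \<in> borel_measurable borel \<and>
     loc_integrable f \<and> loc_integrable g \<and>
     (\<forall>\<phi> \<phi>'. test_function \<phi> \<phi>' \<longrightarrow>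
        (\<forall>i. (LINT x|lborel. (\<phi>' x $ i) *\<^sub>R f x) = - (LINT x|lborel. \<phi> x *\<^sub>R (g x $ i))))"

text \<open>Weak gradients are unique up to null sets, so the choice below does not affect the value of
  the Dirichlet integral $\int |\nabla f|^2 dm$, which is infinite if there is no weak gradient.\<close>

definition weak_gradient :: "(real ^ 'n \<Rightarrow> complex) \<Rightarrow> real ^ 'n \<Rightarrow> complex ^ 'n" where
  "weak_gradient f = (SOME g. is_weak_gradient f g)"

definition dirichlet :: "(real ^ 'n \<Rightarrow> complex) \<Rightarrow> ennreal" where
  "dirichlet f =
     (if \<exists>g. is_weak_gradient f g
      then \<integral>\<^sup>+ x. ennreal ((norm (weak_gradient f x))\<^sup>2) \<partial>gauss_m
      else \<infinity>)"

text \<open>$\int |f|^2 \log |f|^2 dm$ as the difference of the integrals of the positive and of the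
  negative part (\<^const>\<open>ennreal\<close> sends negative numbers to 0). The second one is always finite
  because $t \log t \ge -1/e$; at zeros of $f$ the integrand is 0.\<close>

definition entropy_m :: "(real ^ 'n \<Rightarrow> complex) \<Rightarrow> ereal" where
  "entropy_m f =
     enn2ereal (\<integral>\<^sup>+ x. ennreal ((cmod (f x))\<^sup>2 * ln ((cmod (f x))\<^sup>2)) \<partial>gauss_m)
   - enn2ereal (\<integral>\<^sup>+ x. ennreal (- ((cmod (f x))\<^sup>2 * ln ((cmod (f x))\<^sup>2))) \<partial>gauss_m)"

text \<open>The deficit is $+\infty$ when the Dirichlet integral is infinite; this settles the case in
  which the entropy is infinite as well.\<close>

definition deficit_c :: "(real ^ 'n \<Rightarrow> complex) \<Rightarrow> ereal" where
  "deficit_c f =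
     (if dirichlet f = \<infinity> then \<infinity>
      else ereal (1 / (2 * pi)) * enn2ereal (dirichlet f) - entropy_m f)"

definition tendsto_L2m :: "(nat \<Rightarrow> real ^ 'n \<Rightarrow> complex) \<Rightarrow> (real ^ 'n \<Rightarrow> complex) \<Rightarrow> bool" where
  "tendsto_L2m f h \<longleftrightarrow>
     (\<lambda>k. \<integral>\<^sup>+ x. ennreal ((cmod (f k x - h x))\<^sup>2) \<partial>gauss_m) \<longlonglongrightarrow> 0"

end

theory Submission
  imports Defs "HOL-Probability.Probability"
begin

text \<open>Let \<open>X\<close> have the distribution \<open>|f|\<^sup>2 dm\<close> and let \<open>Z\<close> be standard normal. By de Bruijn's identity the
  entropy of \<open>X + \<surd>t Z\<close> decreases at a rate given by its Fisher information, and the score of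
  \<open>X + \<surd>t Z\<close> is a conditional expectation of a linear interpolation between the scores of \<open>X\<close> and of
  \<open>\<surd>t Z\<close>. Comparison with the Gaussian case yields the logarithmic Sobolev inequality with a remainder:
  the deficit dominates \<open>E |a X - E (a X | X + \<surd>t Z)|\<^sup>2\<close> for some \<open>t\<close> in [1, 2], where \<open>a\<close> is the score
  relative to \<open>dm\<close>. So \<open>a X\<close> is almost a function of \<open>X + \<surd>t Z\<close>. As the laws of \<open>X + \<surd>t Z\<close> given
  different values of \<open>X\<close> overlap, \<open>a\<close> is almost constant on balls; the constant vanishes by centering,
  and the moment hypothesis excludes a contribution of the tails. Hence the Dirichlet integrals tend
  to 0. The logarithmic Sobolev inequality for \<open>f + L\<close> with large constants \<open>L\<close> gives the Poincare
  inequality, by which \<open>f\<close> is close to its mean.\<close>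

text \<open>The obstacle is low regularity: the density of \<open>X\<close> is only weakly
  differentiable and may vanish. Hence everything is computed for \<open>t > 0\<close>, where the
  smoothed density is positive and has explicit Gaussian bounds. Time 0 enters through two
  integrated facts only: the identity \<open>score\<close>, which is the weak gradient tested
  against Gaussians, and the Donsker-Varadhan formula with bounded test functions, whose terms do
  converge as \<open>t\<close> tends to 0. The remainder is what the classical derivation of the
  logarithmic Sobolev inequality from de Bruijn's identity discards: a conditional expectation has a
  smaller second moment than the variable itself, by exactly the mean conditional variance. Times
  between 1 and 2 keep the noise at unit scale; as the noise vanishes, \<open>X + \<surd>t Z\<close>
  reveals \<open>X\<close>, and being almost a function of it says nothing. For complex
  \<open>f\<close> the score sees the modulus alone. The entropy is bounded by the second moment of
  \<open>a\<close>, so the share of the phase in the Dirichlet integral is at most the deficit; this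
  is why the Poincare inequality is applied to \<open>f\<close> and not to its modulus.\<close>

lemma integrable_lborel_translation:
  fixes F :: "'a::euclidean_space \<Rightarrow> 'b::{banach, second_countable_topology}"
  assumes "integrable lborel F"
  shows "integrable lborel (\<lambda>y. F (y - c))"
proof -
  have [measurable]: "F \<in> borel_measurable borel" using assms by auto
  have "integrable (distr lborel borel ((+) (- c))) F"
    using assms by (simp add: lborel_distr_plus)
  then show ?thesis by (subst (asm) integrable_distr_eq) auto
qed

lemma integral_lborel_translation:
  fixes F :: "'a::euclidean_space \<Rightarrow> 'b::{banach, second_countable_topology}"
  assumes [measurable]: "F \<in> borel_measurable borel"
  shows "(LBINT y. F (y - c)) = (LBINT y. F y)"
proof -
  have "(LBINT y. F y) = (\<integral>y. F y \<partial>distr lborel borel ((+) (- c)))"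
    by (simp add: lborel_distr_plus)
  also have "\<dots> = (LBINT y. F (y - c))" by (subst integral_distr) auto
  finally show ?thesis by simp
qed

text \<open>Averaged over unit segments in direction \<open>i\<close>, \<open>F'\<close> keeps its
  integral by translation invariance, while the fundamental theorem of calculus turns it into
  \<open>F (y + i) - F y\<close>, whose integral is 0. This is integration by parts with
  integrability of \<open>F\<close> and \<open>F'\<close> in place of decay at infinity.\<close>

lemma integral_directional_derivative_zero:
  fixes F F' :: "'a::euclidean_space \<Rightarrow> real"
  assumes F: "integrable lborel F" and F': "integrable lborel F'"
    and d: "\<And>y. ((\<lambda>s. F (y + s *\<^sub>R i)) has_real_derivative F' y) (at 0)"
    and c: "continuous_on UNIV F'"
  shows "(LBINT y. F' y) = 0"
proof -
  have [measurable]: "F' \<in> borel_measurable borel" "F \<in> borel_measurable borel"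
    using F F' by auto
  have ftc: "(LBINT s. indicator {0..1} s * F' (y + s *\<^sub>R i)) = F (y + i) - F y" for y
  proof -
    have "has_bochner_integral lborel (\<lambda>s. indicator {0..1} s *\<^sub>R F' (y + s *\<^sub>R i))
        (F (y + 1 *\<^sub>R i) - F (y + 0 *\<^sub>R i))"
    proof (rule has_bochner_integral_FTC_Icc)
      fix s :: real
      have "((\<lambda>r. F ((y + s *\<^sub>R i) + r *\<^sub>R i)) has_real_derivative F' (y + s *\<^sub>R i)) (at 0)"
        by (rule d)
      then have "((\<lambda>r. F (y + (s + r) *\<^sub>R i)) has_real_derivative F' (y + s *\<^sub>R i)) (at 0)"
        by (simp add: algebra_simps)
      then have "((\<lambda>r. F (y + r *\<^sub>R i)) has_real_derivative F' (y + s *\<^sub>R i)) (at s)"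
        using DERIV_shift[of "\<lambda>r. F (y + r *\<^sub>R i)" _ 0 s] by (simp add: add.commute)
      then show "((\<lambda>s. F (y + s *\<^sub>R i)) has_vector_derivative F' (y + s *\<^sub>R i)) (at s within {0..1})"
        by (simp add: has_real_derivative_iff_has_vector_derivative has_vector_derivative_at_within)
    next
      show "continuous_on {0..1} (\<lambda>s. F' (y + s *\<^sub>R i))"
        by (intro continuous_on_compose2[OF c] continuous_intros) auto
    qed simp
    then show ?thesis by (simp add: has_bochner_integral_iff)
  qed
  let ?g = "\<lambda>(s, y). indicator {0..1} s * F' (y + s *\<^sub>R i)"
  have tr: "(LBINT y. G (y + s *\<^sub>R i)) = (LBINT y. G y)"
    if "G \<in> borel_measurable borel" for G :: "'a \<Rightarrow> real" and s
    using integral_lborel_translation[of G "- (s *\<^sub>R i)"] that by simp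
  have it: "integrable lborel (\<lambda>y. G (y + s *\<^sub>R i))" if "integrable lborel G" for G :: "'a \<Rightarrow> real" and s
    using integrable_lborel_translation[of G "- (s *\<^sub>R i)"] that by simp
  have int: "integrable (lborel \<Otimes>\<^sub>M lborel) ?g"
  proof (rule lborel_pair.Fubini_integrable)
    have "(LBINT y. norm (?g (s, y))) = indicator {0..1} s * (LBINT y. \<bar>F' y\<bar>)" for s
      using tr[of "\<lambda>y. \<bar>F' y\<bar>" s] by (simp add: abs_mult)
    then show "integrable lborel (\<lambda>s. \<integral>y. norm (?g (s, y)) \<partial>lborel)"
      by (simp add: integrable_real_indicator)
    show "AE s in lborel. integrable lborel (\<lambda>y. ?g (s, y))"
      using it[OF F'] by simp
  qed measurable
  have "(LBINT y. (LBINT s. indicator {0..1} s * F' (y + s *\<^sub>R i)))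
      = (LBINT s. (LBINT y. indicator {0..1} s * F' (y + s *\<^sub>R i)))"
    using lborel_pair.Fubini_integral[of "\<lambda>s y. indicator {0..1} s * F' (y + s *\<^sub>R i)"] int by simp
  also have "\<dots> = (LBINT s. indicator {0..1::real} s * (LBINT y. F' y))"
    by (simp add: tr)
  also have "\<dots> = (LBINT y. F' y)" by (simp add: content_real)
  finally have "(LBINT y. F' y) = (LBINT y. F (y + i) - F y)" by (simp add: ftc)
  also have "\<dots> = 0" using it[OF F, of 1] tr[of F 1] F by simp
  finally show ?thesis .
qed

text \<open>The mean value theorem bounds the difference quotients by the majorant \<open>B\<close>,
  so dominated convergence applies along every sequence tending to \<open>t0\<close>.\<close>

lemma has_real_derivative_integral:
  fixes f f' :: "real \<Rightarrow> 'b \<Rightarrow> real"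
  assumes t0: "a < t0" "t0 < b"
    and d: "\<And>t x. a < t \<Longrightarrow> t < b \<Longrightarrow> x \<in> space M \<Longrightarrow> ((\<lambda>t. f t x) has_real_derivative f' t x) (at t)"
    and B: "\<And>t x. a < t \<Longrightarrow> t < b \<Longrightarrow> x \<in> space M \<Longrightarrow> \<bar>f' t x\<bar> \<le> B x"
    and iB: "integrable M B"
    and fi: "\<And>t. a < t \<Longrightarrow> t < b \<Longrightarrow> integrable M (f t)"
  shows "((\<lambda>t. \<integral>x. f t x \<partial>M) has_real_derivative (\<integral>x. f' t0 x \<partial>M)) (at t0)"
    and "integrable M (f' t0)"
proof -
  have lim: "((\<lambda>n. (f (X n) x - f t0 x) / (X n - t0)) \<longlonglongrightarrow> f' t0 x)"
    if "x \<in> space M" "\<forall>n. X n \<noteq> t0" "X \<longlonglongrightarrow> t0" for X x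
    using d[OF t0 that(1)] that(2,3)
    unfolding has_field_derivative_iff tendsto_at_iff_sequentially comp_def by auto
  have key: "(\<lambda>n. ((\<integral>x. f (X n) x \<partial>M) - (\<integral>x. f t0 x \<partial>M)) / (X n - t0)) \<longlonglongrightarrow> (\<integral>x. f' t0 x \<partial>M)
      \<and> integrable M (f' t0)"
    if X: "\<forall>n. X n \<noteq> t0" "X \<longlonglongrightarrow> t0" for X :: "nat \<Rightarrow> real"
  proof -
    have "\<forall>\<^sub>F n in sequentially. X n \<in> {a<..<b}"
      using X(2) t0 by (intro topological_tendstoD) auto
    then obtain N where N: "\<And>n. n \<ge> N \<Longrightarrow> a < X n \<and> X n < b"
      by (auto simp: eventually_sequentially)
    \<comment> \<open>Only a tail of the sequence lies in the interval where \<open>f t\<close> is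
      integrable and \<open>f'\<close> is dominated.\<close>
    let ?Y = "\<lambda>n. X (n + N)"
    let ?q = "\<lambda>n x. (f (?Y n) x - f t0 x) / (?Y n - t0)"
    have Y: "a < ?Y n" "?Y n < b" for n using N by auto
    have Yl: "?Y \<longlonglongrightarrow> t0" using X(2) by (rule LIMSEQ_ignore_initial_segment)
    have l: "AE x in M. (\<lambda>n. ?q n x) \<longlonglongrightarrow> f' t0 x"
      using lim[of _ ?Y] X(1) Yl by auto
    have bd: "norm (?q n x) \<le> B x" if x: "x \<in> space M" for n x
    proof -
      have "\<exists>z. a < z \<and> z < b \<and> f (?Y n) x - f t0 x = (?Y n - t0) * f' z x"
      proof (cases "?Y n < t0")
        case True
        obtain z where "z > ?Y n" "z < t0" "f t0 x - f (?Y n) x = (t0 - ?Y n) * f' z x"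
          using MVT2[of "?Y n" t0 "\<lambda>t. f t x" "\<lambda>t. f' t x"] d[OF _ _ x] True Y[of n] t0 by auto
        then show ?thesis using Y[of n] t0 by (intro exI[of _ z]) (auto simp: algebra_simps)
      next
        case False
        then have "t0 < ?Y n" using X(1) by (metis linorder_neqE_linordered_idom)
        then obtain z where "z < ?Y n" "t0 < z" "f (?Y n) x - f t0 x = (?Y n - t0) * f' z x"
          using MVT2[of t0 "?Y n" "\<lambda>t. f t x" "\<lambda>t. f' t x"] d[OF _ _ x] Y[of n] t0 by auto
        then show ?thesis using Y[of n] t0 by (intro exI[of _ z]) auto
      qed
      then obtain z where z: "a < z" "z < b" "f (?Y n) x - f t0 x = (?Y n - t0) * f' z x" by blast
      have "?Y n - t0 \<noteq> 0" using X(1) by simp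
      then have "?q n x = f' z x" unfolding z(3) by simp
      then show ?thesis using B[OF z(1,2) x] by simp
    qed
    have [measurable]: "f t \<in> borel_measurable M" if "a < t" "t < b" for t using fi that by auto
    have mq: "?q n \<in> borel_measurable M" for n using Y[of n] t0 by measurable
    have mf: "f' t0 \<in> borel_measurable M"
      by (rule borel_measurable_LIMSEQ_metric[OF mq]) (use lim[of _ ?Y] X(1) Yl in auto)
    have "(\<lambda>n. \<integral>x. ?q n x \<partial>M) \<longlonglongrightarrow> (\<integral>x. f' t0 x \<partial>M)"
      by (rule integral_dominated_convergence[OF mf mq iB l]) (use bd in auto)
    moreover have "(\<integral>x. ?q n x \<partial>M) = ((\<integral>x. f (?Y n) x \<partial>M) - (\<integral>x. f t0 x \<partial>M)) / (?Y n - t0)" for n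
      unfolding Bochner_Integration.integral_diff[OF fi[OF Y] fi[OF t0], symmetric] by simp
    ultimately have "(\<lambda>n. ((\<integral>x. f (?Y n) x \<partial>M) - (\<integral>x. f t0 x \<partial>M)) / (?Y n - t0)) \<longlonglongrightarrow> (\<integral>x. f' t0 x \<partial>M)"
      by (simp only:)
    then have "(\<lambda>n. ((\<integral>x. f (X n) x \<partial>M) - (\<integral>x. f t0 x \<partial>M)) / (X n - t0)) \<longlonglongrightarrow> (\<integral>x. f' t0 x \<partial>M)"
      by (rule LIMSEQ_offset)
    moreover have "integrable M (f' t0)"
      by (rule Bochner_Integration.integrable_bound[OF iB mf]) (use B t0 in \<open>force intro!: AE_I2\<close>)
    ultimately show ?thesis by simp
  qed
  show "((\<lambda>t. \<integral>x. f t x \<partial>M) has_real_derivative (\<integral>x. f' t0 x \<partial>M)) (at t0)"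
    unfolding has_field_derivative_iff tendsto_at_iff_sequentially comp_def using key by auto
  \<comment> \<open>A concrete sequence avoiding \<open>t0\<close>, from which \<open>key\<close>
    yields the integrability of \<open>f' t0\<close>.\<close>
  have "(\<lambda>n. t0 + 1 / real (Suc n)) \<longlonglongrightarrow> t0 + 0"
    by (intro tendsto_intros LIMSEQ_Suc[OF lim_1_over_n])
  then show "integrable M (f' t0)" using key[of "\<lambda>n. t0 + 1 / real (Suc n)"] by auto
qed

section \<open>Gaussian kernels\<close>

text \<open>The normal density with mean 0 and covariance \<open>t\<close> times the identity:
  \<open>t\<close> is the variance per coordinate, so \<open>gk t\<close> is the density of
  \<open>\<surd>t Z\<close>.\<close>

definition gk :: "real \<Rightarrow> 'a::euclidean_space \<Rightarrow> real" where
  "gk t z = (2 * pi * t) powr (- (real DIM('a) / 2)) * exp (- ((norm z)\<^sup>2 / (2 * t)))"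

lemma gk_measurable [measurable]: "gk t \<in> borel_measurable borel"
  unfolding gk_def by measurable

lemma gk_measurable2 [measurable (raw)]:
  assumes "f \<in> borel_measurable M" "g \<in> borel_measurable M"
  shows "(\<lambda>x. gk (f x) (g x :: 'a::euclidean_space)) \<in> borel_measurable M"
  unfolding gk_def using assms by measurable

lemma gk_pos: "t > 0 \<Longrightarrow> gk t z > 0"
  by (simp add: gk_def)

lemma gk_nonneg [simp]: "gk t z \<ge> 0"
  by (simp add: gk_def)

lemma gk_le: "t > 0 \<Longrightarrow> gk t (z::'a::euclidean_space) \<le> (2 * pi * t) powr (- (real DIM('a) / 2))"
  unfolding gk_def by (auto intro!: mult_left_le)

lemma ln_gk:
  "t > 0 \<Longrightarrow> ln (gk t (z::'a::euclidean_space)) = - (real DIM('a) / 2) * ln (2 * pi * t) - (norm z)\<^sup>2 / (2 * t)"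
  by (simp add: gk_def ln_mult ln_powr)

lemma nn_integral_gk:
  assumes t: "t > 0"
  shows "(\<integral>\<^sup>+z. ennreal (gk t (z::'a::euclidean_space)) \<partial>lborel) = 1"
proof -
  \<comment> \<open>Exponent and prefactor both split over the coordinates, which reduces the total
    mass to dimension one.\<close>
  have 1: "gk t z = (\<Prod>b\<in>Basis. normal_density 0 (sqrt t) (z \<bullet> b))" for z :: 'a
  proof -
    have "(norm z)\<^sup>2 = (\<Sum>b\<in>Basis. (z \<bullet> b)\<^sup>2)"
      by (simp add: power2_norm_eq_inner euclidean_inner[of z z] flip: power2_eq_square)
    then have "exp (- ((norm z)\<^sup>2 / (2 * t))) = (\<Prod>b\<in>Basis. exp (- (z \<bullet> b)\<^sup>2 / (2 * t)))"
      by (simp add: exp_sum[symmetric] sum_negf sum_divide_distrib)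
    moreover have "c powr (- (real DIM('a) / 2)) = (\<Prod>b\<in>(Basis::'a set). 1 / sqrt c)" if "c > 0" for c :: real
    proof -
      have "1 / sqrt c = c powr (-(1/2))"
        using powr_minus[of c "1/2"] powr_half_sqrt[of c] that by (simp add: inverse_eq_divide)
      moreover have "(c powr (-(1/2))) ^ DIM('a) = c powr (- (real DIM('a) / 2))"
        using powr_realpow[of "c powr (-(1/2))" "DIM('a)"] that powr_powr[of c "-(1/2)" "real DIM('a)"] by simp
      ultimately show ?thesis by simp
    qed
    moreover have "2 * pi * t > 0" using t by simp
    ultimately show ?thesis
      using t by (simp add: gk_def normal_density_def prod_dividef power_one_over)
  qed
  have "(\<integral>\<^sup>+z. ennreal (gk t (z::'a)) \<partial>lborel)
      = (\<integral>\<^sup>+z. (\<Prod>b\<in>Basis. ennreal (normal_density 0 (sqrt t) (z \<bullet> b))) \<partial>(lborel::'a measure))"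
    unfolding 1 by (simp add: prod_ennreal)
  also have "\<dots> = (\<Prod>b\<in>(Basis::'a set). (\<integral>\<^sup>+x. ennreal (normal_density 0 (sqrt t) x) \<partial>lborel))"
    by (rule nn_integral_lborel_prod) auto
  also have "\<dots> = 1"
    using t by (subst nn_integral_eq_integral) auto
  finally show ?thesis .
qed

lemma integrable_gk [simp]: "t > 0 \<Longrightarrow> integrable lborel (gk t :: 'a::euclidean_space \<Rightarrow> real)"
  by (rule integrableI_nn_integral_finite[of _ _ 1]) (auto simp: nn_integral_gk)

lemma integral_gk [simp]: "t > 0 \<Longrightarrow> (LBINT z. gk t (z::'a::euclidean_space)) = 1"
  by (rule integral_eq_nn_integral[THEN trans]) (auto simp: nn_integral_gk)

lemma norm_add_scaleR_power2:
  fixes z i :: "'a::real_inner"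
  shows "(norm (z + s *\<^sub>R i))\<^sup>2 = (norm z)\<^sup>2 + 2 * s * (z \<bullet> i) + s\<^sup>2 * (norm i)\<^sup>2"
  unfolding power2_norm_eq_inner
  by (simp add: inner_add_left inner_add_right inner_commute algebra_simps) (simp add: power2_eq_square)

lemma norm_diff_power2_le: "(norm (x - y))\<^sup>2 \<le> 2 * (norm x)\<^sup>2 + 2 * (norm y)\<^sup>2"
  for x y :: "'b::real_normed_vector"
proof -
  have "(norm (x - y))\<^sup>2 \<le> (norm x + norm y)\<^sup>2"
    by (intro power_mono norm_triangle_ineq4) auto
  also have "\<dots> \<le> 2 * (norm x)\<^sup>2 + 2 * (norm y)\<^sup>2"
    using sum_squares_ge_zero[of "norm x - norm y" 0] by (simp add: power2_eq_square algebra_simps)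
  finally show ?thesis .
qed

lemma gk_has_derivative_scale:
  assumes t: "t > 0"
  shows "((\<lambda>t. gk t (z::'a::euclidean_space)) has_real_derivative
    gk t z * ((norm z)\<^sup>2 / (2 * t\<^sup>2) - real DIM('a) / (2 * t))) (at t)"
proof -
  have "((\<lambda>t. (2 * pi * t) powr (- (real DIM('a) / 2))) has_real_derivative
      (- (real DIM('a) / 2)) * (2 * pi * t) powr (- (real DIM('a) / 2) - 1) * (2 * pi)) (at t)"
    using t by (auto intro!: derivative_eq_intros)
  also have "(- (real DIM('a) / 2)) * (2 * pi * t) powr (- (real DIM('a) / 2) - 1) * (2 * pi)
      = (2 * pi * t) powr (- (real DIM('a) / 2)) * (- (real DIM('a) / (2 * t)))"
    using t by (simp add: powr_diff)
  finally have 1: "((\<lambda>t. (2 * pi * t) powr (- (real DIM('a) / 2))) has_real_derivative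
      (2 * pi * t) powr (- (real DIM('a) / 2)) * (- (real DIM('a) / (2 * t)))) (at t)" .
  have 2: "((\<lambda>t. exp (- ((norm z)\<^sup>2 / (2 * t)))) has_real_derivative
      exp (- ((norm z)\<^sup>2 / (2 * t))) * ((norm z)\<^sup>2 / (2 * t\<^sup>2))) (at t)"
    using t by (auto intro!: derivative_eq_intros simp: power2_eq_square field_simps)
  show ?thesis
    using DERIV_mult[OF 1 2] unfolding gk_def by (simp add: algebra_simps)
qed

lemma gk_has_derivative_line:
  assumes t: "t \<noteq> 0"
  shows "((\<lambda>s. gk t (z + s *\<^sub>R i :: 'a::euclidean_space)) has_real_derivative
    - ((z + s *\<^sub>R i) \<bullet> i) / t * gk t (z + s *\<^sub>R i)) (at s)"
  unfolding gk_def norm_add_scaleR_power2 using t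
  by (auto intro!: derivative_eq_intros
      simp: inner_add_left dot_square_norm power2_eq_square field_simps)

text \<open>A quadratic factor is absorbed by doubling the variance:
  \<open>1 + q \<le> (1 + 4 T) exp (q / (4 T))\<close> uses up half of the exponent
  \<open>q / (2 T)\<close>. A single kernel thus dominates a whole time interval, which supplies the
  majorants for differentiation in \<open>t\<close>.\<close>

lemma gk_dominated:
  assumes \<tau>: "0 < \<tau>" "\<tau> \<le> T"
  obtains C where "C > 0"
    "\<And>t z. \<tau> \<le> t \<Longrightarrow> t \<le> T \<Longrightarrow> gk t (z::'a::euclidean_space) * (1 + (norm z)\<^sup>2) \<le> C * gk (2 * T) z"
proof
  let ?a = "real DIM('a) / 2"
  let ?C = "(1 + 4 * T) * (2 * pi * \<tau>) powr (- ?a) / (2 * pi * (2 * T)) powr (- ?a)"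
  have T: "T > 0" using \<tau> by simp
  show "?C > 0" using T \<tau> by simp
  fix t and z :: 'a assume t: "\<tau> \<le> t" "t \<le> T"
  let ?q = "(norm z)\<^sup>2"
  have 1: "(2 * pi * t) powr (- ?a) \<le> (2 * pi * \<tau>) powr (- ?a)"
    using \<tau> t by (intro powr_mono2') auto
  have 2: "exp (- (?q / (2 * t))) \<le> exp (- (?q / (2 * T)))"
    using \<tau> t by (auto intro!: divide_left_mono mult_pos_pos)
  have 3: "1 + ?q \<le> (1 + 4 * T) * exp (?q / (4 * T))"
  proof -
    have "1 + ?q \<le> (1 + 4 * T) * (1 + ?q / (4 * T))"
      using T by (simp add: field_simps)
    also have "\<dots> \<le> (1 + 4 * T) * exp (?q / (4 * T))"
      using T by (intro mult_left_mono exp_ge_add_one_self) auto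
    finally show ?thesis .
  qed
  have "gk t z * (1 + ?q) \<le> ((2 * pi * \<tau>) powr (- ?a) * exp (- (?q / (2 * T)))) * ((1 + 4 * T) * exp (?q / (4 * T)))"
    unfolding gk_def by (intro mult_mono 1 2 3) auto
  also have "\<dots> = (1 + 4 * T) * (2 * pi * \<tau>) powr (- ?a) * (exp (- (?q / (2 * T))) * exp (?q / (4 * T)))"
    by simp
  also have "exp (- (?q / (2 * T))) * exp (?q / (4 * T)) = exp (- (?q / (2 * (2 * T))))"
    unfolding exp_add[symmetric] using T by (simp add: field_simps)
  also have "(1 + 4 * T) * (2 * pi * \<tau>) powr (- ?a) * exp (- (?q / (2 * (2 * T)))) = ?C * gk (2 * T) z"
    unfolding gk_def using T by simp
  finally show "gk t z * (1 + ?q) \<le> ?C * gk (2 * T) z" .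
qed

lemma gk_moment_bounded:
  assumes "0 < \<tau>" "\<tau> \<le> T"
  obtains C where "C > 0"
    "\<And>t z. \<tau> \<le> t \<Longrightarrow> t \<le> T \<Longrightarrow> gk t (z::'a::euclidean_space) * (1 + (norm z)\<^sup>2) \<le> C"
proof -
  obtain C where C: "C > 0" "\<And>t z. \<tau> \<le> t \<Longrightarrow> t \<le> T \<Longrightarrow> gk t (z::'a) * (1 + (norm z)\<^sup>2) \<le> C * gk (2 * T) z"
    using gk_dominated[OF assms] by metis
  let ?D = "(2 * pi * (2 * T)) powr (- (real DIM('a) / 2))"
  have "gk t z * (1 + (norm z)\<^sup>2) \<le> C * ?D" if "\<tau> \<le> t" "t \<le> T" for t and z :: 'a
    by (rule order_trans[OF C(2)[OF that]]) (use C(1) assms gk_le[of "2 * T" z] in auto)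
  then show ?thesis using that[of "C * ?D"] C(1) assms by auto
qed

lemma norm_le_one_plus_power2: "norm z \<le> 1 + (norm z)\<^sup>2"
proof -
  have "0 \<le> (norm z - 1)\<^sup>2" by simp
  then show ?thesis by (simp add: power2_eq_square algebra_simps)
    (smt (verit, best) mult_nonneg_nonneg norm_ge_zero)
qed

lemma integrable_gk_moment2:
  assumes t: "t > 0"
  shows "integrable lborel (\<lambda>z. gk t z * (1 + (norm (z::'a::euclidean_space))\<^sup>2))"
proof -
  obtain C where C: "C > 0" "\<And>z::'a. gk t z * (1 + (norm z)\<^sup>2) \<le> C * gk (2 * t) z"
    using gk_dominated[of t t] t by (metis order_refl)
  show ?thesis
    by (rule Bochner_Integration.integrable_bound[where f = "\<lambda>z. C * gk (2 * t) z"])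
      (use C t in \<open>auto simp: abs_mult intro!: order_trans[OF _ C(2)]\<close>)
qed

lemma integrable_gk_inner:
  fixes i :: "'a::euclidean_space"
  assumes t: "t > 0"
  shows "integrable lborel (\<lambda>z. gk t z * (z \<bullet> i))" "integrable lborel (\<lambda>z. gk t z * (z \<bullet> i)\<^sup>2)"
    "integrable lborel (\<lambda>z. gk t z *\<^sub>R (z::'a::euclidean_space))"
    "integrable lborel (\<lambda>z. gk t z * (norm (z::'a::euclidean_space))\<^sup>2)"
proof -
  have 1: "\<bar>z \<bullet> i\<bar> \<le> norm i * (1 + (norm z)\<^sup>2)" for z
  proof -
    have "\<bar>z \<bullet> i\<bar> \<le> norm z * norm i" by (rule Cauchy_Schwarz_ineq2)
    also have "\<dots> \<le> (1 + (norm z)\<^sup>2) * norm i"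
      by (intro mult_right_mono norm_le_one_plus_power2) auto
    finally show ?thesis by (simp add: mult.commute)
  qed
  have 2: "(z \<bullet> i)\<^sup>2 \<le> (norm i)\<^sup>2 * (1 + (norm z)\<^sup>2)" for z
  proof -
    have "(z \<bullet> i)\<^sup>2 \<le> (norm z * norm i)\<^sup>2"
      by (subst abs_le_square_iff[symmetric]) (simp add: Cauchy_Schwarz_ineq2)
    then show ?thesis by (simp add: power_mult_distrib algebra_simps)
      (smt (verit) zero_le_power2)
  qed
  have I: "integrable lborel (\<lambda>z. c * (gk t z * (1 + (norm (z::'a))\<^sup>2)))" for c
    by (intro integrable_mult_right integrable_gk_moment2[OF t])
  show "integrable lborel (\<lambda>z. gk t z * (z \<bullet> i))"
    by (rule Bochner_Integration.integrable_bound[OF I[of "norm i"]])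
      (use mult_left_mono[OF 1 gk_nonneg] in \<open>auto simp: abs_mult mult.left_commute\<close>)
  show "integrable lborel (\<lambda>z. gk t z * (z \<bullet> i)\<^sup>2)"
    by (rule Bochner_Integration.integrable_bound[OF I[of "(norm i)\<^sup>2"]])
      (use mult_left_mono[OF 2 gk_nonneg] in \<open>auto simp: abs_mult mult.left_commute\<close>)
  show "integrable lborel (\<lambda>z. gk t z *\<^sub>R (z::'a))"
    by (rule Bochner_Integration.integrable_bound[OF I[of 1]])
      (use mult_left_mono[OF norm_le_one_plus_power2 gk_nonneg] in \<open>auto simp: abs_mult\<close>)
  show "integrable lborel (\<lambda>z. gk t z * (norm (z::'a))\<^sup>2)"
    by (rule Bochner_Integration.integrable_bound[OF I[of 1]])
      (auto simp: abs_mult intro!: mult_left_mono)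
qed

lemma continuous_on_gk [continuous_intros]:
  "t \<noteq> 0 \<Longrightarrow> continuous_on S f \<Longrightarrow> continuous_on S (\<lambda>x. gk t (f x :: 'a::euclidean_space))"
  unfolding gk_def by (intro continuous_intros) auto

lemma integral_gk_inner:
  assumes t: "t > 0"
  shows "(LBINT z. gk t z * ((z::'a::euclidean_space) \<bullet> i)) = 0"
proof -
  have "(\<integral>z. - (z \<bullet> i) / t * gk t z \<partial>(lborel :: 'a measure)) = 0"
  proof (rule integral_directional_derivative_zero[where F = "gk t" and i = i])
    show "integrable lborel (\<lambda>z. - (z \<bullet> i) / t * gk t z)"
      using integrable_gk_inner(1)[OF t, of i, THEN integrable_mult_right, of "- 1 / t"]
      by (simp add: ac_simps)
    show "((\<lambda>s. gk t (y + s *\<^sub>R i)) has_real_derivative - (y \<bullet> i) / t * gk t y) (at 0)" for y :: 'a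
      using gk_has_derivative_line[of t y i 0] t by simp
    show "continuous_on UNIV (\<lambda>y. - (y \<bullet> i) / t * gk t y)"
      using t by (intro continuous_intros) auto
  qed (use t in auto)
  then have "(\<integral>z. (- 1 / t) * (gk t z * (z \<bullet> i)) \<partial>(lborel :: 'a measure)) = 0"
    by (simp add: ac_simps)
  then show ?thesis using t by (subst (asm) integral_mult_right_zero) auto
qed

lemma integral_gk_scaleR:
  assumes t: "t > 0"
  shows "(LBINT z. gk t z *\<^sub>R (z::'a::euclidean_space)) = 0"
proof (rule euclidean_eqI)
  fix i :: 'a assume "i \<in> Basis"
  have "(LBINT z. gk t z *\<^sub>R (z::'a)) \<bullet> i = (LBINT z. gk t z * (z \<bullet> i))"
    by (subst integral_inner_left[symmetric]) (simp_all add: integrable_gk_inner(3)[OF t])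
  then show "(LBINT z. gk t z *\<^sub>R (z::'a)) \<bullet> i = 0 \<bullet> i" by (simp add: integral_gk_inner[OF t])
qed

text \<open>Stein's identity: the derivative of \<open>gk t z * (z \<bullet> i)\<close> in direction
  \<open>i\<close> integrates to 0.\<close>

lemma integral_gk_inner2:
  assumes t: "t > 0" and i: "norm i = 1"
  shows "(LBINT z. gk t z * ((z::'a::euclidean_space) \<bullet> i)\<^sup>2) = t"
proof -
  have "(\<integral>z. gk t z - (1 / t) * (gk t z * (z \<bullet> i)\<^sup>2) \<partial>(lborel :: 'a measure)) = 0"
  proof (rule integral_directional_derivative_zero[where F = "\<lambda>z. gk t z * (z \<bullet> i)" and i = i])
    show "((\<lambda>s. gk t (y + s *\<^sub>R i) * ((y + s *\<^sub>R i) \<bullet> i)) has_real_derivative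
        gk t y - (1 / t) * (gk t y * (y \<bullet> i)\<^sup>2)) (at 0)" for y :: 'a
    proof -
      have "((\<lambda>s. (y + s *\<^sub>R i) \<bullet> i) has_real_derivative 1) (at 0)"
        using i by (auto simp: inner_add_left dot_square_norm intro!: derivative_eq_intros)
      from DERIV_mult[OF gk_has_derivative_line[of t y i 0] this] t
      show ?thesis by (simp add: algebra_simps power2_eq_square)
    qed
    show "continuous_on UNIV (\<lambda>z. gk t z - (1 / t) * (gk t z * ((z::'a) \<bullet> i)\<^sup>2))"
      using t by (intro continuous_intros) auto
  qed (use t integrable_gk_inner(1,2)[OF t, of i] in auto)
  then show ?thesis using t integrable_gk_inner(2)[OF t, of i] by simp
qed

lemma norm_power2_eq_sum_Basis: "(norm (z::'a::euclidean_space))\<^sup>2 = (\<Sum>i\<in>Basis. (z \<bullet> i)\<^sup>2)"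
  by (simp add: power2_norm_eq_inner euclidean_inner[of z z] flip: power2_eq_square)

lemma integral_gk_norm2:
  assumes t: "t > 0"
  shows "(LBINT z. gk t z * (norm (z::'a::euclidean_space))\<^sup>2) = real DIM('a) * t"
proof -
  have "(LBINT z. gk t z * (norm (z::'a))\<^sup>2) = (LBINT z. (\<Sum>i\<in>Basis. gk t z * ((z::'a) \<bullet> i)\<^sup>2))"
    by (simp add: norm_power2_eq_sum_Basis sum_distrib_left)
  also have "\<dots> = (\<Sum>i\<in>(Basis::'a set). t)"
    using integrable_gk_inner(2)[OF t]
    by (subst Bochner_Integration.integral_sum) (auto simp: integral_gk_inner2[OF t])
  finally show ?thesis by simp
qed

section \<open>Gaussian smoothing\<close>

locale gaussian_smoothing = prob_space \<mu> for \<mu> :: "'a::euclidean_space measure" +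
  assumes sets_mu [measurable_cong]: "sets \<mu> = sets borel"
    and moment2: "integrable \<mu> (\<lambda>x. (norm x)\<^sup>2)"
begin

text \<open>For \<open>X\<close> distributed as \<open>\<mu>\<close>, \<open>h t\<close> is the
  density of \<open>Y = X + \<surd>t Z\<close>. Divided by \<open>h\<close>, the functions
  \<open>m\<close>, \<open>q i\<close> and \<open>q2\<close> are the conditional expectations, given
  \<open>Y = y\<close>, of the noise \<open>y - X\<close>, of the square of its component along
  \<open>i\<close> and of its squared norm. The derivatives of \<open>h\<close> are expressed
  through them.\<close>

definition h :: "real \<Rightarrow> 'a \<Rightarrow> real" where
  "h t y = (\<integral>x. gk t (y - x) \<partial>\<mu>)"

definition m :: "real \<Rightarrow> 'a \<Rightarrow> 'a" where
  "m t y = (\<integral>x. gk t (y - x) *\<^sub>R (y - x) \<partial>\<mu>)"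

definition q :: "'a \<Rightarrow> real \<Rightarrow> 'a \<Rightarrow> real" where
  "q i t y = (\<integral>x. gk t (y - x) * ((y - x) \<bullet> i)\<^sup>2 \<partial>\<mu>)"

definition q2 :: "real \<Rightarrow> 'a \<Rightarrow> real" where
  "q2 t y = (\<integral>x. gk t (y - x) * (norm (y - x))\<^sup>2 \<partial>\<mu>)"

definition m2 :: real where
  "m2 = (\<integral>x. (norm x)\<^sup>2 \<partial>\<mu>)"

lemma space_mu [simp]: "space \<mu> = UNIV"
  using sets_eq_imp_space_eq[OF sets_mu] by simp

lemma prob_UNIV [simp]: "prob UNIV = 1"
  using prob_space by simp

lemma m2_nonneg: "m2 \<ge> 0"
  unfolding m2_def by simp

lemma sigma_finite_lborel_mu: "sigma_finite_measure \<mu>" ..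

lemma pair_sigma_finite_mu: "pair_sigma_finite \<mu> (lborel :: 'a measure)"
  by (intro pair_sigma_finite.intro sigma_finite_lborel_mu) (rule lborel.sigma_finite_measure_axioms)

sublocale ml: pair_sigma_finite \<mu> "lborel :: 'a measure"
  by (rule pair_sigma_finite_mu)

lemma integrable_bounded:
  assumes [measurable]: "f \<in> borel_measurable borel" and "\<And>x. norm (f x) \<le> C"
  shows "integrable \<mu> (f :: 'a \<Rightarrow> 'b::{banach, second_countable_topology})"
  by (rule integrable_const_bound[where B = C]) (use assms in auto)

lemma continuous_on_convolution:
  fixes k :: "'a \<Rightarrow> real"
  assumes c: "continuous_on UNIV k" and b: "\<And>z. \<bar>k z\<bar> \<le> C"
  shows "continuous_on UNIV (\<lambda>y. \<integral>x. k (y - x) \<partial>\<mu>)"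
proof -
  have [measurable]: "k \<in> borel_measurable borel" using c by (rule borel_measurable_continuous_onI)
  show ?thesis
    unfolding continuous_on_sequentially comp_def
  proof safe
    fix X y assume X: "X \<longlonglongrightarrow> (y :: 'a)"
    show "(\<lambda>n. \<integral>x. k (X n - x) \<partial>\<mu>) \<longlonglongrightarrow> (\<integral>x. k (y - x) \<partial>\<mu>)"
    proof (rule integral_dominated_convergence[where w = "\<lambda>_. C"])
      have "isCont k z" for z using c by (simp add: continuous_on_eq_continuous_at)
      then show "AE x in \<mu>. (\<lambda>n. k (X n - x)) \<longlonglongrightarrow> k (y - x)"
        using X by (intro AE_I2 isCont_tendsto_compose[where g = k] tendsto_intros) auto
    qed (use b in auto)
  qed
qed

lemma continuous_on_convolution_vec:
  fixes k :: "'a \<Rightarrow> 'a"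
  assumes c: "continuous_on UNIV k" and b: "\<And>z. norm (k z) \<le> C"
  shows "continuous_on UNIV (\<lambda>y. \<integral>x. k (y - x) \<partial>\<mu>)"
proof -
  have [measurable]: "k \<in> borel_measurable borel" using c by (rule borel_measurable_continuous_onI)
  have i: "integrable \<mu> (\<lambda>x. k (y - x))" for y by (rule integrable_bounded) (use b in auto)
  have "continuous_on UNIV (\<lambda>y. (\<integral>x. k (y - x) \<partial>\<mu>) \<bullet> e)" for e
  proof -
    have "continuous_on UNIV (\<lambda>y. \<integral>x. k (y - x) \<bullet> e \<partial>\<mu>)"
    proof (rule continuous_on_convolution[where k = "\<lambda>z. k z \<bullet> e" and C = "C * norm e"])
      show "continuous_on UNIV (\<lambda>z. k z \<bullet> e)" by (intro continuous_intros c)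
      show "\<bar>k z \<bullet> e\<bar> \<le> C * norm e" for z
        by (rule order_trans[OF Cauchy_Schwarz_ineq2]) (intro mult_right_mono b, simp)
    qed
    then show ?thesis using i by simp
  qed
  then show ?thesis by (subst continuous_on_componentwise) blast
qed

lemma gk_bounds:
  assumes t: "t > 0"
  obtains C where "C > 0" "\<And>z::'a. gk t z \<le> C" "\<And>z::'a. gk t z * norm z \<le> C"
    "\<And>z::'a. gk t z * (norm z)\<^sup>2 \<le> C"
proof -
  obtain C where C: "C > 0" "\<And>z::'a. gk t z * (1 + (norm z)\<^sup>2) \<le> C"
    using gk_moment_bounded[of t t] t by (metis order_refl)
  show ?thesis
  proof (rule that[of C])
    fix z :: 'a
    show "gk t z \<le> C" by (rule order_trans[OF _ C(2)[of z]]) (simp add: distrib_left)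
    show "gk t z * norm z \<le> C"
      by (rule order_trans[OF _ C(2)[of z]]) (intro mult_left_mono norm_le_one_plus_power2, simp)
    show "gk t z * (norm z)\<^sup>2 \<le> C" by (rule order_trans[OF _ C(2)[of z]]) (simp add: distrib_left)
  qed (fact C(1))
qed

lemma inner_power2_le:
  fixes z i :: 'a
  shows "(z \<bullet> i)\<^sup>2 \<le> (norm z)\<^sup>2 * (norm i)\<^sup>2"
  by (metis Cauchy_Schwarz_ineq power2_norm_eq_inner)

lemma integrable_kernel:
  assumes t: "t > 0"
  shows "integrable \<mu> (\<lambda>x. gk t (y - x))" "integrable \<mu> (\<lambda>x. gk t (y - x) *\<^sub>R (y - x))"
    "integrable \<mu> (\<lambda>x. gk t (y - x) * (norm (y - x))\<^sup>2)"
    "integrable \<mu> (\<lambda>x. gk t (y - x) * ((y - x) \<bullet> i)\<^sup>2)"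
    "integrable \<mu> (\<lambda>x. gk t (y - x) * ((y - x) \<bullet> i))"
proof -
  obtain C where C: "C > 0" "\<And>z::'a. gk t z \<le> C" "\<And>z::'a. gk t z * norm z \<le> C"
    "\<And>z::'a. gk t z * (norm z)\<^sup>2 \<le> C"
    using gk_bounds[OF t] by metis
  show "integrable \<mu> (\<lambda>x. gk t (y - x))" by (rule integrable_bounded[of _ C]) (use C in auto)
  show 1: "integrable \<mu> (\<lambda>x. gk t (y - x) *\<^sub>R (y - x))"
    by (rule integrable_bounded[of _ C]) (use C in auto)
  show "integrable \<mu> (\<lambda>x. gk t (y - x) * ((y - x) \<bullet> i))"
    using integrable_inner_left[OF 1, of i] by simp
  show 2: "integrable \<mu> (\<lambda>x. gk t (y - x) * (norm (y - x))\<^sup>2)"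
    by (rule integrable_bounded[of _ C]) (use C in \<open>auto simp: abs_mult\<close>)
  have "gk t (y - x) * ((y - x) \<bullet> i)\<^sup>2 \<le> (norm i)\<^sup>2 * (gk t (y - x) * (norm (y - x))\<^sup>2)" for x
    using mult_left_mono[OF inner_power2_le[of "y - x" i] gk_nonneg[of t "y - x"]] by (simp add: ac_simps)
  then show "integrable \<mu> (\<lambda>x. gk t (y - x) * ((y - x) \<bullet> i)\<^sup>2)"
    by (intro Bochner_Integration.integrable_bound[OF integrable_mult_right[OF 2, of "(norm i)\<^sup>2"]])
      (auto simp: abs_mult)
qed

lemma h_measurable [measurable]: "h t \<in> borel_measurable borel"
  unfolding h_def[abs_def] by measurable

lemma m_measurable [measurable]: "m t \<in> borel_measurable borel"
  unfolding m_def[abs_def] by measurable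

lemma q_measurable [measurable]: "q i t \<in> borel_measurable borel"
  unfolding q_def[abs_def] by measurable

lemma q2_measurable [measurable]: "q2 t \<in> borel_measurable borel"
  unfolding q2_def[abs_def] by measurable

lemma h_nonneg: "h t y \<ge> 0"
  unfolding h_def by simp

lemma m_inner: "t > 0 \<Longrightarrow> m t y \<bullet> i = (\<integral>x. gk t (y - x) * ((y - x) \<bullet> i) \<partial>\<mu>)"
  unfolding m_def by (subst integral_inner_left[symmetric]) (auto intro: integrable_kernel)

lemma q2_eq: "t > 0 \<Longrightarrow> q2 t y = (\<Sum>i\<in>Basis. q i t y)"
  unfolding q2_def q_def norm_power2_eq_sum_Basis sum_distrib_left
  by (intro Bochner_Integration.integral_sum integrable_kernel)

lemma moment2_shift: "integrable \<mu> (\<lambda>x. (norm (y - x))\<^sup>2)"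
  and moment2_shift_le: "(\<integral>x. (norm (y - x))\<^sup>2 \<partial>\<mu>) \<le> 2 * (norm y)\<^sup>2 + 2 * m2"
proof -
  have i: "integrable \<mu> (\<lambda>x. 2 * (norm y)\<^sup>2 + 2 * (norm x)\<^sup>2)" using moment2 by simp
  show 1: "integrable \<mu> (\<lambda>x. (norm (y - x))\<^sup>2)"
    by (rule Bochner_Integration.integrable_bound[OF i]) (use norm_diff_power2_le[of y] in auto)
  have "(\<integral>x. (norm (y - x))\<^sup>2 \<partial>\<mu>) \<le> (\<integral>x. 2 * (norm y)\<^sup>2 + 2 * (norm x)\<^sup>2 \<partial>\<mu>)"
    by (intro integral_mono 1 i norm_diff_power2_le)
  also have "\<dots> = 2 * (norm y)\<^sup>2 + 2 * m2" using moment2 unfolding m2_def by (simp add: prob_space)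
  finally show "(\<integral>x. (norm (y - x))\<^sup>2 \<partial>\<mu>) \<le> 2 * (norm y)\<^sup>2 + 2 * m2" .
qed

lemma exp_integral_le:
  fixes W :: "'a \<Rightarrow> real"
  assumes "integrable \<mu> W" "integrable \<mu> (\<lambda>x. exp (W x))"
  shows "exp (\<integral>x. W x \<partial>\<mu>) \<le> (\<integral>x. exp (W x) \<partial>\<mu>)"
proof -
  let ?m = "\<integral>x. W x \<partial>\<mu>"
  have "exp ?m * (1 + (W x - ?m)) \<le> exp (W x)" for x
    using exp_ge_add_one_self[of "W x - ?m"] by (simp add: exp_diff field_simps)
  then have "(\<integral>x. exp ?m * (1 + (W x - ?m)) \<partial>\<mu>) \<le> (\<integral>x. exp (W x) \<partial>\<mu>)"
    using assms by (intro integral_mono) auto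
  then show ?thesis using assms by (simp add: prob_space)
qed

text \<open>Jensen's inequality for the exponential: \<open>gk t (y - x)\<close> is the exponential
  of a quadratic polynomial in \<open>x\<close>, whose mean is finite by \<open>moment2\<close>. So
  \<open>ln h\<close> decreases at most quadratically, and second moments suffice for the entropy
  integrals.\<close>

lemma h_lower:
  assumes t: "t > 0"
  shows "h t y > 0"
    and "ln (h t y) \<ge> - (real DIM('a) / 2) * ln (2 * pi * t) - ((norm y)\<^sup>2 + m2) / t"
proof -
  let ?W = "\<lambda>x. - (real DIM('a) / 2) * ln (2 * pi * t) - (norm (y - x))\<^sup>2 / (2 * t)"
  have eW: "exp (?W x) = gk t (y - x)" for x
    unfolding ln_gk[OF t, symmetric] using gk_pos[OF t] by simp
  have iW: "integrable \<mu> ?W" using moment2_shift by simp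
  have e: "exp (\<integral>x. ?W x \<partial>\<mu>) \<le> h t y"
    unfolding h_def eW[symmetric] by (rule exp_integral_le[OF iW]) (simp only: eW integrable_kernel(1)[OF t])
  then show 1: "h t y > 0" using less_le_trans[OF exp_gt_zero] by blast
  have "(\<integral>x. ?W x \<partial>\<mu>) \<le> ln (h t y)" using e 1 by (metis ln_exp ln_mono exp_gt_zero)
  moreover have "(\<integral>x. ?W x \<partial>\<mu>) = - (real DIM('a) / 2) * ln (2 * pi * t) - (\<integral>x. (norm (y - x))\<^sup>2 \<partial>\<mu>) / (2 * t)"
    using moment2_shift by (simp add: prob_space)
  moreover have "(\<integral>x. (norm (y - x))\<^sup>2 \<partial>\<mu>) / (2 * t) \<le> ((norm y)\<^sup>2 + m2) / t"
    using moment2_shift_le[of y] t by (simp add: field_simps)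
  ultimately show "ln (h t y) \<ge> - (real DIM('a) / 2) * ln (2 * pi * t) - ((norm y)\<^sup>2 + m2) / t" by linarith
qed

lemma h_upper:
  assumes t: "t > 0"
  shows "h t y \<le> (2 * pi * t) powr (- (real DIM('a) / 2))"
proof -
  have "h t y \<le> (\<integral>x. (2 * pi * t) powr (- (real DIM('a) / 2)) \<partial>\<mu>)"
    unfolding h_def by (intro integral_mono integrable_kernel t gk_le) auto
  then show ?thesis by (simp add: prob_space)
qed

lemma ln_h_bounded:
  assumes \<tau>: "0 < \<tau>" "\<tau> \<le> T"
  obtains C where "C > 0" "\<And>t y. \<tau> \<le> t \<Longrightarrow> t \<le> T \<Longrightarrow> \<bar>ln (h t y)\<bar> \<le> C * (1 + (norm y)\<^sup>2)"
proof -
  let ?d = "real DIM('a) / 2"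
  let ?L = "\<bar>ln (2 * pi * \<tau>)\<bar> + \<bar>ln (2 * pi * T)\<bar>"
  let ?C = "?d * ?L + (1 + m2) / \<tau>"
  have "\<bar>ln (h t y)\<bar> \<le> ?C * (1 + (norm y)\<^sup>2)" if t: "\<tau> \<le> t" "t \<le> T" for t y
  proof -
    have t0: "t > 0" using \<tau> t by simp
    have l: "\<bar>ln (2 * pi * t)\<bar> \<le> ?L"
    proof -
      have "ln (2 * pi * \<tau>) \<le> ln (2 * pi * t)" "ln (2 * pi * t) \<le> ln (2 * pi * T)"
        using \<tau> t t0 by auto
      then show ?thesis by linarith
    qed
    then have l2: "\<bar>?d * ln (2 * pi * t)\<bar> \<le> ?d * ?L" by (simp add: abs_mult mult_left_mono)
    have "ln (h t y) \<le> ln ((2 * pi * t) powr (- ?d))"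
      using h_upper[OF t0] h_lower(1)[OF t0] by (intro ln_mono) auto
    then have u: "ln (h t y) \<le> - ?d * ln (2 * pi * t)" using t0 by (simp add: ln_powr)
    have "((norm y)\<^sup>2 + m2) / t \<le> ((norm y)\<^sup>2 + m2) / \<tau>"
      using \<tau> t m2_nonneg by (intro divide_left_mono) auto
    also have "\<dots> \<le> (1 + m2) / \<tau> * (1 + (norm y)\<^sup>2)"
      using \<tau> m2_nonneg by (simp add: field_simps)
    finally have v: "((norm y)\<^sup>2 + m2) / t \<le> (1 + m2) / \<tau> * (1 + (norm y)\<^sup>2)" .
    have "?d * ?L \<le> ?d * ?L * (1 + (norm y)\<^sup>2)"
      using mult_left_mono[of 1 "1 + (norm y)\<^sup>2" "?d * ?L"] by simp
    moreover have "0 \<le> (1 + m2) / \<tau> * (1 + (norm y)\<^sup>2)" using \<tau> m2_nonneg by simp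
    ultimately show ?thesis
      using u v l2 h_lower(2)[OF t0, of y] unfolding distrib_right by linarith
  qed
  moreover have "?C > 0" using \<tau> m2_nonneg by (intro add_nonneg_pos) auto
  ultimately show ?thesis using that by blast
qed

end

lemma integral_gk_shift:
  fixes x :: "'a::euclidean_space"
  assumes t: "t > 0"
  shows "has_bochner_integral lborel (\<lambda>y. gk t (y - x)) 1"
    "has_bochner_integral lborel (\<lambda>y. gk t (y - x) *\<^sub>R (y - x)) 0"
    "has_bochner_integral lborel (\<lambda>y. gk t (y - x) * (norm (y - x))\<^sup>2) (real DIM('a) * t)"
    "has_bochner_integral lborel (\<lambda>y. gk t (y - x) *\<^sub>R y) x"
    "has_bochner_integral lborel (\<lambda>y. gk t (y - x) * (norm y)\<^sup>2) ((norm x)\<^sup>2 + real DIM('a) * t)"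
    "has_bochner_integral lborel (\<lambda>y. gk t (y - x) * (y \<bullet> (y - x))) (real DIM('a) * t)"
proof -
  have tr: "has_bochner_integral lborel (\<lambda>y. F (y - x)) c" if "has_bochner_integral lborel F c"
    for F :: "'a \<Rightarrow> 'b::{banach, second_countable_topology}" and c
    using that integrable_lborel_translation[of F x] integral_lborel_translation[of F x]
    by (auto simp: has_bochner_integral_iff)
  show 1: "has_bochner_integral lborel (\<lambda>y. gk t (y - x)) 1"
    by (rule tr[of "gk t"]) (use t in \<open>simp add: has_bochner_integral_iff\<close>)
  show 2: "has_bochner_integral lborel (\<lambda>y. gk t (y - x) *\<^sub>R (y - x)) 0"
    by (rule tr[of "\<lambda>z. gk t z *\<^sub>R z"])
      (use integrable_gk_inner(3)[OF t] integral_gk_scaleR[OF t] in \<open>simp add: has_bochner_integral_iff\<close>)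
  show 3: "has_bochner_integral lborel (\<lambda>y. gk t (y - x) * (norm (y - x))\<^sup>2) (real DIM('a) * t)"
    by (rule tr[of "\<lambda>z. gk t z * (norm z)\<^sup>2"])
      (use integrable_gk_inner(4)[OF t] integral_gk_norm2[OF t] in \<open>simp add: has_bochner_integral_iff\<close>)
  have "has_bochner_integral lborel (\<lambda>y. gk t (y - x) *\<^sub>R (y - x) + gk t (y - x) *\<^sub>R x) (0 + 1 *\<^sub>R x)"
    by (intro has_bochner_integral_add 2 has_bochner_integral_scaleR_left 1)
  then show "has_bochner_integral lborel (\<lambda>y. gk t (y - x) *\<^sub>R y) x"
    by (simp add: scaleR_add_right[symmetric])
  have 4: "has_bochner_integral lborel (\<lambda>y. (gk t (y - x) *\<^sub>R (y - x)) \<bullet> x) (0 \<bullet> x)"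
    by (intro has_bochner_integral_inner_left 2)
  have "has_bochner_integral lborel (\<lambda>y. gk t (y - x) * (norm (y - x))\<^sup>2 +
      2 * ((gk t (y - x) *\<^sub>R (y - x)) \<bullet> x) + gk t (y - x) * (norm x)\<^sup>2)
      (real DIM('a) * t + 2 * (0 \<bullet> x) + 1 * (norm x)\<^sup>2)"
    by (intro has_bochner_integral_add 3 has_bochner_integral_mult_left has_bochner_integral_mult_right 1 4)
  moreover have "gk t (y - x) * (norm (y - x))\<^sup>2 +
      2 * ((gk t (y - x) *\<^sub>R (y - x)) \<bullet> x) + gk t (y - x) * (norm x)\<^sup>2 = gk t (y - x) * (norm y)\<^sup>2" for y
    unfolding power2_norm_eq_inner by (simp add: algebra_simps inner_commute)
  ultimately show "has_bochner_integral lborel (\<lambda>y. gk t (y - x) * (norm y)\<^sup>2) ((norm x)\<^sup>2 + real DIM('a) * t)"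
    by (simp add: add.commute)
  have "has_bochner_integral lborel (\<lambda>y. gk t (y - x) * (norm (y - x))\<^sup>2 +
      (gk t (y - x) *\<^sub>R (y - x)) \<bullet> x) (real DIM('a) * t + 0 \<bullet> x)"
    by (intro has_bochner_integral_add 3 4)
  moreover have "gk t (y - x) * (norm (y - x))\<^sup>2 + (gk t (y - x) *\<^sub>R (y - x)) \<bullet> x = gk t (y - x) * (y \<bullet> (y - x))" for y
    unfolding power2_norm_eq_inner by (simp add: algebra_simps inner_commute)
  ultimately show "has_bochner_integral lborel (\<lambda>y. gk t (y - x) * (y \<bullet> (y - x))) (real DIM('a) * t)"
    by simp
qed

section \<open>Joint integrability, and derivatives of the smoothed density in space and
  time\<close>

context gaussian_smoothing
begin

text \<open>A common majorant for applying Fubini's theorem to \<open>\<mu>\<close> and Lebesgue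
  measure: integrating out \<open>y\<close> leaves a multiple of \<open>1 + |x|^2\<close> plus a
  constant.\<close>

lemma integrable_joint:
  assumes t: "t > 0"
  shows "integrable (\<mu> \<Otimes>\<^sub>M lborel) (\<lambda>(x, y). gk t (y - x) * (1 + (norm x)\<^sup>2 + (norm y)\<^sup>2))"
proof (rule ml.Fubini_integrable)
  have *: "has_bochner_integral lborel (\<lambda>y. gk t (y - x) * (1 + (norm x)\<^sup>2) + gk t (y - x) * (norm y)\<^sup>2)
    (1 * (1 + (norm x)\<^sup>2) + ((norm x)\<^sup>2 + real DIM('a) * t))" for x :: 'a
    by (intro has_bochner_integral_add has_bochner_integral_mult_left integral_gk_shift t)
  then have **: "has_bochner_integral lborel (\<lambda>y. gk t (y - x) * (1 + (norm x)\<^sup>2 + (norm y)\<^sup>2))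
    (1 + 2 * (norm x)\<^sup>2 + real DIM('a) * t)" for x :: 'a
  proof -
    have "(\<lambda>y. gk t (y - x) * (1 + (norm x)\<^sup>2) + gk t (y - x) * (norm y)\<^sup>2) =
        (\<lambda>y. gk t (y - x) * (1 + (norm x)\<^sup>2 + (norm y)\<^sup>2))"
      by (simp add: distrib_left add.assoc)
    moreover have "1 * (1 + (norm x)\<^sup>2) + ((norm x)\<^sup>2 + real DIM('a) * t) = 1 + 2 * (norm x)\<^sup>2 + real DIM('a) * t"
      by simp
    ultimately show ?thesis using *[of x] by (simp only:)
  qed
  show "integrable \<mu> (\<lambda>x. \<integral>y. norm (case (x, y) of (x, y) \<Rightarrow> gk t (y - x) * (1 + (norm x)\<^sup>2 + (norm y)\<^sup>2)) \<partial>lborel)"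
    using ** moment2 by (simp add: has_bochner_integral_iff abs_mult)
  show "AE x in \<mu>. integrable lborel (\<lambda>y. case (x, y) of (x, y) \<Rightarrow> gk t (y - x) * (1 + (norm x)\<^sup>2 + (norm y)\<^sup>2))"
    using ** by (simp add: has_bochner_integral_iff)
qed measurable

lemma integrable_joint_bound:
  fixes P :: "'a \<Rightarrow> 'a \<Rightarrow> 'b::{banach, second_countable_topology}"
  assumes t: "t > 0" and m: "(\<lambda>(x, y). P x y) \<in> borel_measurable (borel \<Otimes>\<^sub>M borel)"
    and b: "\<And>x y. norm (P x y) \<le> C * (gk t (y - x) * (1 + (norm x)\<^sup>2 + (norm y)\<^sup>2))"
  shows "integrable (\<mu> \<Otimes>\<^sub>M lborel) (\<lambda>(x, y). P x y)"
proof (rule Bochner_Integration.integrable_bound[OF integrable_mult_right[OF integrable_joint[OF t], of C]])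
  have "sets (\<mu> \<Otimes>\<^sub>M lborel) = sets (borel \<Otimes>\<^sub>M (borel :: 'a measure))"
    by (intro sets_pair_measure_cong) (simp_all add: sets_mu)
  then show "(\<lambda>(x, y). P x y) \<in> borel_measurable (\<mu> \<Otimes>\<^sub>M lborel)"
    using m by (simp cong: measurable_cong_sets)
  show "AE z in \<mu> \<Otimes>\<^sub>M lborel. norm (case z of (x, y) \<Rightarrow> P x y)
      \<le> norm (C * (case z of (x, y) \<Rightarrow> gk t (y - x) * (1 + (norm x)\<^sup>2 + (norm y)\<^sup>2)))"
    by (intro AE_I2) (use b in \<open>auto intro: order_trans[OF _ abs_ge_self]\<close>)
qed

lemma integrable_h_moment:
  assumes t: "t > 0"
  shows "integrable lborel (\<lambda>y. (1 + (norm y)\<^sup>2) * h t y)"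
proof -
  have "integrable (\<mu> \<Otimes>\<^sub>M lborel) (\<lambda>(x, y). gk t (y - x) * (1 + (norm y)\<^sup>2))"
    by (rule integrable_joint_bound[OF t, where C = 1]) (auto simp: abs_mult intro!: mult_left_mono)
  from ml.integrable_snd[OF this] show ?thesis
    unfolding h_def by (simp add: mult.commute)
qed

text \<open>Tweedie's formula: the score of the smoothed law is minus the conditional mean of the
  noise, divided by \<open>t\<close>.\<close>

lemma h_line:
  assumes t: "t > 0" and i: "norm i = 1"
  shows "((\<lambda>s. h t (y + s *\<^sub>R i)) has_real_derivative - (m t y \<bullet> i) / t) (at 0)"
proof -
  obtain C where C: "C > 0" "\<And>z::'a. gk t z \<le> C" "\<And>z::'a. gk t z * norm z \<le> C"
    using gk_bounds[OF t] by metis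
  let ?z = "\<lambda>s x. (y - x) + s *\<^sub>R i"
  have "((\<lambda>s. \<integral>x. gk t (?z s x) \<partial>\<mu>) has_real_derivative (\<integral>x. - (?z 0 x \<bullet> i) / t * gk t (?z 0 x) \<partial>\<mu>)) (at 0)"
  proof (rule has_real_derivative_integral(1)[where a = "-1" and b = 1 and B = "\<lambda>_. C / t"])
    show "((\<lambda>s. gk t (?z s x)) has_real_derivative - (?z s x \<bullet> i) / t * gk t (?z s x)) (at s)" for s x
      using gk_has_derivative_line[of t "y - x" i s] t by simp
    show "\<bar>- (?z s x \<bullet> i) / t * gk t (?z s x)\<bar> \<le> C / t" for s x
    proof -
      have "\<bar>?z s x \<bullet> i\<bar> \<le> norm (?z s x)" using Cauchy_Schwarz_ineq2[of "?z s x" i] i by simp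
      then have "\<bar>?z s x \<bullet> i\<bar> * gk t (?z s x) \<le> norm (?z s x) * gk t (?z s x)"
        by (intro mult_right_mono) auto
      also have "\<dots> \<le> C" using C(3) by (simp add: mult.commute)
      finally show ?thesis using t by (simp add: abs_mult divide_right_mono)
    qed
    show "integrable \<mu> (\<lambda>x. gk t (?z s x))" for s
      using integrable_kernel(1)[OF t, of "y + s *\<^sub>R i"] by (simp add: algebra_simps)
  qed auto
  moreover have "(\<integral>x. - (?z 0 x \<bullet> i) / t * gk t (?z 0 x) \<partial>\<mu>) = - (m t y \<bullet> i) / t"
    unfolding m_inner[OF t] by (simp add: mult.commute)
  moreover have "(\<lambda>s. h t (y + s *\<^sub>R i)) = (\<lambda>s. \<integral>x. gk t (?z s x) \<partial>\<mu>)"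
    unfolding h_def by (simp add: algebra_simps)
  ultimately show ?thesis using t by simp
qed

lemma m_line:
  assumes t: "t > 0" and i: "norm i = 1"
  shows "((\<lambda>s. m t (y + s *\<^sub>R i) \<bullet> i) has_real_derivative h t y - q i t y / t) (at 0)"
proof -
  obtain C where C: "C > 0" "\<And>z::'a. gk t z \<le> C" "\<And>z::'a. gk t z * norm z \<le> C"
      "\<And>z::'a. gk t z * (norm z)\<^sup>2 \<le> C"
    using gk_bounds[OF t] by metis
  let ?z = "\<lambda>s x. (y - x) + s *\<^sub>R i"
  let ?f = "\<lambda>s x. gk t (?z s x) * (?z s x \<bullet> i)"
  let ?f' = "\<lambda>s x. gk t (?z s x) - gk t (?z s x) * (?z s x \<bullet> i)\<^sup>2 / t"
  have "((\<lambda>s. \<integral>x. ?f s x \<partial>\<mu>) has_real_derivative (\<integral>x. ?f' 0 x \<partial>\<mu>)) (at 0)"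
  proof (rule has_real_derivative_integral(1)[where a = "-1" and b = 1 and B = "\<lambda>_. C + C / t"])
    show "((\<lambda>s. ?f s x) has_real_derivative ?f' s x) (at s)" for s x
    proof -
      have "((\<lambda>s. ?z s x \<bullet> i) has_real_derivative 1) (at s)"
        using i by (auto simp: inner_add_left dot_square_norm intro!: derivative_eq_intros)
      from DERIV_mult[OF gk_has_derivative_line[of t "y - x" i s] this] t
      show ?thesis by (simp add: power2_eq_square ac_simps)
    qed
    show "\<bar>?f' s x\<bar> \<le> C + C / t" for s x
    proof -
      have "(?z s x \<bullet> i)\<^sup>2 \<le> (norm (?z s x))\<^sup>2" using inner_power2_le[of "?z s x" i] i by simp
      then have "gk t (?z s x) * (?z s x \<bullet> i)\<^sup>2 \<le> gk t (?z s x) * (norm (?z s x))\<^sup>2"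
        by (intro mult_left_mono) auto
      also have "\<dots> \<le> C" by (rule C(4))
      finally have "gk t (?z s x) * (?z s x \<bullet> i)\<^sup>2 / t \<le> C / t" using t by (simp add: divide_right_mono)
      moreover have "0 \<le> gk t (?z s x) * (?z s x \<bullet> i)\<^sup>2 / t" using t by simp
      ultimately show ?thesis using C(2)[of "?z s x"] gk_nonneg[of t "?z s x"] C(1) by linarith
    qed
    show "integrable \<mu> (?f s)" for s
      using integrable_kernel(5)[OF t, of "y + s *\<^sub>R i" i] by (simp add: algebra_simps)
  qed auto
  moreover have "(\<integral>x. ?f' 0 x \<partial>\<mu>) = h t y - q i t y / t"
    unfolding h_def q_def using integrable_kernel[OF t] by simp
  moreover have "(\<lambda>s. m t (y + s *\<^sub>R i) \<bullet> i) = (\<lambda>s. \<integral>x. ?f s x \<partial>\<mu>)"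
    unfolding m_inner[OF t] by (simp add: algebra_simps)
  ultimately show ?thesis by simp
qed

text \<open>Compared with \<open>h_line\<close> and \<open>m_line\<close> this is the heat equation,
  the time derivative being half the Laplacian; the two match because \<open>q2\<close> is the sum
  of the \<open>q i\<close> over the basis.\<close>

lemma h_time:
  assumes t: "t > 0"
  shows "((\<lambda>t. h t y) has_real_derivative q2 t y / (2 * t\<^sup>2) - real DIM('a) / (2 * t) * h t y) (at t)"
proof -
  obtain C where C: "C > 0"
    "\<And>r z. t / 2 \<le> r \<Longrightarrow> r \<le> 2 * t \<Longrightarrow> gk r (z::'a) * (1 + (norm z)\<^sup>2) \<le> C"
    using gk_moment_bounded[of "t / 2" "2 * t"] t by auto
  let ?f' = "\<lambda>r x. gk r (y - x) * ((norm (y - x))\<^sup>2 / (2 * r\<^sup>2) - real DIM('a) / (2 * r))"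
  let ?K = "2 / t\<^sup>2 + real DIM('a) / t"
  have "((\<lambda>r. \<integral>x. gk r (y - x) \<partial>\<mu>) has_real_derivative (\<integral>x. ?f' t x \<partial>\<mu>)) (at t)"
  proof (rule has_real_derivative_integral(1)[where a = "t / 2" and b = "2 * t" and B = "\<lambda>_. C * ?K"])
    fix r x assume r: "t / 2 < r" "r < 2 * t"
    then have r0: "r > 0" using t by simp
    show "((\<lambda>r. gk r (y - x)) has_real_derivative ?f' r x) (at r)"
      by (rule gk_has_derivative_scale[OF r0])
    have 1: "(norm (y - x))\<^sup>2 / (2 * r\<^sup>2) \<le> (1 + (norm (y - x))\<^sup>2) * (2 / t\<^sup>2)"
    proof -
      have "(t / 2)\<^sup>2 \<le> r\<^sup>2" using r t by (intro power_mono) auto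
      then have "(norm (y - x))\<^sup>2 / (2 * r\<^sup>2) \<le> (norm (y - x))\<^sup>2 / (2 * (t / 2)\<^sup>2)"
        using t by (intro divide_left_mono) (auto intro!: mult_pos_pos)
      also have "\<dots> = (norm (y - x))\<^sup>2 * (2 / t\<^sup>2)" by (simp add: power2_eq_square)
      also have "\<dots> \<le> (1 + (norm (y - x))\<^sup>2) * (2 / t\<^sup>2)" by (intro mult_right_mono) auto
      finally show ?thesis .
    qed
    have 2: "real DIM('a) / (2 * r) \<le> (1 + (norm (y - x))\<^sup>2) * (real DIM('a) / t)"
    proof -
      have "real DIM('a) / (2 * r) \<le> real DIM('a) / t" using r t by (intro divide_left_mono) auto
      also have "\<dots> \<le> (1 + (norm (y - x))\<^sup>2) * (real DIM('a) / t)"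
        using mult_right_mono[of 1 "1 + (norm (y - x))\<^sup>2" "real DIM('a) / t"] t by simp
      finally show ?thesis .
    qed
    have "\<bar>(norm (y - x))\<^sup>2 / (2 * r\<^sup>2) - real DIM('a) / (2 * r)\<bar>
        \<le> (norm (y - x))\<^sup>2 / (2 * r\<^sup>2) + real DIM('a) / (2 * r)"
      using r0 by (intro order_trans[OF abs_triangle_ineq4]) simp
    also have "\<dots> \<le> (1 + (norm (y - x))\<^sup>2) * ?K" using 1 2 unfolding distrib_left by linarith
    finally have "\<bar>?f' r x\<bar> \<le> gk r (y - x) * ((1 + (norm (y - x))\<^sup>2) * ?K)"
      by (simp add: abs_mult mult_left_mono)
    also have "\<dots> = gk r (y - x) * (1 + (norm (y - x))\<^sup>2) * ?K" by simp
    also have "\<dots> \<le> C * ?K" using C(2)[of r "y - x"] r t by (intro mult_right_mono) auto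
    finally show "\<bar>?f' r x\<bar> \<le> C * ?K" .
    show "integrable \<mu> (\<lambda>x. gk r (y - x))" by (rule integrable_kernel(1)[OF r0])
  qed (use t in auto)
  moreover have "(\<integral>x. ?f' t x \<partial>\<mu>) = q2 t y / (2 * t\<^sup>2) - real DIM('a) / (2 * t) * h t y"
  proof -
    have "?f' t = (\<lambda>x. gk t (y - x) * (norm (y - x))\<^sup>2 / (2 * t\<^sup>2) - gk t (y - x) * (real DIM('a) / (2 * t)))"
      by (simp add: algebra_simps)
    then show ?thesis unfolding h_def q2_def using integrable_kernel[OF t] by simp
  qed
  ultimately show ?thesis unfolding h_def by simp
qed

end

section \<open>De Bruijn's identity\<close>

context gaussian_smoothing
begin

text \<open>Minus the differential entropy of \<open>X + \<surd>t Z\<close>; with this sign it is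
  nonincreasing in \<open>t\<close>.\<close>

definition entropy_h :: "real \<Rightarrow> real" where
  "entropy_h t = (LBINT y. h t y * ln (h t y))"

text \<open>The pointwise domination of the kernels survives integration over \<open>\<mu>\<close>;
  the second moment of \<open>h (2 * T)\<close> then makes it an integrable majorant for all times
  of the interval, even with a quadratic factor.\<close>

lemma h_q2_dominated:
  assumes \<tau>: "0 < \<tau>" "\<tau> \<le> T"
  obtains C where "C > 0" "\<And>t y. \<tau> \<le> t \<Longrightarrow> t \<le> T \<Longrightarrow> h t y \<le> C * h (2 * T) y"
    "\<And>t y. \<tau> \<le> t \<Longrightarrow> t \<le> T \<Longrightarrow> q2 t y \<le> C * h (2 * T) y"
proof -
  obtain C where C: "C > 0"
    "\<And>t z. \<tau> \<le> t \<Longrightarrow> t \<le> T \<Longrightarrow> gk t (z::'a) * (1 + (norm z)\<^sup>2) \<le> C * gk (2 * T) z"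
    using gk_dominated[OF \<tau>] by metis
  have T: "2 * T > 0" using \<tau> by simp
  have i: "integrable \<mu> (\<lambda>x. C * gk (2 * T) (y - x))" for y
    by (intro integrable_mult_right integrable_kernel T)
  have e: "(\<integral>x. C * gk (2 * T) (y - x) \<partial>\<mu>) = C * h (2 * T) y" for y
    unfolding h_def by simp
  show ?thesis
  proof (rule that[OF C(1)])
    fix t y assume t: "\<tau> \<le> t" "t \<le> T"
    then have t0: "t > 0" using \<tau> by simp
    show "h t y \<le> C * h (2 * T) y"
      unfolding e[symmetric] unfolding h_def
      by (intro integral_mono i integrable_kernel t0 order_trans[OF _ C(2)[OF t]]) (simp add: distrib_left)
    show "q2 t y \<le> C * h (2 * T) y"
      unfolding e[symmetric] unfolding q2_def
      by (intro integral_mono i integrable_kernel t0 order_trans[OF _ C(2)[OF t]]) (simp add: distrib_left)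
  qed
qed

text \<open>Cauchy-Schwarz given \<open>Y = y\<close>: the difference of the two sides is
  \<open>h\<close> times a conditional variance, and \<open>?c\<close> is the conditional mean of
  the noise component. It makes the integrand of the Fisher information integrable.\<close>

lemma m_power2_le:
  assumes t: "t > 0"
  shows "(m t y \<bullet> i)\<^sup>2 / h t y \<le> q i t y"
proof -
  note I = integrable_kernel[OF t]
  let ?c = "(m t y \<bullet> i) / h t y"
  have expand: "g * (z - c)\<^sup>2 = g * z\<^sup>2 - 2 * c * (g * z) + c\<^sup>2 * g" for g z c :: real
    by (simp add: power2_diff algebra_simps)
  have "0 \<le> (\<integral>x. gk t (y - x) * ((y - x) \<bullet> i - ?c)\<^sup>2 \<partial>\<mu>)" by simp
  also have "\<dots> = (\<integral>x. gk t (y - x) * ((y - x) \<bullet> i)\<^sup>2 - 2 * ?c * (gk t (y - x) * ((y - x) \<bullet> i))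
      + ?c\<^sup>2 * gk t (y - x) \<partial>\<mu>)"
    unfolding expand ..
  also have "\<dots> = q i t y - 2 * ?c * (m t y \<bullet> i) + ?c\<^sup>2 * h t y"
    unfolding m_inner[OF t] q_def h_def using I by simp
  also have "\<dots> = q i t y - (m t y \<bullet> i)\<^sup>2 / h t y"
    using h_lower(1)[OF t, of y] by (simp add: field_simps power2_eq_square)
  finally show ?thesis by simp
qed

lemma q_nonneg: "q i t y \<ge> 0" unfolding q_def by simp

lemma q2_nonneg: "q2 t y \<ge> 0" unfolding q2_def by simp

lemma q_le_q2:
  assumes t: "t > 0" and i: "norm i = 1"
  shows "q i t y \<le> q2 t y"
  unfolding q_def q2_def
  by (intro integral_mono integrable_kernel t mult_left_mono)
    (use inner_power2_le[of _ i] i in auto)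

lemma continuous_h: "t > 0 \<Longrightarrow> continuous_on UNIV (h t)"
  unfolding h_def[abs_def]
  by (rule gk_bounds[of t], simp, rule continuous_on_convolution, intro continuous_intros) auto

lemma continuous_m: "t > 0 \<Longrightarrow> continuous_on UNIV (m t)"
  unfolding m_def[abs_def]
  by (rule gk_bounds[of t], simp, rule continuous_on_convolution_vec[where k = "\<lambda>z. gk t z *\<^sub>R z"],
      intro continuous_intros) auto

lemma continuous_q:
  assumes t: "t > 0" and i: "norm i = 1"
  shows "continuous_on UNIV (q i t)"
proof -
  obtain C where C: "\<And>z::'a. gk t z * (norm z)\<^sup>2 \<le> C"
    using gk_bounds[OF t] by metis
  show ?thesis
    unfolding q_def[abs_def]
  proof (rule continuous_on_convolution[where k = "\<lambda>z. gk t z * (z \<bullet> i)\<^sup>2" and C = C])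
    show "continuous_on UNIV (\<lambda>z. gk t z * (z \<bullet> i)\<^sup>2)" using t by (intro continuous_intros) auto
    show "\<bar>gk t z * (z \<bullet> i)\<^sup>2\<bar> \<le> C" for z
    proof -
      have "gk t z * (z \<bullet> i)\<^sup>2 \<le> gk t z * (norm z)\<^sup>2"
        using inner_power2_le[of z i] i by (intro mult_left_mono) auto
      then show ?thesis using C[of z] by simp
    qed
  qed
qed

text \<open>\<open>ln h\<close> costs a factor \<open>1 + |y|^2\<close>, which is affordable because
  \<open>h (2 * t)\<close> has a second moment.\<close>

lemma integrable_ln_h_times:
  assumes t: "t > 0" and [measurable]: "g \<in> borel_measurable borel"
    and g: "\<And>y. \<bar>g y\<bar> \<le> C * h (2 * t) y" and C: "C \<ge> 0"
  shows "integrable lborel (\<lambda>y. g y)" "integrable lborel (\<lambda>y. ln (h t y) * g y)"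
proof -
  obtain L where L: "L > 0" "\<And>y. \<bar>ln (h t y)\<bar> \<le> L * (1 + (norm y)\<^sup>2)"
    using ln_h_bounded[of t t] t by (metis order_refl)
  have I: "integrable lborel (\<lambda>y. c * ((1 + (norm y)\<^sup>2) * h (2 * t) y))" for c
    using t by (intro integrable_mult_right integrable_h_moment) auto
  show "integrable lborel (\<lambda>y. g y)"
  proof (rule Bochner_Integration.integrable_bound[OF I[of C]])
    have "norm (g y) \<le> norm (C * ((1 + (norm y)\<^sup>2) * h (2 * t) y))" for y
    proof -
      have "C * h (2 * t) y \<le> C * ((1 + (norm y)\<^sup>2) * h (2 * t) y)"
        using h_nonneg[of "2 * t" y] C by (intro mult_left_mono) (auto simp: distrib_right)
      then show ?thesis using g[of y] by simp
    qed
    then show "AE y in lborel. norm (g y) \<le> norm (C * ((1 + (norm y)\<^sup>2) * h (2 * t) y))" by simp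
  qed simp
  show "integrable lborel (\<lambda>y. ln (h t y) * g y)"
  proof (rule Bochner_Integration.integrable_bound[OF I[of "L * C"]])
    have "norm (ln (h t y) * g y) \<le> norm (L * C * ((1 + (norm y)\<^sup>2) * h (2 * t) y))" for y
    proof -
      have "\<bar>ln (h t y)\<bar> * \<bar>g y\<bar> \<le> (L * (1 + (norm y)\<^sup>2)) * (C * h (2 * t) y)"
        using L(1) by (intro mult_mono L(2) g) auto
      also have "\<dots> = L * C * ((1 + (norm y)\<^sup>2) * h (2 * t) y)" by simp
      also have "\<dots> \<le> \<bar>L * C * ((1 + (norm y)\<^sup>2) * h (2 * t) y)\<bar>" by (rule abs_ge_self)
      finally show ?thesis by (simp only: real_norm_def abs_mult)
    qed
    then show "AE y in lborel. norm (ln (h t y) * g y) \<le> norm (L * C * ((1 + (norm y)\<^sup>2) * h (2 * t) y))" by simp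
  qed simp
qed

lemma integrable_densities:
  assumes t: "t > 0"
  shows "integrable lborel (h t)" "integrable lborel (\<lambda>y. ln (h t y) * h t y)"
    and "norm i = 1 \<Longrightarrow> integrable lborel (q i t)"
    and "norm i = 1 \<Longrightarrow> integrable lborel (\<lambda>y. ln (h t y) * q i t y)"
    and "norm i = 1 \<Longrightarrow> integrable lborel (\<lambda>y. (m t y \<bullet> i)\<^sup>2 / h t y)"
    and "norm i = 1 \<Longrightarrow> integrable lborel (\<lambda>y. m t y \<bullet> i)"
    and "norm i = 1 \<Longrightarrow> integrable lborel (\<lambda>y. ln (h t y) * (m t y \<bullet> i))"
proof -
  obtain C where C: "C > 0" "\<And>y. h t y \<le> C * h (2 * t) y" "\<And>y. q2 t y \<le> C * h (2 * t) y"
    using h_q2_dominated[of t t] t by (metis order_refl)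
  note I = integrable_ln_h_times[OF t, where C = C]
  have 1: "\<bar>h t y\<bar> \<le> C * h (2 * t) y" for y using C(2)[of y] h_nonneg[of t y] by simp
  have 2: "\<bar>q2 t y\<bar> \<le> C * h (2 * t) y" for y using C(3)[of y] q2_nonneg[of t y] by simp
  show "integrable lborel (h t)" "integrable lborel (\<lambda>y. ln (h t y) * h t y)"
    by (rule I; use 1 C in simp)+
  assume i: "norm i = 1"
  have 3: "\<bar>q i t y\<bar> \<le> C * h (2 * t) y" for y
    using 2[of y] q_nonneg[of i t y] q_le_q2[OF t i, of y] by simp
  show "integrable lborel (q i t)" "integrable lborel (\<lambda>y. ln (h t y) * q i t y)"
    by (rule I; use 3 C in simp)+
  have 4: "\<bar>(m t y \<bullet> i)\<^sup>2 / h t y\<bar> \<le> C * h (2 * t) y" for y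
    using 3[of y] m_power2_le[OF t, of y i] h_nonneg[of t y] by simp
  show "integrable lborel (\<lambda>y. (m t y \<bullet> i)\<^sup>2 / h t y)"
    by (rule I) (use 4 C in auto)
  have 5: "\<bar>m t y \<bullet> i\<bar> \<le> C * h (2 * t) y" for y
  proof -
    \<comment> \<open>Arithmetic-geometric mean inequality: the first moment is controlled by two
      quantities that are dominated already.\<close>
    have "2 * \<bar>m t y \<bullet> i\<bar> \<le> (m t y \<bullet> i)\<^sup>2 / h t y + h t y"
    proof -
      have p: "h t y > 0" by (rule h_lower(1)[OF t])
      have "0 \<le> (\<bar>m t y \<bullet> i\<bar> - h t y)\<^sup>2 / h t y" using p by simp
      also have "\<dots> = (m t y \<bullet> i)\<^sup>2 / h t y + h t y - 2 * \<bar>m t y \<bullet> i\<bar>"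
        using p by (simp add: power2_diff add_divide_distrib diff_divide_distrib) (simp add: power2_eq_square)
      finally show ?thesis by simp
    qed
    then show ?thesis using 4[of y] 1[of y] by linarith
  qed
  show "integrable lborel (\<lambda>y. m t y \<bullet> i)" "integrable lborel (\<lambda>y. ln (h t y) * (m t y \<bullet> i))"
    by (rule I; use 5 C in simp)+
qed

lemma integrable_h_ln_h: "t > 0 \<Longrightarrow> integrable lborel (\<lambda>y. h t y * ln (h t y))"
  using integrable_densities(2)[of t] by (simp add: mult.commute)

text \<open>Here \<open>q i t y / t\<^sup>2 - h t y / t\<close> is the second derivative of
  \<open>h\<close> along \<open>i\<close>, and \<open>- (m t y \<bullet> i) / t\<close> is the
  first. The function integrated by parts is \<open>1 + ln h\<close> times the first derivative,
  that is, the derivative of \<open>h ln h\<close> along \<open>i\<close>.\<close>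

lemma integration_by_parts_ln_h:
  assumes t: "t > 0" and i: "norm i = 1"
  shows "(LBINT y. (1 + ln (h t y)) * (q i t y / t\<^sup>2 - h t y / t))
    = - (LBINT y. (m t y \<bullet> i)\<^sup>2 / (t\<^sup>2 * h t y))"
proof -
  note I = integrable_densities[OF t] and p = h_lower(1)[OF t]
  let ?A = "\<lambda>y. (m t y \<bullet> i)\<^sup>2 / (t\<^sup>2 * h t y)"
  let ?B = "\<lambda>y. (1 + ln (h t y)) * (q i t y / t\<^sup>2 - h t y / t)"
  have iA: "integrable lborel ?A"
    using integrable_mult_right[OF I(5)[OF i], of "1 / t\<^sup>2"] by simp
  have "integrable lborel (\<lambda>y. q i t y / t\<^sup>2 - h t y / t + (ln (h t y) * q i t y) / t\<^sup>2 - (ln (h t y) * h t y) / t)"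
    using I(1,2) I(3,4)[OF i] by (intro Bochner_Integration.integrable_add Bochner_Integration.integrable_diff integrable_divide) auto
  then have iB: "integrable lborel ?B" by (simp add: algebra_simps add_divide_distrib)
  have "(LBINT y. ?A y + ?B y) = 0"
  proof (rule integral_directional_derivative_zero[where F = "\<lambda>y. (1 + ln (h t y)) * (- (m t y \<bullet> i) / t)" and i = i])
    have "integrable lborel (\<lambda>y. (m t y \<bullet> i + ln (h t y) * (m t y \<bullet> i)) / t)"
      using I(6,7)[OF i] by simp
    then show "integrable lborel (\<lambda>y. (1 + ln (h t y)) * (- (m t y \<bullet> i) / t))"
      by (simp add: algebra_simps)
    show "((\<lambda>s. (1 + ln (h t (y + s *\<^sub>R i))) * (- (m t (y + s *\<^sub>R i) \<bullet> i) / t))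
        has_real_derivative ?A y + ?B y) (at 0)" for y
    proof -
      have 1: "((\<lambda>s. 1 + ln (h t (y + s *\<^sub>R i))) has_real_derivative (- (m t y \<bullet> i) / t) / h t y) (at 0)"
        using h_line[OF t i, of y] p[of y] by (auto intro!: derivative_eq_intros)
      have 2: "((\<lambda>s. - (m t (y + s *\<^sub>R i) \<bullet> i) / t) has_real_derivative - (h t y - q i t y / t) / t) (at 0)"
        using t by (intro DERIV_cdivide DERIV_minus m_line t i)
      show ?thesis
        using DERIV_mult[OF 1 2] t p[of y]
        by (simp add: field_simps power2_eq_square)
    qed
    have "h t y \<noteq> 0" for y using p[of y] by simp
    then show "continuous_on UNIV (\<lambda>y. ?A y + ?B y)"
      using t p by (intro continuous_intros continuous_h continuous_m continuous_q t i) auto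
  qed (use iA iB in simp)
  then show ?thesis using iA iB by simp
qed

text \<open>De Bruijn's identity: as \<open>m\<close> is \<open>- t\<close> times the gradient of
  \<open>h\<close>, the integrand on the right is \<open>|grad h|^2 / h\<close>. The heat equation
  trades the time derivative for second space derivatives, and
  \<open>integration_by_parts_ln_h\<close> is summed over the basis.\<close>

lemma entropy_h_deriv:
  assumes t: "t > 0"
  shows "(entropy_h has_real_derivative
    - (1 / 2) * (LBINT y. (norm (m t y))\<^sup>2 / (t\<^sup>2 * h t y))) (at t)"
proof -
  let ?\<tau> = "t / 2" and ?T = "2 * t" and ?n = "real DIM('a)"
  obtain C where C: "C > 0" "\<And>r y. ?\<tau> \<le> r \<Longrightarrow> r \<le> ?T \<Longrightarrow> h r y \<le> C * h (2 * ?T) y"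
    "\<And>r y. ?\<tau> \<le> r \<Longrightarrow> r \<le> ?T \<Longrightarrow> q2 r y \<le> C * h (2 * ?T) y"
    using h_q2_dominated[of ?\<tau> ?T] t by auto
  obtain L where L: "L > 0" "\<And>r y. ?\<tau> \<le> r \<Longrightarrow> r \<le> ?T \<Longrightarrow> \<bar>ln (h r y)\<bar> \<le> L * (1 + (norm y)\<^sup>2)"
    using ln_h_bounded[of ?\<tau> ?T] t by auto
  let ?f' = "\<lambda>r y. (1 + ln (h r y)) * (q2 r y / (2 * r\<^sup>2) - ?n / (2 * r) * h r y)"
  let ?K = "(1 + L) * (C * (2 / t\<^sup>2 + ?n / t))"
  have D: "((\<lambda>r. \<integral>y. h r y * ln (h r y) \<partial>lborel) has_real_derivative (LBINT y. ?f' t y)) (at t)"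
  proof (rule has_real_derivative_integral(1)[where a = ?\<tau> and b = ?T
        and B = "\<lambda>y. ?K * ((1 + (norm y)\<^sup>2) * h (2 * ?T) y)"])
    fix r y assume r: "?\<tau> < r" "r < ?T"
    then have r0: "r > 0" using t by simp
    have p: "h r y > 0" by (rule h_lower(1)[OF r0])
    show "((\<lambda>r. h r y * ln (h r y)) has_real_derivative ?f' r y) (at r)"
    proof -
      define D where "D = q2 r y / (2 * r\<^sup>2) - ?n / (2 * r) * h r y"
      have 1: "((\<lambda>r. h r y) has_real_derivative D) (at r)" unfolding D_def by (rule h_time[OF r0])
      have 2: "((\<lambda>r. ln (h r y)) has_real_derivative D / h r y) (at r)"
        using 1 p by (auto intro!: derivative_eq_intros)
      show ?thesis
        unfolding D_def[symmetric] using DERIV_mult[OF 1 2] p by (simp add: algebra_simps)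
    qed
    show "\<bar>?f' r y\<bar> \<le> ?K * ((1 + (norm y)\<^sup>2) * h (2 * ?T) y)"
    proof -
      have a: "\<bar>1 + ln (h r y)\<bar> \<le> (1 + L) * (1 + (norm y)\<^sup>2)"
        using L(2)[of r y] r by (simp add: algebra_simps) (smt (verit) zero_le_power2)
      have H: "h (2 * ?T) y \<ge> 0" by (rule h_nonneg)
      have b1: "q2 r y / (2 * r\<^sup>2) \<le> (C * h (2 * ?T) y) * (2 / t\<^sup>2)"
      proof -
        have "(t / 2)\<^sup>2 \<le> r\<^sup>2" using r t by (intro power_mono) auto
        then have "1 / (2 * r\<^sup>2) \<le> 1 / (2 * (t / 2)\<^sup>2)"
          using t r0 by (intro divide_left_mono) (auto intro!: mult_pos_pos)
        then have "1 / (2 * r\<^sup>2) \<le> 2 / t\<^sup>2" by (simp add: power2_eq_square)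
        then have "q2 r y * (1 / (2 * r\<^sup>2)) \<le> (C * h (2 * ?T) y) * (2 / t\<^sup>2)"
          using r C(1) H by (intro mult_mono C(3)) auto
        then show ?thesis by simp
      qed
      have b2: "?n / (2 * r) * h r y \<le> (?n / t) * (C * h (2 * ?T) y)"
        using r t r0 C(1) h_nonneg[of r y]
        by (intro mult_mono C(2)) (auto intro!: divide_left_mono mult_pos_pos)
      have b3: "0 \<le> q2 r y / (2 * r\<^sup>2)" "0 \<le> ?n / (2 * r) * h r y"
        using q2_nonneg[of r y] h_nonneg[of r y] r0 by auto
      have b: "\<bar>q2 r y / (2 * r\<^sup>2) - ?n / (2 * r) * h r y\<bar> \<le> (C * (2 / t\<^sup>2 + ?n / t)) * h (2 * ?T) y"
      proof -
        have "(C * (2 / t\<^sup>2 + ?n / t)) * h (2 * ?T) y = (C * h (2 * ?T) y) * (2 / t\<^sup>2) + (?n / t) * (C * h (2 * ?T) y)"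
          by (simp add: algebra_simps)
        then show ?thesis using b1 b2 b3 by linarith
      qed
      have "\<bar>?f' r y\<bar> \<le> ((1 + L) * (1 + (norm y)\<^sup>2)) * ((C * (2 / t\<^sup>2 + ?n / t)) * h (2 * ?T) y)"
        unfolding abs_mult using L(1) by (intro mult_mono a b) auto
      then show ?thesis by (simp add: ac_simps)
    qed
    show "integrable lborel (\<lambda>y. h r y * ln (h r y))" by (rule integrable_h_ln_h[OF r0])
  next
    show "integrable lborel (\<lambda>y. ?K * ((1 + (norm y)\<^sup>2) * h (2 * ?T) y))"
      using t by (intro integrable_mult_right integrable_h_moment) auto
  qed (use t in auto)
  have iB: "integrable lborel (\<lambda>y. (1 + ln (h t y)) * (q i t y / t\<^sup>2 - h t y / t))" if "norm i = 1" for i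
  proof -
    note I = integrable_densities[OF t]
    have "integrable lborel (\<lambda>y. q i t y / t\<^sup>2 - h t y / t + (ln (h t y) * q i t y) / t\<^sup>2 - (ln (h t y) * h t y) / t)"
      using I(1,2) I(3,4)[OF that] by (intro Bochner_Integration.integrable_add Bochner_Integration.integrable_diff integrable_divide) auto
    then show ?thesis by (simp add: algebra_simps add_divide_distrib)
  qed
  have "(LBINT y. ?f' t y) = (LBINT y. (1 / 2) * (\<Sum>i\<in>Basis. (1 + ln (h t y)) * (q i t y / t\<^sup>2 - h t y / t)))"
  proof (intro Bochner_Integration.integral_cong refl)
    fix y
    have "(1 / 2) * (\<Sum>i\<in>(Basis::'a set). (1 + ln (h t y)) * (q i t y / t\<^sup>2 - h t y / t))
      = (1 + ln (h t y)) * ((1 / 2) * (q2 t y / t\<^sup>2 - ?n * (h t y / t)))"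
      unfolding sum_distrib_left[symmetric] sum_subtractf q2_eq[OF t] sum_divide_distrib by simp
    also have "\<dots> = ?f' t y" by (simp add: algebra_simps)
    finally show "?f' t y = (1 / 2) * (\<Sum>i\<in>(Basis::'a set). (1 + ln (h t y)) * (q i t y / t\<^sup>2 - h t y / t))" by simp
  qed
  also have "\<dots> = (1 / 2) * (\<Sum>i\<in>(Basis::'a set). (LBINT y. (1 + ln (h t y)) * (q i t y / t\<^sup>2 - h t y / t)))"
    using iB by (simp add: Bochner_Integration.integral_sum)
  also have "\<dots> = (1 / 2) * (\<Sum>i\<in>(Basis::'a set). - (LBINT y. (m t y \<bullet> i)\<^sup>2 / (t\<^sup>2 * h t y)))"
    by (simp add: integration_by_parts_ln_h[OF t])
  also have "(\<Sum>i\<in>(Basis::'a set). - (LBINT y. (m t y \<bullet> i)\<^sup>2 / (t\<^sup>2 * h t y)))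
      = - (LBINT y. (\<Sum>i\<in>(Basis::'a set). (m t y \<bullet> i)\<^sup>2 / (t\<^sup>2 * h t y)))"
  proof -
    have "integrable lborel (\<lambda>y. (m t y \<bullet> i)\<^sup>2 / (t\<^sup>2 * h t y))" if "i \<in> Basis" for i
      using integrable_mult_right[OF integrable_densities(5)[OF t, of i], of "1 / t\<^sup>2"] that by simp
    then show ?thesis by (simp add: Bochner_Integration.integral_sum sum_negf)
  qed
  also have "(LBINT y. (\<Sum>i\<in>(Basis::'a set). (m t y \<bullet> i)\<^sup>2 / (t\<^sup>2 * h t y)))
      = (LBINT y. (norm (m t y))\<^sup>2 / (t\<^sup>2 * h t y))"
    by (simp add: norm_power2_eq_sum_Basis sum_divide_distrib)
  finally show ?thesis using D unfolding entropy_h_def[abs_def] by simp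
qed

end

section \<open>Moments of the smoothed law and an upper bound for its entropy\<close>

context gaussian_smoothing
begin

text \<open>Tilting by a decreasing function of \<open>|y - x|\<close> decreases the expectation of \<open>|y - x|\<^sup>2\<close>.\<close>

lemma q2_le:
  assumes t: "t > 0"
  shows "q2 t y \<le> h t y * (\<integral>x. (norm (y - x))\<^sup>2 \<partial>\<mu>)"
proof -
  let ?M = "\<integral>x. (norm (y - x))\<^sup>2 \<partial>\<mu>"
  define g where "g N = (2 * pi * t) powr (- (real DIM('a) / 2)) * exp (- (N / (2 * t)))" for N :: real
  have gk: "gk t (y - x) = g ((norm (y - x))\<^sup>2)" for x by (simp add: gk_def g_def)
  have anti: "(N - K) * (g N - g K) \<le> 0" for N K
  proof (cases "N \<le> K")
    case True
    then have "g K \<le> g N" using t unfolding g_def by (intro mult_left_mono) (auto simp: divide_right_mono)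
    then show ?thesis using True by (simp add: mult_nonpos_nonneg)
  next
    case False
    then have "g N \<le> g K" using t unfolding g_def by (intro mult_left_mono) (auto simp: divide_right_mono)
    then show ?thesis using False by (simp add: mult_nonneg_nonpos)
  qed
  note I = integrable_kernel[OF t, of y] and I2 = moment2_shift[of y]
  have "(\<integral>x. gk t (y - x) * (norm (y - x))\<^sup>2 - ?M * gk t (y - x)
      - g ?M * (norm (y - x))\<^sup>2 + g ?M * ?M \<partial>\<mu>) \<le> (\<integral>x. 0 \<partial>\<mu>)"
  proof (rule integral_mono)
    show "gk t (y - x) * (norm (y - x))\<^sup>2 - ?M * gk t (y - x) - g ?M * (norm (y - x))\<^sup>2 + g ?M * ?M \<le> 0" for x
      using anti[of "(norm (y - x))\<^sup>2" ?M] unfolding gk by (simp add: algebra_simps)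
  qed (use I I2 in auto)
  then have "q2 t y - ?M * h t y \<le> 0"
    using I I2 unfolding q2_def h_def by simp
  then show ?thesis by (simp add: mult.commute)
qed

lemma norm_m_power2_le:
  assumes t: "t > 0"
  shows "(norm (m t y))\<^sup>2 / h t y \<le> q2 t y"
proof -
  have "(norm (m t y))\<^sup>2 / h t y = (\<Sum>i\<in>Basis. (m t y \<bullet> i)\<^sup>2 / h t y)"
    by (simp add: norm_power2_eq_sum_Basis sum_divide_distrib)
  also have "\<dots> \<le> (\<Sum>i\<in>Basis. q i t y)" by (intro sum_mono m_power2_le t)
  finally show ?thesis by (simp add: q2_eq[OF t])
qed

text \<open>The squared conditional mean of the noise is at most its conditional second moment,
  which by \<open>q2_le\<close> is at most the unconditional mean of \<open>|y - X|^2\<close>. The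
  law enters through \<open>m2\<close> alone and \<open>t\<close> not at all, so the resulting
  linear growth of \<open>w\<close> is uniform along a sequence with bounded moments.\<close>

lemma norm_posterior_mean_le:
  assumes t: "t > 0"
  shows "(norm (m t y /\<^sub>R h t y))\<^sup>2 \<le> 2 * (norm y)\<^sup>2 + 2 * m2"
proof -
  have p: "h t y > 0" by (rule h_lower(1)[OF t])
  have "(norm (m t y /\<^sub>R h t y))\<^sup>2 = ((norm (m t y))\<^sup>2 / h t y) / h t y"
    using p by (simp add: power2_eq_square divide_inverse)
  also have "\<dots> \<le> q2 t y / h t y"
    using p by (intro divide_right_mono norm_m_power2_le t) auto
  also have "\<dots> \<le> (\<integral>x. (norm (y - x))\<^sup>2 \<partial>\<mu>)"
    using q2_le[OF t, of y] p by (simp add: field_simps)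
  also have "\<dots> \<le> 2 * (norm y)\<^sup>2 + 2 * m2" by (rule moment2_shift_le)
  finally show ?thesis .
qed

lemma integral_h_times:
  fixes g :: "'a \<Rightarrow> 'a \<Rightarrow> real"
  assumes int: "integrable (\<mu> \<Otimes>\<^sub>M lborel) (\<lambda>(x, y). g x y)"
  shows "integrable lborel (\<lambda>y. \<integral>x. g x y \<partial>\<mu>)" "integrable \<mu> (\<lambda>x. \<integral>y. g x y \<partial>lborel)"
    and "(LBINT y. (\<integral>x. g x y \<partial>\<mu>)) = (\<integral>x. (LBINT y. g x y) \<partial>\<mu>)"
  using ml.integrable_snd[OF int] ml.integrable_fst[OF int] ml.Fubini_integral[OF int] by auto

lemma h_norm2:
  assumes t: "t > 0"
  shows "integrable lborel (\<lambda>y. h t y * (norm y)\<^sup>2)"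
    and "(LBINT y. h t y * (norm y)\<^sup>2) = m2 + real DIM('a) * t"
proof -
  have int: "integrable (\<mu> \<Otimes>\<^sub>M lborel) (\<lambda>(x, y). gk t (y - x) * (norm y)\<^sup>2)"
    by (rule integrable_joint_bound[OF t, where C = 1]) (auto simp: abs_mult intro!: mult_left_mono)
  have e: "(\<integral>x. gk t (y - x) * (norm y)\<^sup>2 \<partial>\<mu>) = h t y * (norm y)\<^sup>2" for y
    unfolding h_def by simp
  show "integrable lborel (\<lambda>y. h t y * (norm y)\<^sup>2)"
    using integral_h_times(1)[OF int] unfolding e .
  have "(LBINT y. gk t (y - x) * (norm y)\<^sup>2) = (norm x)\<^sup>2 + real DIM('a) * t" for x :: 'a
    using integral_gk_shift(5)[OF t, of x] by (simp add: has_bochner_integral_iff)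
  then show "(LBINT y. h t y * (norm y)\<^sup>2) = m2 + real DIM('a) * t"
    using integral_h_times(3)[OF int] moment2 unfolding e m2_def by simp
qed

text \<open>The mean of \<open>Y \<bullet> \<surd>t Z\<close> equals that of
  \<open>|\<surd>t Z|^2\<close>, because the noise is centered and independent of \<open>X\<close>.
  This is the source of the cross term in \<open>fisher_eq\<close>.\<close>

lemma inner_m:
  assumes t: "t > 0"
  shows "integrable lborel (\<lambda>y. y \<bullet> m t y)"
    and "(LBINT y. y \<bullet> m t y) = real DIM('a) * t"
proof -
  have b: "\<bar>y \<bullet> (y - x)\<bar> \<le> 2 * (1 + (norm x)\<^sup>2 + (norm y)\<^sup>2)" for x y :: 'a
  proof -
    have "\<bar>y \<bullet> (y - x)\<bar> \<le> norm y * norm (y - x)" by (rule Cauchy_Schwarz_ineq2)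
    also have "\<dots> \<le> ((norm y)\<^sup>2 + (norm (y - x))\<^sup>2) / 2"
      using sum_squares_ge_zero[of "norm y - norm (y - x)" 0] by (simp add: power2_eq_square algebra_simps)
    also have "\<dots> \<le> 2 * (1 + (norm x)\<^sup>2 + (norm y)\<^sup>2)"
    proof -
      have "(norm (y - x))\<^sup>2 \<le> 2 * (norm y)\<^sup>2 + 2 * (norm x)\<^sup>2" by (rule norm_diff_power2_le)
      moreover have "0 \<le> (norm x)\<^sup>2" "0 \<le> (norm y)\<^sup>2" by auto
      ultimately show ?thesis by argo
    qed
    finally show ?thesis .
  qed
  have int: "integrable (\<mu> \<Otimes>\<^sub>M lborel) (\<lambda>(x, y). gk t (y - x) * (y \<bullet> (y - x)))"
  proof (rule integrable_joint_bound[OF t, where C = 2])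
    show "norm (gk t (y - x) * (y \<bullet> (y - x))) \<le> 2 * (gk t (y - x) * (1 + (norm x)\<^sup>2 + (norm y)\<^sup>2))" for x y :: 'a
      using mult_left_mono[OF b[of y x] gk_nonneg[of t "y - x"]] by (simp add: abs_mult mult.left_commute del: distrib_left_numeral)
  qed measurable
  have e: "(\<integral>x. gk t (y - x) * (y \<bullet> (y - x)) \<partial>\<mu>) = y \<bullet> m t y" for y
    unfolding inner_commute[of y "m t y"] m_inner[OF t] by (simp add: inner_commute)
  show "integrable lborel (\<lambda>y. y \<bullet> m t y)"
    using integral_h_times(1)[OF int] by (simp add: e)
  have "(LBINT y. gk t (y - x) * (y \<bullet> (y - x))) = real DIM('a) * t" for x :: 'a
    using integral_gk_shift(6)[OF t, of x] by (simp add: has_bochner_integral_iff)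
  then show "(LBINT y. y \<bullet> m t y) = real DIM('a) * t"
    using integral_h_times(3)[OF int] unfolding e by simp
qed

text \<open>Convexity of \<open>s ln s\<close>: \<open>h t y\<close> is the average of
  \<open>gk t (y - x)\<close> over \<open>x\<close>, so its entropy integral is at most that of
  \<open>gk t\<close>, which is the right-hand side. Replacing \<open>t\<close> by
  \<open>v + t\<close> in that value changes it by an amount that vanishes for large
  \<open>t\<close>; so this acts as a boundary condition at infinity.\<close>

lemma entropy_h_le:
  assumes t: "t > 0"
  shows "entropy_h t \<le> - (real DIM('a) / 2) * ln (2 * pi * t) - real DIM('a) / 2"
proof -
  let ?d = "real DIM('a) / 2"
  let ?l = "\<lambda>z::'a. - ?d * ln (2 * pi * t) - (norm z)\<^sup>2 / (2 * t)"
  have int: "integrable (\<mu> \<Otimes>\<^sub>M lborel) (\<lambda>(x, y). gk t (y - x) * ?l (y - x))"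
  proof (rule integrable_joint_bound[OF t, where C = "\<bar>?d * ln (2 * pi * t)\<bar> + 1 / t"])
    fix x y :: 'a
    have "\<bar>?l (y - x)\<bar> \<le> \<bar>?d * ln (2 * pi * t)\<bar> + (norm (y - x))\<^sup>2 / (2 * t)"
    proof -
      have "0 \<le> (norm (y - x))\<^sup>2 / (2 * t)" using t by simp
      then show ?thesis unfolding mult_minus_left by linarith
    qed
    also have "(norm (y - x))\<^sup>2 / (2 * t) \<le> (1 + (norm x)\<^sup>2 + (norm y)\<^sup>2) / t"
      using norm_diff_power2_le[of y x] t by (simp add: field_simps)
    also have "\<bar>?d * ln (2 * pi * t)\<bar> \<le> \<bar>?d * ln (2 * pi * t)\<bar> * (1 + (norm x)\<^sup>2 + (norm y)\<^sup>2)"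
      using mult_left_mono[of 1 "1 + (norm x)\<^sup>2 + (norm y)\<^sup>2" "\<bar>?d * ln (2 * pi * t)\<bar>"] by simp
    finally have "\<bar>?l (y - x)\<bar> \<le> (\<bar>?d * ln (2 * pi * t)\<bar> + 1 / t) * (1 + (norm x)\<^sup>2 + (norm y)\<^sup>2)"
      by (simp add: distrib_right)
    then show "norm (gk t (y - x) * ?l (y - x)) \<le> (\<bar>?d * ln (2 * pi * t)\<bar> + 1 / t) * (gk t (y - x) * (1 + (norm x)\<^sup>2 + (norm y)\<^sup>2))"
      using mult_left_mono[OF _ gk_nonneg[of t "y - x"]] by (simp add: abs_mult mult.left_commute)
  qed measurable
  have val: "(LBINT y. gk t (y - x) * ?l (y - x)) = - ?d * ln (2 * pi * t) - ?d" for x :: 'a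
  proof -
    have "has_bochner_integral lborel (\<lambda>y. gk t (y - x) * (- ?d * ln (2 * pi * t)) - (gk t (y - x) * (norm (y - x))\<^sup>2) / (2 * t))
      (1 * (- ?d * ln (2 * pi * t)) - (real DIM('a) * t) / (2 * t))"
      by (intro has_bochner_integral_diff has_bochner_integral_mult_left has_bochner_integral_divide_zero integral_gk_shift t)
    then show ?thesis using t by (simp add: has_bochner_integral_iff right_diff_distrib)
  qed
  have "h t y * ln (h t y) \<le> (\<integral>x. gk t (y - x) * ?l (y - x) \<partial>\<mu>)" for y
  proof -
    have p: "h t y > 0" by (rule h_lower(1)[OF t])
    note I = integrable_kernel[OF t, of y]
    \<comment> \<open>The term \<open>gk t (y - x) - h t y\<close> comes from
      \<open>ln s \<le> s - 1\<close> and has integral 0 over \<open>\<mu>\<close>.\<close>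
    have "(\<integral>x. gk t (y - x) * ln (h t y) + gk t (y - x) - h t y \<partial>\<mu>) \<le> (\<integral>x. gk t (y - x) * ?l (y - x) \<partial>\<mu>)"
    proof (rule integral_mono)
      fix x
      have g: "gk t (y - x) > 0" by (rule gk_pos[OF t])
      have "ln (h t y / gk t (y - x)) \<le> h t y / gk t (y - x) - 1"
        using p g by (intro ln_le_minus_one) auto
      then have "ln (h t y) - ln (gk t (y - x)) \<le> h t y / gk t (y - x) - 1"
        using p g by (simp add: ln_div)
      then have "gk t (y - x) * (ln (h t y) - ln (gk t (y - x))) \<le> gk t (y - x) * (h t y / gk t (y - x) - 1)"
        using g by (intro mult_left_mono) auto
      also have "\<dots> = h t y - gk t (y - x)" using g by (simp add: field_simps)
      finally show "gk t (y - x) * ln (h t y) + gk t (y - x) - h t y \<le> gk t (y - x) * ?l (y - x)"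
        unfolding ln_gk[OF t, symmetric] by (simp add: algebra_simps)
    next
      have "(\<lambda>x. gk t (y - x) * ?l (y - x)) =
          (\<lambda>x. gk t (y - x) * (- ?d * ln (2 * pi * t)) - (gk t (y - x) * (norm (y - x))\<^sup>2) / (2 * t))"
        by (simp add: right_diff_distrib)
      then show "integrable \<mu> (\<lambda>x. gk t (y - x) * ?l (y - x))" using I by simp
    qed (use I in auto)
    moreover have "(\<integral>x. gk t (y - x) * ln (h t y) + gk t (y - x) - h t y \<partial>\<mu>) = h t y * ln (h t y)"
      using I unfolding h_def by simp
    ultimately show ?thesis by simp
  qed
  then have "entropy_h t \<le> (LBINT y. (\<integral>x. gk t (y - x) * ?l (y - x) \<partial>\<mu>))"
    unfolding entropy_h_def by (intro integral_mono integrable_h_ln_h t integral_h_times(1)[OF int])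
  also have "\<dots> = - ?d * ln (2 * pi * t) - ?d"
    unfolding integral_h_times(3)[OF int] val by simp
  finally show ?thesis .
qed

end

section \<open>The score and its gap\<close>

text \<open>If \<open>\<mu>\<close> has a smooth positive density \<open>\<rho>\<close> and
  \<open>a x = x + v grad \<rho> / \<rho>\<close>, then \<open>score\<close> results from
  integrating by parts against \<open>gk t (y - x)\<close>. Requiring only this smoothed identity
  keeps the regularity of the density out of the locale; a weak gradient is able to supply
  it.\<close>

locale gaussian_score = gaussian_smoothing +
  fixes v :: real and a :: "'a \<Rightarrow> 'a"
  assumes v: "v > 0"
    and a_measurable [measurable]: "a \<in> borel_measurable borel"
    and a2: "integrable \<mu> (\<lambda>x. (norm (a x))\<^sup>2)"
    and score: "\<And>t y. t > 0 \<Longrightarrow>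
      (\<integral>x. gk t (y - x) *\<^sub>R a x \<partial>\<mu>) = h t y *\<^sub>R y - ((v + t) / t) *\<^sub>R m t y"
begin

text \<open>\<open>a\<close> is \<open>v\<close> times the gradient of the logarithm of the density of \<open>\<mu>\<close> relative to \<open>gk v\<close>, and
  \<open>w t y\<close> is the conditional expectation of \<open>a X\<close> given \<open>X + \<surd>t Z = y\<close>, where \<open>X\<close> has
  distribution \<open>\<mu>\<close> and \<open>Z\<close> is standard normal.\<close>

definition w :: "real \<Rightarrow> 'a \<Rightarrow> 'a" where
  "w t y = y - ((v + t) / t) *\<^sub>R (m t y /\<^sub>R h t y)"

definition A2 :: real where "A2 = (\<integral>x. (norm (a x))\<^sup>2 \<partial>\<mu>)"

definition gap :: "real \<Rightarrow> real" where
  "gap t = (LBINT y. (\<integral>x. gk t (y - x) * (norm (a x - w t y))\<^sup>2 \<partial>\<mu>))"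

lemma w_measurable [measurable]: "w t \<in> borel_measurable borel"
  unfolding w_def[abs_def] by measurable

lemma h_w:
  assumes t: "t > 0"
  shows "h t y *\<^sub>R w t y = (\<integral>x. gk t (y - x) *\<^sub>R a x \<partial>\<mu>)"
  using h_lower(1)[OF t, of y] unfolding score[OF t] w_def by (simp add: scaleR_right_diff_distrib)

lemma w_bound:
  assumes t: "t > 0"
  shows "(norm (w t y))\<^sup>2 \<le> 2 * (norm y)\<^sup>2 + 4 * ((v + t) / t)\<^sup>2 * ((norm y)\<^sup>2 + m2)"
proof -
  have "(norm (w t y))\<^sup>2 \<le> 2 * (norm y)\<^sup>2 + 2 * (norm (((v + t) / t) *\<^sub>R (m t y /\<^sub>R h t y)))\<^sup>2"
    unfolding w_def by (rule norm_diff_power2_le)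
  also have "(norm (((v + t) / t) *\<^sub>R (m t y /\<^sub>R h t y)))\<^sup>2 = ((v + t) / t)\<^sup>2 * (norm (m t y /\<^sub>R h t y))\<^sup>2"
    by (simp only: norm_scaleR power_mult_distrib power2_abs)
  also have "\<dots> \<le> ((v + t) / t)\<^sup>2 * (2 * (norm y)\<^sup>2 + 2 * m2)"
    by (intro mult_left_mono norm_posterior_mean_le t) auto
  finally show ?thesis by (simp add: algebra_simps)
qed

lemma integrable_a: "integrable \<mu> a"
proof (rule Bochner_Integration.integrable_bound[where f = "\<lambda>x. 1 + (norm (a x))\<^sup>2"])
  show "integrable \<mu> (\<lambda>x. 1 + (norm (a x))\<^sup>2)" using a2 by simp
  show "AE x in \<mu>. norm (a x) \<le> norm (1 + (norm (a x))\<^sup>2)"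
    by (intro AE_I2 order_trans[OF norm_le_one_plus_power2]) simp
qed measurable

lemma joint_a2:
  assumes t: "t > 0"
  shows "integrable (\<mu> \<Otimes>\<^sub>M lborel) (\<lambda>(x, y). gk t (y - x) * (norm (a x))\<^sup>2)"
proof (rule ml.Fubini_integrable)
  have *: "has_bochner_integral lborel (\<lambda>y. gk t (y - x) * (norm (a x))\<^sup>2) (1 * (norm (a x))\<^sup>2)" for x
    by (intro has_bochner_integral_mult_left integral_gk_shift t)
  show "integrable \<mu> (\<lambda>x. \<integral>y. norm (case (x, y) of (x, y) \<Rightarrow> gk t (y - x) * (norm (a x))\<^sup>2) \<partial>lborel)"
    using a2 integral_gk_shift(1)[OF t, where 'a = 'a] by (simp add: has_bochner_integral_iff abs_mult)
  show "AE x in \<mu>. integrable lborel (\<lambda>y. case (x, y) of (x, y) \<Rightarrow> gk t (y - x) * (norm (a x))\<^sup>2)"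
    using * by (simp add: has_bochner_integral_iff)
qed measurable

lemma w_bound':
  assumes t: "t > 0"
  obtains C where "C \<ge> 0" "\<And>y. (norm (w t y))\<^sup>2 \<le> C * (1 + (norm y)\<^sup>2)"
proof
  let ?c = "4 * ((v + t) / t)\<^sup>2"
  show "0 \<le> 2 + ?c * (1 + m2)" using m2_nonneg by simp
  show "(norm (w t y))\<^sup>2 \<le> (2 + ?c * (1 + m2)) * (1 + (norm y)\<^sup>2)" for y
  proof -
    have "(norm y)\<^sup>2 + m2 \<le> (1 + m2) * (1 + (norm y)\<^sup>2)"
      using m2_nonneg by (simp add: algebra_simps)
    then have "?c * ((norm y)\<^sup>2 + m2) \<le> ?c * ((1 + m2) * (1 + (norm y)\<^sup>2))"
      by (intro mult_left_mono) auto
    then show ?thesis using w_bound[OF t, of y] by (simp add: algebra_simps)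
  qed
qed

lemma joint_w2:
  assumes t: "t > 0"
  shows "integrable (\<mu> \<Otimes>\<^sub>M lborel) (\<lambda>(x, y). gk t (y - x) * (norm (w t y))\<^sup>2)"
proof -
  obtain C where C: "C \<ge> 0" "\<And>y. (norm (w t y))\<^sup>2 \<le> C * (1 + (norm y)\<^sup>2)"
    using w_bound'[OF t] by metis
  show ?thesis
  proof (rule integrable_joint_bound[OF t, where C = C])
    fix x y :: 'a
    have "(norm (w t y))\<^sup>2 \<le> C * (1 + (norm x)\<^sup>2 + (norm y)\<^sup>2)"
      using C(1) by (intro order_trans[OF C(2)] mult_left_mono) auto
    from mult_left_mono[OF this gk_nonneg[of t "y - x"]]
    show "norm (gk t (y - x) * (norm (w t y))\<^sup>2) \<le> C * (gk t (y - x) * (1 + (norm x)\<^sup>2 + (norm y)\<^sup>2))"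
      by (simp add: abs_mult mult.left_commute)
  qed measurable
qed

lemma joint_gap:
  assumes t: "t > 0"
  shows "integrable (\<mu> \<Otimes>\<^sub>M lborel) (\<lambda>(x, y). gk t (y - x) * (norm (a x - w t y))\<^sup>2)"
proof (rule Bochner_Integration.integrable_bound)
  show "integrable (\<mu> \<Otimes>\<^sub>M lborel) (\<lambda>z. 2 * (case z of (x, y) \<Rightarrow> gk t (y - x) * (norm (a x))\<^sup>2)
      + 2 * (case z of (x, y) \<Rightarrow> gk t (y - x) * (norm (w t y))\<^sup>2))"
    using joint_a2[OF t] joint_w2[OF t] by simp
  have "gk t (y - x) * (norm (a x - w t y))\<^sup>2 \<le> 2 * (gk t (y - x) * (norm (a x))\<^sup>2) + 2 * (gk t (y - x) * (norm (w t y))\<^sup>2)" for x y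
    using mult_left_mono[OF norm_diff_power2_le[of "a x" "w t y"] gk_nonneg[of t "y - x"]] by (simp add: algebra_simps)
  then show "AE z in \<mu> \<Otimes>\<^sub>M lborel. norm (case z of (x, y) \<Rightarrow> gk t (y - x) * (norm (a x - w t y))\<^sup>2)
      \<le> norm (2 * (case z of (x, y) \<Rightarrow> gk t (y - x) * (norm (a x))\<^sup>2)
      + 2 * (case z of (x, y) \<Rightarrow> gk t (y - x) * (norm (w t y))\<^sup>2))"
    by (intro AE_I2) (auto simp: abs_mult)
qed measurable

lemma gap_nonneg: "gap t \<ge> 0"
  unfolding gap_def by simp

lemma integrable_kernel_a:
  assumes t: "t > 0"
  shows "integrable \<mu> (\<lambda>x. gk t (y - x) *\<^sub>R a x)" "integrable \<mu> (\<lambda>x. gk t (y - x) * (norm (a x))\<^sup>2)"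
proof -
  let ?C = "(2 * pi * t) powr (- (real DIM('a) / 2))"
  show "integrable \<mu> (\<lambda>x. gk t (y - x) *\<^sub>R a x)"
    by (rule Bochner_Integration.integrable_bound[OF integrable_mult_right[OF integrable_norm[OF integrable_a], of ?C]])
      (auto intro!: mult_right_mono gk_le t simp: abs_mult)
  show "integrable \<mu> (\<lambda>x. gk t (y - x) * (norm (a x))\<^sup>2)"
    by (rule Bochner_Integration.integrable_bound[OF integrable_mult_right[OF a2, of ?C]])
      (auto intro!: mult_right_mono gk_le t simp: abs_mult)
qed

text \<open>Pythagoras: \<open>w\<close> is the orthogonal projection of \<open>a X\<close> onto the
  functions of \<open>X + \<surd>t Z\<close>, and \<open>gap\<close> is the squared distance from
  it.\<close>

lemma h_w2:
  assumes t: "t > 0"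
  shows "integrable lborel (\<lambda>y. h t y * (norm (w t y))\<^sup>2)"
    and "gap t = A2 - (LBINT y. h t y * (norm (w t y))\<^sup>2)"
proof -
  have e: "(\<integral>x. gk t (y - x) * (norm (w t y))\<^sup>2 \<partial>\<mu>) = h t y * (norm (w t y))\<^sup>2" for y
    unfolding h_def by simp
  show int: "integrable lborel (\<lambda>y. h t y * (norm (w t y))\<^sup>2)"
    using integral_h_times(1)[OF joint_w2[OF t]] unfolding e .
  have inner: "(\<integral>x. gk t (y - x) * (norm (a x - w t y))\<^sup>2 \<partial>\<mu>)
    = (\<integral>x. gk t (y - x) * (norm (a x))\<^sup>2 \<partial>\<mu>) - h t y * (norm (w t y))\<^sup>2" for y
  proof -
    note I = integrable_kernel(1)[OF t, of y] integrable_kernel_a[OF t, of y]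
    have "(\<integral>x. gk t (y - x) * (norm (a x - w t y))\<^sup>2 \<partial>\<mu>) =
      (\<integral>x. gk t (y - x) * (norm (a x))\<^sup>2 - 2 * ((gk t (y - x) *\<^sub>R a x) \<bullet> w t y) + gk t (y - x) * (norm (w t y))\<^sup>2 \<partial>\<mu>)"
      unfolding power2_norm_eq_inner by (simp add: algebra_simps inner_commute)
    also have "\<dots> = (\<integral>x. gk t (y - x) * (norm (a x))\<^sup>2 \<partial>\<mu>)
        - 2 * (\<integral>x. (gk t (y - x) *\<^sub>R a x) \<bullet> w t y \<partial>\<mu>) + h t y * (norm (w t y))\<^sup>2"
      unfolding h_def using I(1,3) integrable_inner_left[OF I(2), of "w t y"] by simp
    also have "(\<integral>x. (gk t (y - x) *\<^sub>R a x) \<bullet> w t y \<partial>\<mu>) = (h t y *\<^sub>R w t y) \<bullet> w t y"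
      unfolding h_w[OF t] by (rule integral_inner_left) (rule I(2))
    also have "(\<integral>x. gk t (y - x) * (norm (a x))\<^sup>2 \<partial>\<mu>) - 2 * ((h t y *\<^sub>R w t y) \<bullet> w t y) + h t y * (norm (w t y))\<^sup>2
        = (\<integral>x. gk t (y - x) * (norm (a x))\<^sup>2 \<partial>\<mu>) - h t y * (norm (w t y))\<^sup>2"
      unfolding power2_norm_eq_inner by simp
    finally show ?thesis .
  qed
  have "(LBINT y. gk t (y - x)) = 1" for x :: 'a
    using integral_gk_shift(1)[OF t, of x] by (simp add: has_bochner_integral_iff)
  then have "(LBINT y. (\<integral>x. gk t (y - x) * (norm (a x))\<^sup>2 \<partial>\<mu>)) = A2"
    unfolding integral_h_times(3)[OF joint_a2[OF t]] A2_def by simp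
  then show "gap t = A2 - (LBINT y. h t y * (norm (w t y))\<^sup>2)"
    unfolding gap_def inner using int integral_h_times(1)[OF joint_a2[OF t]] by simp
qed

text \<open>By the definition of \<open>w\<close>, the score \<open>- m / (t h)\<close> equals
  \<open>(w - y) / (v + t)\<close>. In the expansion of \<open>|y - w|^2\<close> the mean of
  \<open>|w|^2\<close> is \<open>A2 - gap\<close>, and the cross term follows from
  \<open>h_norm2\<close> and \<open>inner_m\<close>. Without \<open>gap\<close> this is the
  Blachman-Stam upper bound with weights \<open>v / (v + t)\<close> and
  \<open>t / (v + t)\<close>.\<close>

lemma fisher_eq:
  assumes t: "t > 0"
  shows "(LBINT y. (norm (m t y))\<^sup>2 / (t\<^sup>2 * h t y))
    = (A2 - m2 + 2 * v * real DIM('a) + real DIM('a) * t - gap t) / (v + t)\<^sup>2"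
proof -
  let ?n = "real DIM('a)"
  have "(norm (m t y))\<^sup>2 / (t\<^sup>2 * h t y) = (h t y * (norm y)\<^sup>2 - 2 * (h t y * (norm y)\<^sup>2 - ((v + t) / t) * (y \<bullet> m t y))
      + h t y * (norm (w t y))\<^sup>2) / (v + t)\<^sup>2" for y
  proof -
    have p: "h t y > 0" by (rule h_lower(1)[OF t])
    have vt: "v + t > 0" using v t by simp
    have 1: "h t y *\<^sub>R (y - w t y) = ((v + t) / t) *\<^sub>R m t y"
      using p by (simp add: w_def)
    have "h t y * (norm y)\<^sup>2 - 2 * (h t y * (norm y)\<^sup>2 - ((v + t) / t) * (y \<bullet> m t y)) + h t y * (norm (w t y))\<^sup>2
        = h t y * (norm (y - w t y))\<^sup>2"
    proof -
      have "y \<bullet> (h t y *\<^sub>R (y - w t y)) = ((v + t) / t) * (y \<bullet> m t y)" unfolding 1 by simp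
      then show ?thesis unfolding power2_norm_eq_inner
        by (simp add: inner_diff_left inner_diff_right inner_commute algebra_simps)
    qed
    also have "\<dots> = (norm (h t y *\<^sub>R (y - w t y)))\<^sup>2 / h t y"
      using p by (simp add: power_mult_distrib power2_eq_square)
    also have "\<dots> = (v + t)\<^sup>2 * ((norm (m t y))\<^sup>2 / (t\<^sup>2 * h t y))"
      unfolding 1 by (simp add: power_mult_distrib power_divide)
    finally show ?thesis using vt by simp
  qed
  then have "(LBINT y. (norm (m t y))\<^sup>2 / (t\<^sup>2 * h t y))
    = ((m2 + ?n * t) - 2 * ((m2 + ?n * t) - ((v + t) / t) * (?n * t))
      + (LBINT y. h t y * (norm (w t y))\<^sup>2)) / (v + t)\<^sup>2"
    using h_norm2[OF t] inner_m[OF t] h_w2(1)[OF t] by simp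
  moreover have W: "(LBINT y. h t y * (norm (w t y))\<^sup>2) = A2 - gap t" using h_w2(2)[OF t] by simp
  moreover have V: "((v + t) / t) * (?n * t) = (v + t) * ?n" using t by simp
  moreover have "(m2 + ?n * t) - 2 * ((m2 + ?n * t) - (v + t) * ?n) + (A2 - gap t)
      = A2 - m2 + 2 * v * ?n + ?n * t - gap t" by (simp add: algebra_simps)
  ultimately show ?thesis by (simp only:)
qed

text \<open>The summand added to the entropy is an antiderivative that cancels its derivative up to
  the gap, so \<open>Phi\<close> moves only because of the gap. If \<open>\<mu>\<close> has density
  \<open>gk v\<close>, then \<open>a\<close> is 0 and \<open>Phi\<close> is constant; that constant
  is the bound in \<open>Phi_le\<close>.\<close>

definition Phi :: "real \<Rightarrow> real" where
  "Phi t = entropy_h t + (1 / 2) * (- (A2 - m2 + v * real DIM('a)) / (v + t) + real DIM('a) * ln (v + t))"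

lemma Phi_deriv:
  assumes t: "t > 0"
  shows "(Phi has_real_derivative gap t / (2 * (v + t)\<^sup>2)) (at t)"
proof -
  let ?n = "real DIM('a)" and ?K = "A2 - m2 + v * real DIM('a)"
  have vt: "v + t > 0" using v t by simp
  have "((\<lambda>t. - ?K / (v + t) + ?n * ln (v + t)) has_real_derivative ?K / (v + t)\<^sup>2 + ?n / (v + t)) (at t)"
    using vt by (auto intro!: derivative_eq_intros simp: power2_eq_square)
  from DERIV_add[OF entropy_h_deriv[OF t] DERIV_cmult[OF this, of "1 / 2"]]
  have "(Phi has_real_derivative - (1 / 2) * ((A2 - m2 + 2 * v * ?n + ?n * t - gap t) / (v + t)\<^sup>2)
      + (1 / 2) * (?K / (v + t)\<^sup>2 + ?n / (v + t))) (at t)"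
    unfolding Phi_def[abs_def] fisher_eq[OF t] by simp
  moreover have "- (1 / 2) * ((A2 - m2 + 2 * v * ?n + ?n * t - gap t) / (v + t)\<^sup>2)
      + (1 / 2) * (?K / (v + t)\<^sup>2 + ?n / (v + t)) = gap t / (2 * (v + t)\<^sup>2)"
  proof -
    have e: "?n / (v + t) = ?n * (v + t) / (v + t)\<^sup>2" using vt by (simp add: power2_eq_square)
    have "- (1 / 2) * (x / d) + (1 / 2) * (y / d + z / d) = (y + z - x) / (2 * d)" for x y z d :: real
      by (simp add: add_divide_distrib diff_divide_distrib)
    from this show ?thesis unfolding e
      by (rule trans) (simp add: algebra_simps)
  qed
  ultimately show ?thesis by simp
qed

lemma Phi_mono:
  assumes "0 < s" "s \<le> t"
  shows "Phi s \<le> Phi t"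
  by (rule DERIV_nonneg_imp_nondecreasing[OF assms(2)])
    (use assms Phi_deriv gap_nonneg in \<open>meson divide_nonneg_nonneg less_le_trans mult_nonneg_nonneg zero_le_numeral zero_le_power2\<close>)

text \<open>\<open>Phi\<close> is nondecreasing, so a bound near infinity is enough. There
  \<open>entropy_h_le\<close> applies, and the logarithms match up to
  \<open>ln (v + T) - ln T\<close>, which tends to 0.\<close>

lemma Phi_le:
  assumes t: "t > 0"
  shows "Phi t \<le> - (real DIM('a) / 2) * ln (2 * pi) - real DIM('a) / 2"
proof -
  let ?n = "real DIM('a)" and ?K = "A2 - m2 + v * real DIM('a)"
  let ?u = "\<lambda>T. - (?n / 2) * ln (2 * pi) - ?n / 2 - (1 / 2) * (?K / (v + T)) + (?n / 2) * (ln (v + T) - ln T)"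
  have "Phi t \<le> ?u T" if "T \<ge> t" for T
  proof -
    have T: "T > 0" using t that by simp
    have "Phi t \<le> Phi T" by (rule Phi_mono[OF t that])
    also have "\<dots> \<le> ?u T"
    proof -
      have "ln (2 * pi * T) = ln (2 * pi) + ln T" using T by (simp add: ln_mult)
      then have bound: "entropy_h T \<le> - (?n / 2) * ln (2 * pi) - (?n / 2) * ln T - ?n / 2"
        using entropy_h_le[OF T] by (simp add: distrib_left)
      have key: "E + (1 / 2) * (- A + B) \<le> d - (1 / 2) * A + C"
        if "E \<le> d' - c - d2" "d = d' - d2" "C = B / 2 - c" for E A B C c d d' d2 :: real
        using that by argo
      show ?thesis unfolding Phi_def minus_divide_left[symmetric]
        by (rule key[OF bound]) (simp_all add: right_diff_distrib diff_divide_distrib)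
    qed
    finally show ?thesis .
  qed
  then have ev: "eventually (\<lambda>T. Phi t \<le> ?u T) at_top"
    by (auto simp: eventually_at_top_linorder)
  have l1: "((\<lambda>T. ?K / (v + T)) \<longlongrightarrow> 0) at_top"
    by (intro tendsto_divide_0[OF tendsto_const] filterlim_at_top_imp_at_infinity
        filterlim_tendsto_add_at_top[OF tendsto_const] filterlim_ident)
  have l2: "((\<lambda>T. ln (v + T) - ln T) \<longlongrightarrow> 0) at_top"
  proof -
    have "((\<lambda>T. ln (v / T + 1)) \<longlongrightarrow> ln (0 + 1)) at_top"
      by (intro tendsto_intros tendsto_divide_0[OF tendsto_const] filterlim_at_top_imp_at_infinity filterlim_ident) auto
    moreover have "eventually (\<lambda>T. ln (v / T + 1) = ln (v + T) - ln T) at_top"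
      using eventually_gt_at_top[of 0]
    proof eventually_elim
      case (elim T)
      then have "v / T + 1 = (v + T) / T" by (simp add: field_simps)
      then show ?case using elim v by (simp add: ln_div)
    qed
    ultimately show ?thesis by (simp add: filterlim_cong)
  qed
  have "(?u \<longlongrightarrow> - (?n / 2) * ln (2 * pi) - ?n / 2 - (1 / 2) * 0 + (?n / 2) * 0) at_top"
    by (intro tendsto_intros l1 l2)
  then show ?thesis using tendsto_lowerbound[OF _ ev] by force
qed

text \<open>Mean value theorem between the times 1 and 2, where the noise is neither so small that
  it reveals \<open>X\<close> nor so large that the kernels flatten out; \<open>A2_le_gap\<close> is
  uniform on this interval.\<close>

lemma gap_le_Phi:
  obtains r where "1 < r" "r < 2"
    "Phi 1 + gap r / (2 * (v + r)\<^sup>2) \<le> - (real DIM('a) / 2) * ln (2 * pi) - real DIM('a) / 2"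
proof -
  obtain r where r: "1 < r" "r < 2" "Phi 2 - Phi 1 = (2 - 1) * (gap r / (2 * (v + r)\<^sup>2))"
    using MVT2[of 1 2 Phi "\<lambda>r. gap r / (2 * (v + r)\<^sup>2)"] Phi_deriv by auto
  then show ?thesis using that[of r] Phi_le[of 2] by simp
qed

end

section \<open>Continuity of translations\<close>

text \<open>Induction on integrable functions. For an indicator, outer regularity replaces the set
  by an open set \<open>U\<close>; a point of \<open>U\<close> stays in \<open>U\<close> under small
  shifts, so dominated convergence applies. Sums and limits follow from the triangle
  inequality.\<close>

lemma tendsto_L1_translation:
  fixes f :: "'a::euclidean_space \<Rightarrow> real"
  assumes "integrable lborel f" and X: "X \<longlonglongrightarrow> 0"
  shows "(\<lambda>n. \<integral>y. \<bar>f (y - X n) - f y\<bar> \<partial>lborel) \<longlonglongrightarrow> 0"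
  using assms(1)
proof induct
  case (base A c)
  have A[measurable]: "A \<in> sets borel" using base by simp
  have fin: "emeasure lborel A < \<infinity>" using base by simp
  have iA: "integrable lborel (indicat_real A)" using base by (simp add: integrable_real_indicator)
  have "(\<lambda>n. \<integral>y. \<bar>indicat_real A (y - X n) - indicat_real A y\<bar> \<partial>lborel) \<longlonglongrightarrow> 0"
  proof (rule LIMSEQ_I)
    fix e :: real assume "e > 0"
    obtain U where U: "open U" "A \<subseteq> U" "emeasure lborel (U - A) < e / 4"
      using outer_regular_lborel[OF A, of "e / 4"] \<open>e > 0\<close> by auto
    have [measurable]: "U \<in> sets borel" using U by simp
    have UA: "emeasure lborel (U - A) < \<infinity>" using U(3) less_trans by fastforce
    have "emeasure lborel U \<le> emeasure lborel A + emeasure lborel (U - A)"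
      using U(2) by (subst plus_emeasure) (auto intro!: emeasure_mono)
    then have fU: "emeasure lborel U < \<infinity>" using fin UA by (metis ennreal_add_less_top infinity_ennreal_def le_less_trans)
    have iU: "integrable lborel (indicat_real U)" using fU by (simp add: integrable_real_indicator)
    have iD: "integrable lborel (indicat_real (U - A))" using UA by (simp add: integrable_real_indicator)
    have mD: "(LBINT y. indicat_real (U - A) y) < e / 4"
    proof -
      have "ennreal (measure lborel (U - A)) < ennreal (e / 4)"
        using U(3) UA by (simp add: emeasure_eq_ennreal_measure)
      then show ?thesis using \<open>e > 0\<close> by (simp add: ennreal_less_iff)
    qed
    have lim: "(\<lambda>n. \<integral>y. indicat_real U y * (1 - indicat_real U (y - X n)) \<partial>lborel) \<longlonglongrightarrow> (\<integral>y. 0 \<partial>(lborel :: 'a measure))"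
    proof (rule integral_dominated_convergence[where w = "indicat_real U"])
      show "AE y in lborel. (\<lambda>n. indicat_real U y * (1 - indicat_real U (y - X n))) \<longlonglongrightarrow> 0"
      proof (intro AE_I2)
        fix y :: 'a
        show "(\<lambda>n. indicat_real U y * (1 - indicat_real U (y - X n))) \<longlonglongrightarrow> 0"
        proof (cases "y \<in> U")
          case True
          have "(\<lambda>n. y - X n) \<longlonglongrightarrow> y - 0" by (intro tendsto_intros X)
          then have "eventually (\<lambda>n. y - X n \<in> U) sequentially"
            using U(1) True by (intro topological_tendstoD) auto
          then have "eventually (\<lambda>n. indicat_real U y * (1 - indicat_real U (y - X n)) = 0) sequentially"
            by eventually_elim simp
          then show ?thesis by (rule tendsto_eventually)
        qed simp
      qed
      show "AE y in lborel. norm (indicat_real U y * (1 - indicat_real U (y - X n))) \<le> indicat_real U y" for n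
        by (intro AE_I2) (auto simp: indicator_def)
    qed (use iU in auto)
    have sU: "integrable lborel (\<lambda>y. indicat_real U (y - X n))" "integrable lborel (\<lambda>y. indicat_real A (y - X n))"
      "integrable lborel (\<lambda>y. indicat_real (U - A) (y - X n))" for n
      by (rule integrable_lborel_translation[OF iU] integrable_lborel_translation[OF iA] integrable_lborel_translation[OF iD])+
    have bound: "(LBINT y. \<bar>indicat_real A (y - X n) - indicat_real A y\<bar>)
        \<le> 2 * (LBINT y. indicat_real (U - A) y) + 2 * (LBINT y. indicat_real U y * (1 - indicat_real U (y - X n)))" for n
    proof -
      have i1: "integrable lborel (\<lambda>y. indicat_real U y * (1 - indicat_real U (y - X n)))"
        by (rule Bochner_Integration.integrable_bound[OF iU]) (auto simp: indicator_def)
      \<comment> \<open>The last summand is the modulus of the difference of the indicators of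
        \<open>U\<close>, written as twice the loss from \<open>U\<close> plus a difference that
        integrates to 0 by translation invariance. So only points leaving \<open>U\<close> need
        control, and \<open>U\<close> is open.\<close>
      have pw: "\<bar>indicat_real A (y - X n) - indicat_real A y\<bar> \<le> indicat_real (U - A) (y - X n) + indicat_real (U - A) y
          + (2 * (indicat_real U y * (1 - indicat_real U (y - X n))) + (indicat_real U (y - X n) - indicat_real U y))" for y
        using U(2) by (auto simp: indicator_def)
      have "(LBINT y. \<bar>indicat_real A (y - X n) - indicat_real A y\<bar>)
          \<le> (LBINT y. indicat_real (U - A) (y - X n) + indicat_real (U - A) y
          + (2 * (indicat_real U y * (1 - indicat_real U (y - X n))) + (indicat_real U (y - X n) - indicat_real U y)))"
        by (intro integral_mono pw Bochner_Integration.integrable_add Bochner_Integration.integrable_diff integrable_abs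
            integrable_mult_right sU iA iD i1 iU)
      also have "\<dots> = (LBINT y. indicat_real (U - A) (y - X n)) + (LBINT y. indicat_real (U - A) y)
          + (2 * (LBINT y. indicat_real U y * (1 - indicat_real U (y - X n)))
          + ((LBINT y. indicat_real U (y - X n)) - (LBINT y. indicat_real U y)))"
        using sU iD i1 iU
        by (simp only: Bochner_Integration.integral_add Bochner_Integration.integral_diff integral_mult_right_zero
            Bochner_Integration.integrable_add Bochner_Integration.integrable_diff integrable_mult_right)
      also have "(LBINT y. indicat_real (U - A) (y - X n)) = (LBINT y. indicat_real (U - A) y)"
        by (rule integral_lborel_translation) simp
      also have "(LBINT y. indicat_real U (y - X n)) = (LBINT y. indicat_real U y)"
        by (rule integral_lborel_translation) simp
      finally show ?thesis by simp
    qed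
    obtain N where N: "\<And>n. n \<ge> N \<Longrightarrow> \<bar>\<integral>y. indicat_real U y * (1 - indicat_real U (y - X n)) \<partial>lborel\<bar> < e / 4"
      using LIMSEQ_D[OF lim, of "e / 4"] \<open>e > 0\<close> by auto
    show "\<exists>N. \<forall>n\<ge>N. norm ((LBINT y. \<bar>indicat_real A (y - X n) - indicat_real A y\<bar>) - 0) < e"
    proof (intro exI[of _ N] allI impI)
      fix n assume "n \<ge> N"
      have "0 \<le> (LBINT y. \<bar>indicat_real A (y - X n) - indicat_real A y\<bar>)" by simp
      then show "norm ((LBINT y. \<bar>indicat_real A (y - X n) - indicat_real A y\<bar>) - 0) < e"
        using bound[of n] N[OF \<open>n \<ge> N\<close>] mD by simp
    qed
  qed
  then have "(\<lambda>n. (LBINT y. \<bar>indicat_real A (y - X n) - indicat_real A y\<bar>) * \<bar>c\<bar>) \<longlonglongrightarrow> 0 * \<bar>c\<bar>"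
    by (intro tendsto_intros)
  moreover have "\<bar>indicator A (y - X n) *\<^sub>R c - indicator A y *\<^sub>R c\<bar> = \<bar>indicat_real A (y - X n) - indicat_real A y\<bar> * \<bar>c\<bar>" for y n
    by (simp add: abs_mult[symmetric] left_diff_distrib)
  ultimately show ?case by simp
next
  case (add f g)
  have ti: "integrable lborel (\<lambda>y. f (y - X n))" "integrable lborel (\<lambda>y. g (y - X n))" for n
    by (rule integrable_lborel_translation[OF add(1)] integrable_lborel_translation[OF add(3)])+
  have "(LBINT y. \<bar>(f (y - X n) + g (y - X n)) - (f y + g y)\<bar>)
      \<le> (LBINT y. \<bar>f (y - X n) - f y\<bar>) + (LBINT y. \<bar>g (y - X n) - g y\<bar>)" for n
  proof -
    have "(LBINT y. \<bar>(f (y - X n) + g (y - X n)) - (f y + g y)\<bar>)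
      \<le> (LBINT y. \<bar>f (y - X n) - f y\<bar> + \<bar>g (y - X n) - g y\<bar>)"
      using ti add by (intro integral_mono) auto
    also have "\<dots> = (LBINT y. \<bar>f (y - X n) - f y\<bar>) + (LBINT y. \<bar>g (y - X n) - g y\<bar>)"
      using ti add by (intro Bochner_Integration.integral_add) auto
    finally show ?thesis .
  qed
  then have b: "norm (LBINT y. \<bar>(f (y - X n) + g (y - X n)) - (f y + g y)\<bar>)
      \<le> (LBINT y. \<bar>f (y - X n) - f y\<bar>) + (LBINT y. \<bar>g (y - X n) - g y\<bar>)" for n
    by simp
  have "(\<lambda>n. (LBINT y. \<bar>f (y - X n) - f y\<bar>) + (LBINT y. \<bar>g (y - X n) - g y\<bar>)) \<longlonglongrightarrow> 0"
    using tendsto_add[OF add(2) add(4)] by simp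
  then show ?case
    by (rule Lim_null_comparison[rotated]) (intro always_eventually allI b)
next
  case (lim f s)
  have ti: "integrable lborel (\<lambda>y. f (y - X n))" "integrable lborel (\<lambda>y. s i (y - X n))" for n i
    by (rule integrable_lborel_translation[OF lim(5)] integrable_lborel_translation[OF lim(1)])+
  have [measurable]: "f \<in> borel_measurable borel" "s i \<in> borel_measurable borel" for i
    using lim by auto
  have conv: "(\<lambda>i. \<integral>y. \<bar>s i y - f y\<bar> \<partial>lborel) \<longlonglongrightarrow> (\<integral>y. 0 \<partial>(lborel :: 'a measure))"
  proof (rule integral_dominated_convergence[where w = "\<lambda>y. 3 * \<bar>f y\<bar>"])
    show "AE y in lborel. (\<lambda>i. \<bar>s i y - f y\<bar>) \<longlonglongrightarrow> 0"
      using lim(3) by (intro AE_I2) (auto intro!: tendsto_rabs_zero simp: LIM_zero)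
    show "AE y in lborel. norm \<bar>s i y - f y\<bar> \<le> 3 * \<bar>f y\<bar>" for i
    proof (intro AE_I2)
      fix y
      have "\<bar>s i y\<bar> \<le> 2 * \<bar>f y\<bar>" using lim(4)[of y i] by simp
      then show "norm \<bar>s i y - f y\<bar> \<le> 3 * \<bar>f y\<bar>" by simp
    qed
  qed (use lim in auto)
  have bound: "(LBINT y. \<bar>f (y - X n) - f y\<bar>)
      \<le> 2 * (LBINT y. \<bar>s i y - f y\<bar>) + (LBINT y. \<bar>s i (y - X n) - s i y\<bar>)" for n i
  proof -
    have "(LBINT y. \<bar>f (y - X n) - f y\<bar>)
        \<le> (LBINT y. \<bar>s i (y - X n) - f (y - X n)\<bar> + \<bar>s i y - f y\<bar> + \<bar>s i (y - X n) - s i y\<bar>)"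
      using ti lim(1,5) by (intro integral_mono) auto
    also have "\<dots> = (LBINT y. \<bar>s i (y - X n) - f (y - X n)\<bar>) + (LBINT y. \<bar>s i y - f y\<bar>)
        + (LBINT y. \<bar>s i (y - X n) - s i y\<bar>)"
      using ti lim(1,5) by simp
    also have "(LBINT y. \<bar>s i (y - X n) - f (y - X n)\<bar>) = (LBINT y. \<bar>s i y - f y\<bar>)"
      by (rule integral_lborel_translation) measurable
    finally show ?thesis by simp
  qed
  show ?case
  proof (rule LIMSEQ_I)
    fix e :: real assume "e > 0"
    obtain i where i: "\<bar>\<integral>y. \<bar>s i y - f y\<bar> \<partial>lborel\<bar> < e / 4"
      using LIMSEQ_D[OF conv, of "e / 4"] \<open>e > 0\<close> by auto
    obtain N where N: "\<And>n. n \<ge> N \<Longrightarrow> \<bar>\<integral>y. \<bar>s i (y - X n) - s i y\<bar> \<partial>lborel\<bar> < e / 4"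
      using LIMSEQ_D[OF lim(2)[of i], of "e / 4"] \<open>e > 0\<close> by auto
    show "\<exists>N. \<forall>n\<ge>N. norm ((LBINT y. \<bar>f (y - X n) - f y\<bar>) - 0) < e"
    proof (intro exI[of _ N] allI impI)
      fix n assume "n \<ge> N"
      have "0 \<le> (LBINT y. \<bar>f (y - X n) - f y\<bar>)" by simp
      then show "norm ((LBINT y. \<bar>f (y - X n) - f y\<bar>) - 0) < e"
        using bound[of n i] N[OF \<open>n \<ge> N\<close>] i \<open>e > 0\<close> by simp
    qed
  qed
qed

lemma L1_translation_small:
  fixes f :: "'a::euclidean_space \<Rightarrow> real"
  assumes f: "integrable lborel f" and e: "e > 0"
  obtains d where "d > 0" "\<And>z. norm z < d \<Longrightarrow> (LBINT y. \<bar>f (y - z) - f y\<bar>) < e"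
proof -
  have "eventually (\<lambda>z. (LBINT y. \<bar>f (y - z) - f y\<bar>) < e) (at 0)"
  proof (rule sequentially_imp_eventually_at, safe)
    fix X :: "nat \<Rightarrow> 'a" assume "X \<longlonglongrightarrow> 0"
    from order_tendstoD(2)[OF tendsto_L1_translation[OF f this] e]
    show "eventually (\<lambda>n. (LBINT y. \<bar>f (y - X n) - f y\<bar>) < e) sequentially" .
  qed
  then obtain d where d: "d > 0" "\<And>z. z \<noteq> 0 \<Longrightarrow> norm z < d \<Longrightarrow> (LBINT y. \<bar>f (y - z) - f y\<bar>) < e"
    unfolding eventually_at by (auto simp: dist_norm)
  show ?thesis
    by (rule that[OF d(1)]) (use d(2) e in \<open>case_tac "z = 0"; force\<close>)
qed

text \<open>For nonnegative numbers \<open>(x - y)^2 \<le> |x^2 - y^2|\<close>. Hence the L1 result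
  can be applied to the squares of the positive and of the negative part.\<close>

lemma L2_translation_small:
  fixes f :: "'a::euclidean_space \<Rightarrow> real"
  assumes f: "integrable lborel (\<lambda>y. (f y)\<^sup>2)" and [measurable]: "f \<in> borel_measurable borel" and e: "e > 0"
  obtains d where "d > 0" "\<And>z. norm z < d \<Longrightarrow> integrable lborel (\<lambda>y. (f (y - z) - f y)\<^sup>2)"
    "\<And>z. norm z < d \<Longrightarrow> (LBINT y. (f (y - z) - f y)\<^sup>2) < e"
proof -
  let ?p = "\<lambda>y. (max 0 (f y))\<^sup>2" and ?n = "\<lambda>y. (max 0 (- f y))\<^sup>2"
  have ip: "integrable lborel ?p" "integrable lborel ?n"
    by (rule Bochner_Integration.integrable_bound[OF f]; auto simp: max_def)+
  obtain d1 where d1: "d1 > 0" "\<And>z. norm z < d1 \<Longrightarrow> (LBINT y. \<bar>?p (y - z) - ?p y\<bar>) < e / 4"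
    using L1_translation_small[OF ip(1), of "e / 4"] e by auto
  obtain d2 where d2: "d2 > 0" "\<And>z. norm z < d2 \<Longrightarrow> (LBINT y. \<bar>?n (y - z) - ?n y\<bar>) < e / 4"
    using L1_translation_small[OF ip(2), of "e / 4"] e by auto
  have sq: "(max 0 u - max 0 u')\<^sup>2 \<le> \<bar>(max 0 u)\<^sup>2 - (max 0 u')\<^sup>2\<bar>" for u u' :: real
  proof -
    have "(x - y)\<^sup>2 \<le> \<bar>x\<^sup>2 - y\<^sup>2\<bar>" if "x \<ge> 0" "y \<ge> 0" for x y :: real
    proof -
      have "\<bar>x - y\<bar> * \<bar>x - y\<bar> \<le> \<bar>x - y\<bar> * \<bar>x + y\<bar>" using that by (intro mult_left_mono) auto
      moreover have "\<bar>x - y\<bar> * \<bar>x - y\<bar> = (x - y)\<^sup>2" by (simp add: power2_eq_square)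
      moreover have "\<bar>x - y\<bar> * \<bar>x + y\<bar> = \<bar>x\<^sup>2 - y\<^sup>2\<bar>"
        unfolding abs_mult[symmetric] by (simp add: power2_eq_square algebra_simps)
      ultimately show ?thesis by simp
    qed
    then show ?thesis by simp
  qed
  have sq2: "(x - y)\<^sup>2 \<le> 2 * x\<^sup>2 + 2 * y\<^sup>2" for x y :: real
    using sum_squares_ge_zero[of "x + y" 0] by (simp add: power2_eq_square algebra_simps)
  have pw: "(u - u')\<^sup>2 \<le> 2 * \<bar>(max 0 u)\<^sup>2 - (max 0 u')\<^sup>2\<bar> + 2 * \<bar>(max 0 (- u))\<^sup>2 - (max 0 (- u'))\<^sup>2\<bar>" for u u' :: real
  proof -
    have eq: "u - u' = (max 0 u - max 0 u') - (max 0 (- u) - max 0 (- u'))" by simp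
    have "(u - u')\<^sup>2 \<le> 2 * (max 0 u - max 0 u')\<^sup>2 + 2 * (max 0 (- u) - max 0 (- u'))\<^sup>2"
      by (subst eq) (rule sq2)
    then show ?thesis using sq[of u u'] sq[of "-u" "-u'"] by simp
  qed
  show ?thesis
  proof (rule that[of "min d1 d2"])
    fix z :: 'a assume z: "norm z < min d1 d2"
    have ti: "integrable lborel (\<lambda>y. \<bar>?p (y - z) - ?p y\<bar>)" "integrable lborel (\<lambda>y. \<bar>?n (y - z) - ?n y\<bar>)"
      using integrable_lborel_translation[OF ip(1), of z] integrable_lborel_translation[OF ip(2), of z] ip by auto
    have I: "integrable lborel (\<lambda>y. 2 * \<bar>?p (y - z) - ?p y\<bar> + 2 * \<bar>?n (y - z) - ?n y\<bar>)"
      by (intro Bochner_Integration.integrable_add integrable_mult_right ti)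
    show J: "integrable lborel (\<lambda>y. (f (y - z) - f y)\<^sup>2)"
      by (rule Bochner_Integration.integrable_bound[OF I]) (use pw in \<open>auto intro: order_trans[OF _ abs_ge_self]\<close>)
    have "(LBINT y. (f (y - z) - f y)\<^sup>2) \<le> (LBINT y. 2 * \<bar>?p (y - z) - ?p y\<bar> + 2 * \<bar>?n (y - z) - ?n y\<bar>)"
      by (intro integral_mono J I pw)
    also have "\<dots> = 2 * (LBINT y. \<bar>?p (y - z) - ?p y\<bar>) + 2 * (LBINT y. \<bar>?n (y - z) - ?n y\<bar>)"
      using ti by simp
    also have "\<dots> < e" using d1(2)[of z] d2(2)[of z] z by simp
    finally show "(LBINT y. (f (y - z) - f y)\<^sup>2) < e" .
  qed (use d1 d2 in auto)
qed

section \<open>Short times and the dual logarithmic Sobolev inequality\<close>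

context gaussian_score
begin

lemma integral_h:
  assumes t: "t > 0"
  shows "(LBINT y. h t y) = 1"
proof -
  have int: "integrable (\<mu> \<Otimes>\<^sub>M lborel) (\<lambda>(x, y). gk t (y - x))"
    by (rule integrable_joint_bound[OF t, where C = 1]) (auto simp: distrib_left)
  have "(LBINT y. gk t (y - x)) = 1" for x :: 'a
    using integral_gk_shift(1)[OF t, of x] by (simp add: has_bochner_integral_iff)
  then show ?thesis using integral_h_times(3)[OF int] by (simp add: h_def)
qed

lemma integrable_h_bounded:
  assumes t: "t > 0" and [measurable]: "\<psi> \<in> borel_measurable borel" and N: "\<And>x. \<bar>\<psi> x\<bar> \<le> N"
  shows "integrable lborel (\<lambda>y. h t y * \<psi> y)"
proof (rule Bochner_Integration.integrable_bound[OF integrable_mult_right[OF integrable_densities(1)[OF t], of N]])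
  have "\<bar>h t y * \<psi> y\<bar> \<le> \<bar>N * h t y\<bar>" for y
    using mult_left_mono[OF N[of y] h_nonneg[of t y]] h_nonneg[of t y] N[of y]
    by (simp add: abs_mult mult.commute)
  then show "AE y in lborel. norm (h t y * \<psi> y) \<le> norm (N * h t y)" by simp
qed measurable

text \<open>Gibbs' inequality: the relative entropy of \<open>h t\<close> with respect to the
  probability density \<open>exp \<psi> * gk v / Z\<close> is nonnegative. For bounded
  \<open>\<psi>\<close> the right-hand side can be followed to \<open>t = 0\<close>, where the
  entropy itself is not under control.\<close>

lemma entropy_h_ge:
  assumes t: "t > 0" and [measurable]: "\<psi> \<in> borel_measurable borel" and N: "\<And>x. \<bar>\<psi> x\<bar> \<le> N"
  defines "Z \<equiv> \<integral>y. exp (\<psi> y) * gk v (y::'a) \<partial>lborel"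
  shows "entropy_h t \<ge> (LBINT y. h t y * \<psi> y) - (real DIM('a) / 2) * ln (2 * pi * v)
      - (m2 + real DIM('a) * t) / (2 * v) - ln Z"
proof -
  let ?d = "real DIM('a) / 2"
  have bd: "exp (- N) \<le> exp (\<psi> y)" "exp (\<psi> y) \<le> exp N" for y using N[of y] by auto
  have iZ: "integrable lborel (\<lambda>y::'a. exp (\<psi> y) * gk v y)"
    by (rule Bochner_Integration.integrable_bound[OF integrable_mult_right[OF integrable_gk[OF v], of "exp N"]])
      (auto intro!: mult_right_mono bd)
  have "exp (- N) = (LBINT y. exp (- N) * gk v (y::'a))" using v by simp
  also have "\<dots> \<le> Z" unfolding Z_def
    using v by (intro integral_mono iZ integrable_mult_right integrable_gk mult_right_mono bd) auto
  finally have Z: "Z > 0" using less_le_trans[OF exp_gt_zero] by blast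
  note ih = integrable_h_bounded[OF t assms(2) N] integrable_densities(1)[OF t] h_norm2(1)[OF t]
  \<comment> \<open>The \<open>- 1\<close> and the last term stem from
    \<open>ln s \<le> s - 1\<close>; they cancel on integration, as both densities have mass
    1.\<close>
  have "(LBINT y. h t y * \<psi> y - (?d * ln (2 * pi * v) + ln Z - 1) * h t y - h t y * (norm y)\<^sup>2 / (2 * v)
      - (exp (\<psi> y) * gk v y) / Z) \<le> entropy_h t"
    unfolding entropy_h_def
  proof (rule integral_mono)
    show "integrable lborel (\<lambda>y. h t y * ln (h t y))" by (rule integrable_h_ln_h[OF t])
    show "integrable lborel (\<lambda>y. h t y * \<psi> y - (?d * ln (2 * pi * v) + ln Z - 1) * h t y - h t y * (norm y)\<^sup>2 / (2 * v)
      - (exp (\<psi> y) * gk v y) / Z)"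
      by (intro Bochner_Integration.integrable_diff ih integrable_mult_right integrable_divide iZ)
    fix y :: 'a
    have p: "h t y > 0" by (rule h_lower(1)[OF t])
    define Q where "Q = exp (\<psi> y) * gk v y / Z"
    have Q: "Q > 0" unfolding Q_def by (intro divide_pos_pos mult_pos_pos exp_gt_zero gk_pos v Z)
    have lQ: "ln Q = \<psi> y - ?d * ln (2 * pi * v) - (norm y)\<^sup>2 / (2 * v) - ln Z"
      unfolding Q_def using Z gk_pos[OF v, of y] by (simp add: ln_div ln_mult ln_gk[OF v])
    have "ln (Q / h t y) \<le> Q / h t y - 1" using p Q by (intro ln_le_minus_one) auto
    then have "ln Q - ln (h t y) \<le> Q / h t y - 1" using p Q by (subst (asm) ln_div) auto
    then have "h t y * (ln Q - ln (h t y)) \<le> h t y * (Q / h t y - 1)"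
      using p by (intro mult_left_mono) auto
    also have "\<dots> = Q - h t y" using p by (simp add: right_diff_distrib)
    finally have "h t y * ln Q + h t y - Q \<le> h t y * ln (h t y)" by (simp add: right_diff_distrib)
    then show "h t y * \<psi> y - (?d * ln (2 * pi * v) + ln Z - 1) * h t y - h t y * (norm y)\<^sup>2 / (2 * v)
      - (exp (\<psi> y) * gk v y) / Z \<le> h t y * ln (h t y)"
      unfolding lQ unfolding Q_def by (simp add: algebra_simps)
  qed
  moreover have "(LBINT y. h t y * \<psi> y - (?d * ln (2 * pi * v) + ln Z - 1) * h t y - h t y * (norm y)\<^sup>2 / (2 * v)
      - (exp (\<psi> y) * gk v y) / Z)
    = (LBINT y. h t y * \<psi> y) - (?d * ln (2 * pi * v) + ln Z - 1) * 1
      - (m2 + real DIM('a) * t) / (2 * v) - Z / Z"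
    using ih iZ integral_h[OF t] h_norm2(2)[OF t] by (simp add: Z_def[symmetric])
  ultimately show ?thesis using Z by simp
qed

lemma density_facts:
  assumes \<rho>: "\<rho> \<in> borel_measurable borel" "\<And>x. \<rho> x \<ge> 0" and \<mu>: "\<mu> = density lborel (\<lambda>x. ennreal (\<rho> x))"
  shows "integrable lborel \<rho>" "(LBINT x. \<rho> x) = 1"
proof -
  note [measurable] = \<rho>(1)
  have "emeasure \<mu> UNIV = 1" using emeasure_space_1 by simp
  then have *: "(\<integral>\<^sup>+x. ennreal (\<rho> x) \<partial>lborel) = 1" unfolding \<mu> by (subst (asm) emeasure_density) auto
  show "integrable lborel \<rho>"
    by (rule integrableI_nn_integral_finite[of _ _ 1]) (use \<rho> * in auto)
  show "(LBINT x. \<rho> x) = 1"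
    by (rule integral_eq_nn_integral[THEN trans]) (use \<rho> * in auto)
qed

text \<open>\<open>\<psi>\<close> is merely measurable, so weak convergence of the laws would not
  do. But the mean \<open>\<Psi> z\<close> of \<open>\<psi> (z + X)\<close> is continuous at 0,
  since translations of the density \<open>\<rho>\<close> are continuous in L1, and the integral in
  question is the Gaussian mean of \<open>\<Psi>\<close>.\<close>

lemma h_psi_limit:
  assumes \<rho>: "\<rho> \<in> borel_measurable borel" "\<And>x. \<rho> x \<ge> 0" and \<mu>: "\<mu> = density lborel (\<lambda>x. ennreal (\<rho> x))"
    and [measurable]: "\<psi> \<in> borel_measurable borel" and N: "\<And>x. \<bar>\<psi> x\<bar> \<le> N"
  shows "((\<lambda>t. \<integral>y. h t y * \<psi> y \<partial>lborel) \<longlongrightarrow> (\<integral>x. \<psi> x \<partial>\<mu>)) (at_right 0)"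
proof -
  note [measurable] = \<rho>(1)
  note D = density_facts[OF \<rho> \<mu>]
  have N0: "N \<ge> 0" using N[of 0] by simp
  have i\<rho>\<psi>: "integrable lborel (\<lambda>x. \<rho> x * \<phi> x)" if [measurable]: "\<phi> \<in> borel_measurable borel" and "\<And>x. \<bar>\<phi> x\<bar> \<le> c"
    for \<phi> :: "'a \<Rightarrow> real" and c
  proof (rule Bochner_Integration.integrable_bound[OF integrable_mult_right[OF D(1), of c]])
    have "\<bar>\<rho> x * \<phi> x\<bar> \<le> \<bar>c * \<rho> x\<bar>" for x
      using mult_left_mono[OF that(2)[of x] \<rho>(2)[of x]] \<rho>(2)[of x] that(2)[of x] by (simp add: abs_mult mult.commute)
    then show "AE x in lborel. norm (\<rho> x * \<phi> x) \<le> norm (c * \<rho> x)" by simp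
  qed measurable
  have dens: "(\<integral>x. \<phi> x \<partial>\<mu>) = (LBINT x. \<rho> x * \<phi> x)" if "\<phi> \<in> borel_measurable borel" for \<phi> :: "'a \<Rightarrow> real"
    unfolding \<mu> using that \<rho> by (subst integral_density) auto
  define \<Psi> where "\<Psi> z = (\<integral>x. \<psi> (z + x) \<partial>\<mu>)" for z
  have \<Psi>_eq: "\<Psi> z - \<Psi> 0 = (LBINT y. (\<rho> (y - z) - \<rho> y) * \<psi> y)" for z
  proof -
    have "\<Psi> z = (LBINT x. \<rho> x * \<psi> (z + x))" unfolding \<Psi>_def by (rule dens) simp
    also have "\<dots> = (LBINT y. \<rho> (y - z) * \<psi> y)"
      using integral_lborel_translation[of "\<lambda>x. \<rho> x * \<psi> (z + x)" z] by simp
    finally have 1: "\<Psi> z = (LBINT y. \<rho> (y - z) * \<psi> y)" .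
    have 2: "\<Psi> 0 = (LBINT y. \<rho> y * \<psi> y)" unfolding \<Psi>_def by (simp add: dens)
    have 3: "integrable lborel (\<lambda>y. \<rho> (y - z) * \<psi> y)"
      using integrable_lborel_translation[OF i\<rho>\<psi>[of "\<lambda>x. \<psi> (z + x)" N], of z] N by simp
    show ?thesis unfolding 1 2 using 3 i\<rho>\<psi>[OF assms(4) N] by (simp add: left_diff_distrib)
  qed
  have \<Psi>_le: "\<bar>\<Psi> z - \<Psi> 0\<bar> \<le> N * (LBINT y. \<bar>\<rho> (y - z) - \<rho> y\<bar>)" for z
  proof -
    have i: "integrable lborel (\<lambda>y. N * \<bar>\<rho> (y - z) - \<rho> y\<bar>)"
      using integrable_lborel_translation[OF D(1), of z] D(1) by simp
    have pw: "\<bar>(\<rho> (y - z) - \<rho> y) * \<psi> y\<bar> \<le> N * \<bar>\<rho> (y - z) - \<rho> y\<bar>" for y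
      using mult_left_mono[OF N[of y], of "\<bar>\<rho> (y - z) - \<rho> y\<bar>"] by (simp add: abs_mult mult.commute)
    have "\<bar>\<Psi> z - \<Psi> 0\<bar> \<le> (LBINT y. \<bar>(\<rho> (y - z) - \<rho> y) * \<psi> y\<bar>)"
      unfolding \<Psi>_eq by (rule integral_abs_bound)
    also have "\<dots> \<le> (LBINT y. N * \<bar>\<rho> (y - z) - \<rho> y\<bar>)"
      by (intro integral_mono pw i Bochner_Integration.integrable_bound[OF i])
        (use pw in \<open>auto intro: order_trans[OF _ abs_ge_self]\<close>)
    finally show ?thesis by simp
  qed
  have \<Psi>_bd: "\<bar>\<Psi> z\<bar> \<le> N" for z
  proof -
    have "\<bar>\<Psi> z\<bar> \<le> (\<integral>x. \<bar>\<psi> (z + x)\<bar> \<partial>\<mu>)" unfolding \<Psi>_def by (rule integral_abs_bound)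
    also have "\<dots> \<le> (\<integral>x. N \<partial>\<mu>)" by (intro integral_mono N integrable_bounded[of _ N]) (use N N0 in auto)
    finally show ?thesis by simp
  qed
  have [measurable]: "\<Psi> \<in> borel_measurable borel" unfolding \<Psi>_def[abs_def] by measurable
  \<comment> \<open>Fubini's theorem twice, with the substitution \<open>y = z + x\<close> in
    between.\<close>
  have h\<psi>: "(LBINT y. h t y * \<psi> y) = (LBINT z. gk t z * \<Psi> z)" if t: "t > 0" for t
  proof -
    have int1: "integrable (\<mu> \<Otimes>\<^sub>M lborel) (\<lambda>(x, y). gk t (y - x) * \<psi> y)"
    proof (rule integrable_joint_bound[OF t, where C = N])
      show "norm (gk t (y - x) * \<psi> y) \<le> N * (gk t (y - x) * (1 + (norm x)\<^sup>2 + (norm y)\<^sup>2))" for x y :: 'a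
      proof -
        have "\<bar>\<psi> y\<bar> \<le> N * (1 + (norm x)\<^sup>2 + (norm y)\<^sup>2)"
          using N[of y] mult_left_mono[of 1 "1 + (norm x)\<^sup>2 + (norm y)\<^sup>2" N] N0 by simp
        from mult_left_mono[OF this gk_nonneg[of t "y - x"]] show ?thesis by (simp add: abs_mult mult.left_commute)
      qed
    qed measurable
    have int2: "integrable (\<mu> \<Otimes>\<^sub>M lborel) (\<lambda>(x, z). gk t z * \<psi> (z + x))"
    proof (rule ml.Fubini_integrable)
      have b: "\<bar>gk t z * \<psi> (z + x)\<bar> \<le> N * gk t z" for x z
        using mult_right_mono[OF N[of "z + x"] gk_nonneg[of t z]] by (simp add: abs_mult mult.commute)
      then have "\<bar>gk t z * \<psi> (z + x)\<bar> \<le> \<bar>N * gk t z\<bar>" for x z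
        by (rule order_trans[OF _ abs_ge_self])
      then have i: "integrable lborel (\<lambda>z. gk t z * \<psi> (z + x))" for x
        by (intro Bochner_Integration.integrable_bound[OF integrable_mult_right[OF integrable_gk[OF t], of N]]) simp_all
      then show "AE x in \<mu>. integrable lborel (\<lambda>y. case (x, y) of (x, z) \<Rightarrow> gk t z * \<psi> (z + x))" by simp
      have "\<bar>\<integral>z. \<bar>gk t z * \<psi> (z + x)\<bar> \<partial>lborel\<bar> \<le> N" for x
      proof -
        have "(LBINT z. \<bar>gk t z * \<psi> (z + x)\<bar>) \<le> (LBINT z. N * gk t (z::'a))"
          by (intro integral_mono integrable_abs i integrable_mult_right integrable_gk t b)
        then show ?thesis using t by simp
      qed
      then show "integrable \<mu> (\<lambda>x. \<integral>y. norm (case (x, y) of (x, z) \<Rightarrow> gk t z * \<psi> (z + x)) \<partial>lborel)"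
        by (intro integrable_bounded[of _ N]) auto
    qed measurable
    have "(LBINT y. h t y * \<psi> y) = (LBINT y. (\<integral>x. gk t (y - x) * \<psi> y \<partial>\<mu>))"
      unfolding h_def by simp
    also have "\<dots> = (\<integral>x. (LBINT y. gk t (y - x) * \<psi> y) \<partial>\<mu>)" by (rule integral_h_times(3)[OF int1])
    also have "\<dots> = (\<integral>x. (LBINT z. gk t z * \<psi> (z + x)) \<partial>\<mu>)"
    proof -
      have "(LBINT y. gk t (y - x) * \<psi> y) = (LBINT z. gk t z * \<psi> (z + x))" for x
        using integral_lborel_translation[of "\<lambda>z. gk t z * \<psi> (z + x)" x] by simp
      then show ?thesis by simp
    qed
    also have "\<dots> = (LBINT z. (\<integral>x. gk t z * \<psi> (z + x) \<partial>\<mu>))"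
      by (rule integral_h_times(3)[OF int2, symmetric])
    finally show ?thesis unfolding \<Psi>_def by simp
  qed
  have est: "\<exists>b>0. \<forall>t. 0 < t \<and> t < b \<longrightarrow> \<bar>(LBINT y. h t y * \<psi> y) - \<Psi> 0\<bar> < e" if e: "e > 0" for e
  proof -
    have e': "e / (2 * (N + 1)) > 0" using e N0 by simp
    obtain d where d: "d > 0" "\<And>z. norm z < d \<Longrightarrow> (LBINT y. \<bar>\<rho> (y - z) - \<rho> y\<bar>) < e / (2 * (N + 1))"
      using L1_translation_small[OF D(1) e'] by metis
    \<comment> \<open>Within distance \<open>d\<close> the continuity of \<open>\<Psi>\<close> is
      used; farther out the trivial bound \<open>2 N\<close> is at most
      \<open>2 N |z|^2 / d^2\<close>, whose Gaussian mean is of order \<open>t\<close>.\<close>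
    have pw: "\<bar>\<Psi> z - \<Psi> 0\<bar> \<le> e / 2 + (2 * N / d\<^sup>2) * (norm z)\<^sup>2" for z
    proof (cases "norm z < d")
      case True
      have "\<bar>\<Psi> z - \<Psi> 0\<bar> \<le> N * (e / (2 * (N + 1)))"
        using d(2)[OF True] N0 by (intro order_trans[OF \<Psi>_le] mult_left_mono) auto
      also have "\<dots> \<le> e / 2" using N0 e by (simp add: field_simps)
      also have "\<dots> \<le> e / 2 + (2 * N / d\<^sup>2) * (norm z)\<^sup>2" using N0 by simp
      finally show ?thesis .
    next
      case False
      then have "d\<^sup>2 \<le> (norm z)\<^sup>2" using d(1) by (intro power_mono) auto
      then have "2 * N \<le> (2 * N / d\<^sup>2) * (norm z)\<^sup>2"
        using N0 d(1) mult_left_mono[of "d\<^sup>2" "(norm z)\<^sup>2" "2 * N"] by (simp add: field_simps)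
      then show ?thesis using \<Psi>_bd[of z] \<Psi>_bd[of 0] e by linarith
    qed
    define c where "c = 2 * N / d\<^sup>2 * real DIM('a)"
    have c: "c \<ge> 0" using N0 by (simp add: c_def)
    have main: "\<bar>(LBINT y. h t y * \<psi> y) - \<Psi> 0\<bar> \<le> e / 2 + c * t" if t: "t > 0" for t
    proof -
      have "\<bar>gk t z * \<Psi> z\<bar> \<le> \<bar>N * gk t z\<bar>" for z
        using mult_right_mono[OF \<Psi>_bd[of z] gk_nonneg[of t z]] N0 by (simp add: abs_mult mult.commute)
      then have i1: "integrable lborel (\<lambda>z. gk t z * \<Psi> z)"
        by (intro Bochner_Integration.integrable_bound[OF integrable_mult_right[OF integrable_gk[OF t], of N]]) simp_all
      have "(LBINT y. h t y * \<psi> y) - \<Psi> 0 = (LBINT z. gk t z * (\<Psi> z - \<Psi> 0))"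
        unfolding h\<psi>[OF t] using i1 t by (simp add: right_diff_distrib)
      also have "\<bar>\<dots>\<bar> \<le> (LBINT z. \<bar>gk t z * (\<Psi> z - \<Psi> 0)\<bar>)" by (rule integral_abs_bound)
      also have "\<dots> \<le> (LBINT z. (e / 2) * gk t z + (2 * N / d\<^sup>2) * (gk t z * (norm (z::'a))\<^sup>2))"
      proof (rule integral_mono)
        show "integrable lborel (\<lambda>z. \<bar>gk t z * (\<Psi> z - \<Psi> 0)\<bar>)"
          using i1 t by (simp add: right_diff_distrib)
        show "integrable lborel (\<lambda>z. (e / 2) * gk t z + (2 * N / d\<^sup>2) * (gk t z * (norm (z::'a))\<^sup>2))"
          using integrable_gk_inner(4)[OF t] t by (intro Bochner_Integration.integrable_add integrable_mult_right integrable_gk) auto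
        show "\<bar>gk t z * (\<Psi> z - \<Psi> 0)\<bar> \<le> (e / 2) * gk t z + (2 * N / d\<^sup>2) * (gk t z * (norm z)\<^sup>2)" for z
          using mult_left_mono[OF pw[of z] gk_nonneg[of t z]]
          unfolding abs_mult distrib_left by (simp add: ac_simps)
      qed
      also have "\<dots> = (e / 2) * 1 + (2 * N / d\<^sup>2) * (real DIM('a) * t)"
        using integrable_gk_inner(4)[OF t, where 'a = 'a] t integral_gk_norm2[OF t, where 'a = 'a] by simp
      finally show ?thesis by (simp add: c_def)
    qed
    show ?thesis
    proof (intro exI[of _ "e / (2 * (c + 1))"] conjI allI impI)
      show "e / (2 * (c + 1)) > 0" using e c by simp
      fix t assume t: "0 < t \<and> t < e / (2 * (c + 1))"
      have "c * t \<le> (c + 1) * t" using t by (simp add: distrib_right)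
      also have "\<dots> < e / 2" using t c by (simp add: field_simps)
      finally show "\<bar>(LBINT y. h t y * \<psi> y) - \<Psi> 0\<bar> < e" using main[of t] t by linarith
    qed
  qed
  have "((\<lambda>t. \<integral>y. h t y * \<psi> y \<partial>lborel) \<longlongrightarrow> \<Psi> 0) (at_right 0)"
  proof (rule tendstoI)
    fix e :: real assume "e > 0"
    then obtain b where "b > 0" "\<forall>t. 0 < t \<and> t < b \<longrightarrow> \<bar>(LBINT y. h t y * \<psi> y) - \<Psi> 0\<bar> < e"
      using est by blast
    then show "\<forall>\<^sub>F t in at_right 0. dist (LBINT y. h t y * \<psi> y) (\<Psi> 0) < e"
      unfolding eventually_at_right_field dist_real_def by (intro exI[of _ b]) auto
  qed
  then show ?thesis by (simp add: \<Psi>_def)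
qed

text \<open>By the Donsker--Varadhan formula, the supremum over \<open>\<psi>\<close> of the first two terms is the entropy of
  \<open>\<mu>\<close> relative to \<open>gk v\<close>. The gap comes from the mean value theorem for \<open>Phi\<close> on [1, 2].\<close>

lemma dual_lsi_with_gap:
  assumes \<rho>: "\<rho> \<in> borel_measurable borel" "\<And>x. \<rho> x \<ge> 0" and \<mu>: "\<mu> = density lborel (\<lambda>x. ennreal (\<rho> x))"
  obtains r where "1 < r" "r < 2"
    "\<And>\<psi> N. \<psi> \<in> borel_measurable borel \<Longrightarrow> (\<And>x. \<bar>\<psi> x\<bar> \<le> N) \<Longrightarrow>
      (\<integral>x. \<psi> x \<partial>\<mu>) - ln (LBINT y. exp (\<psi> y) * gk v y) + gap r / (2 * (v + r)\<^sup>2) \<le> A2 / (2 * v)"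
proof -
  let ?n = "real DIM('a)"
  define K where "K = A2 - m2 + v * real DIM('a)"
  obtain r where r: "1 < r" "r < 2"
    "Phi 1 + gap r / (2 * (v + r)\<^sup>2) \<le> - (?n / 2) * ln (2 * pi) - ?n / 2"
    by (rule gap_le_Phi)
  show ?thesis
  proof (rule that[OF r(1,2)])
    fix \<psi> :: "'a \<Rightarrow> real" and N assume \<psi>: "\<psi> \<in> borel_measurable borel" "\<And>x. \<bar>\<psi> x\<bar> \<le> N"
    let ?Z = "\<integral>y. exp (\<psi> y) * gk v y \<partial>lborel"
    \<comment> \<open>A lower bound for \<open>Phi t\<close> all of whose terms have limits at 0. In
      the limit \<open>m2\<close>, the dimension and the logarithms cancel, and
      \<open>A2 / (2 * v)\<close> remains.\<close>
    let ?L = "\<lambda>t. (LBINT y. h t y * \<psi> y) - (?n / 2) * ln (2 * pi * v)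
      - (m2 + ?n * t) / (2 * v) - ln ?Z + (1 / 2) * (- K / (v + t) + ?n * ln (v + t))"
    have "?L t \<le> Phi 1" if "0 < t" "t < 1" for t
      using entropy_h_ge[OF that(1) \<psi>] Phi_mono[of t 1] that unfolding Phi_def K_def[symmetric] by simp
    then have ev: "\<forall>\<^sub>F t in at_right 0. ?L t \<le> Phi 1"
      unfolding eventually_at_right_field by (intro exI[of _ 1]) auto
    have "(?L \<longlongrightarrow> (\<integral>x. \<psi> x \<partial>\<mu>) - (?n / 2) * ln (2 * pi * v)
      - (m2 + ?n * 0) / (2 * v) - ln ?Z + (1 / 2) * (- K / (v + 0) + ?n * ln (v + 0))) (at_right 0)"
      by (intro tendsto_intros h_psi_limit[OF \<rho> \<mu> \<psi>]) (use v in auto)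
    then have "(\<integral>x. \<psi> x \<partial>\<mu>) - (?n / 2) * ln (2 * pi * v)
      - (m2 + ?n * 0) / (2 * v) - ln ?Z + (1 / 2) * (- K / (v + 0) + ?n * ln (v + 0)) \<le> Phi 1"
      using tendsto_upperbound[OF _ ev] by simp
    then have "(\<integral>x. \<psi> x \<partial>\<mu>) - (?n / 2) * ln (2 * pi * v)
      - m2 / (2 * v) - ln ?Z + (1 / 2) * (- (K / v)) + (?n / 2) * ln v \<le> Phi 1"
      unfolding minus_divide_left[symmetric] by (simp add: diff_divide_distrib)
    then have "(\<integral>x. \<psi> x \<partial>\<mu>) - ln ?Z + gap r / (2 * (v + r)\<^sup>2)
      \<le> (?n / 2) * ln (2 * pi * v) - (?n / 2) * ln (2 * pi) - (?n / 2) * ln v - ?n / 2 + m2 / (2 * v) + (1 / 2) * (K / v)"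
      using r(3) by linarith
    also have "\<dots> = A2 / (2 * v)"
    proof -
      have "ln (2 * pi * v) = ln (2 * pi) + ln v" using v by (simp add: ln_mult)
      moreover have "m2 / (2 * v) + (1 / 2) * (K / v) = A2 / (2 * v) + ?n / 2" using v by (simp add: K_def field_simps)
      ultimately show ?thesis by (simp add: distrib_left)
    qed
    finally show "(\<integral>x. \<psi> x \<partial>\<mu>) - ln ?Z + gap r / (2 * (v + r)\<^sup>2) \<le> A2 / (2 * v)" .
  qed
qed

end

section \<open>From a small gap to a small score\<close>

context gaussian_score
begin

text \<open>Since \<open>a X\<close> is close to a function of \<open>X + \<surd>t Z\<close> and the laws of \<open>X + \<surd>t Z\<close> given different
  values of \<open>X\<close> in a ball overlap, \<open>a\<close> is nearly constant on the ball; its mean being 0, it is small.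
  The tail is controlled by the linear growth of \<open>w\<close>.\<close>

lemma A2_le_gap:
  assumes mean: "(\<integral>x. a x \<partial>\<mu>) = 0" and t: "1 \<le> t" "t \<le> 2" and R: "R \<ge> 0"
  defines "\<kappa> \<equiv> (4 * pi) powr (- (real DIM('a) / 2)) * exp (- ((R + 1)\<^sup>2 / 2))"
    and "V \<equiv> measure lborel (cball (0::'a) 1)"
    and "C \<equiv> 2 + 4 * (1 + v)\<^sup>2 * (1 + m2)"
    and "T \<equiv> \<integral>x. indicator (- cball 0 R) x * (1 + (norm x)\<^sup>2) \<partial>\<mu>"
  shows "A2 \<le> (1 / (\<kappa> * V) + 4) * gap t + 4 * C * (2 + 2 * real DIM('a)) * T"
proof -
  have t0: "t > 0" using t by simp
  let ?n = "real DIM('a)"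
  let ?O = "indicat_real (- cball 0 R) :: 'a \<Rightarrow> real"
  let ?I = "indicat_real (cball 0 R) :: 'a \<Rightarrow> real"
  have IO: "?I x + ?O x = 1" for x by (simp add: indicator_def)
  have O: "0 \<le> ?O x" "?O x \<le> 1" for x by (auto simp: indicator_def)
  have C0: "C \<ge> 0" unfolding C_def using m2_nonneg by simp
  have wC: "(norm (w t y))\<^sup>2 \<le> C * (1 + (norm y)\<^sup>2)" for y
  proof -
    have "(v + t) / t \<le> 1 + v" using t v by (simp add: field_simps)
    then have "((v + t) / t)\<^sup>2 \<le> (1 + v)\<^sup>2" using v t by (intro power_mono) auto
    then have "4 * ((v + t) / t)\<^sup>2 * ((norm y)\<^sup>2 + m2) \<le> 4 * (1 + v)\<^sup>2 * ((1 + m2) * (1 + (norm y)\<^sup>2))"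
      using m2_nonneg by (intro mult_mono) (auto simp: algebra_simps)
    then have "(norm (w t y))\<^sup>2 \<le> 2 * (norm y)\<^sup>2 + 4 * (1 + v)\<^sup>2 * ((1 + m2) * (1 + (norm y)\<^sup>2))"
      using w_bound[OF t0, of y] by linarith
    also have "\<dots> \<le> C * (1 + (norm y)\<^sup>2)" unfolding C_def by (simp add: algebra_simps)
    finally show ?thesis .
  qed
  have iT: "integrable \<mu> (\<lambda>x. ?O x * (1 + (norm x)\<^sup>2))"
    by (rule Bochner_Integration.integrable_bound[where f = "\<lambda>x. 1 + (norm x)\<^sup>2"])
      (use moment2 in \<open>auto simp: indicator_def\<close>)
  have iO: "integrable \<mu> ?O" by (rule integrable_bounded[of _ 1]) (auto simp: indicator_def)
  have OT: "(\<integral>x. ?O x \<partial>\<mu>) \<le> T" unfolding T_def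
    by (intro integral_mono iO iT) (auto simp: indicator_def)
  have T0: "T \<ge> 0" unfolding T_def by (intro integral_nonneg_AE AE_I2) (auto simp: indicator_def)
  have iOa: "integrable \<mu> (\<lambda>x. ?O x * (norm (a x))\<^sup>2)"
    by (rule Bochner_Integration.integrable_bound[OF a2]) (auto simp: indicator_def)
  \<comment> \<open>For fixed \<open>x\<close> the bound
    \<open>|a|^2 \<le> 2 |a - w|^2 + 2 |w|^2\<close> is averaged over the noise: the first part is
    charged to the gap, the second to the growth of \<open>w\<close>. The factor
    \<open>1 + 2 * ?n\<close> comes from \<open>1 + |x|^2 + ?n * t\<close> with
    \<open>t \<le> 2\<close>.\<close>
  have tail: "(\<integral>x. ?O x * (norm (a x))\<^sup>2 \<partial>\<mu>) \<le> 2 * gap t + 2 * C * (1 + 2 * ?n) * T"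
  proof -
    have iG: "integrable \<mu> (\<lambda>x. \<integral>y. gk t (y - x) * (norm (a x - w t y))\<^sup>2 \<partial>lborel)"
      by (rule integral_h_times(2)[OF joint_gap[OF t0]])
    have "(\<integral>x. ?O x * (norm (a x))\<^sup>2 \<partial>\<mu>) \<le> (\<integral>x. 2 * (LBINT y. gk t (y - x) * (norm (a x - w t y))\<^sup>2)
        + 2 * C * (1 + 2 * ?n) * (?O x * (1 + (norm x)\<^sup>2)) \<partial>\<mu>)"
    proof (rule integral_mono_AE)
      show "integrable \<mu> (\<lambda>x. 2 * (LBINT y. gk t (y - x) * (norm (a x - w t y))\<^sup>2)
        + 2 * C * (1 + 2 * ?n) * (?O x * (1 + (norm x)\<^sup>2)))"
        by (intro Bochner_Integration.integrable_add integrable_mult_right iG iT)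
      show "AE x in \<mu>. ?O x * (norm (a x))\<^sup>2 \<le> 2 * (LBINT y. gk t (y - x) * (norm (a x - w t y))\<^sup>2)
        + 2 * C * (1 + 2 * ?n) * (?O x * (1 + (norm x)\<^sup>2))"
        using ml.AE_integrable_fst[OF joint_gap[OF t0]]
      proof eventually_elim
        case (elim x)
        have G0: "0 \<le> (LBINT y. gk t (y - x) * (norm (a x - w t y))\<^sup>2)" by simp
        show ?case
        proof (cases "x \<in> cball 0 R")
          case True
          then show ?thesis using G0 by (simp add: indicator_def)
        next
          case False
          have B: "has_bochner_integral lborel (\<lambda>y. 2 * (gk t (y - x) * (norm (a x - w t y))\<^sup>2)
              + 2 * C * (gk t (y - x) + gk t (y - x) * (norm y)\<^sup>2))
              (2 * (LBINT y. gk t (y - x) * (norm (a x - w t y))\<^sup>2) + 2 * C * (1 + ((norm x)\<^sup>2 + ?n * t)))"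
            by (intro has_bochner_integral_add has_bochner_integral_mult_right integral_gk_shift t0
                has_bochner_integral_integrable elim)
          have A: "has_bochner_integral lborel (\<lambda>y. gk t (y - x) * (norm (a x))\<^sup>2) (1 * (norm (a x))\<^sup>2)"
            by (intro has_bochner_integral_mult_left integral_gk_shift t0)
          have pw: "gk t (y - x) * (norm (a x))\<^sup>2 \<le> 2 * (gk t (y - x) * (norm (a x - w t y))\<^sup>2)
              + 2 * C * (gk t (y - x) + gk t (y - x) * (norm y)\<^sup>2)" for y
          proof -
            have "(norm (a x))\<^sup>2 \<le> 2 * (norm (a x - w t y))\<^sup>2 + 2 * (norm (w t y))\<^sup>2"
              using norm_diff_power2_le[of "a x - w t y" "- w t y"] by simp
            also have "\<dots> \<le> 2 * (norm (a x - w t y))\<^sup>2 + 2 * (C * (1 + (norm y)\<^sup>2))" using wC[of y] by simp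
            finally show ?thesis
              using mult_left_mono[OF _ gk_nonneg[of t "y - x"]] by (fastforce simp: algebra_simps)
          qed
          have "(norm (a x))\<^sup>2 \<le> 2 * (LBINT y. gk t (y - x) * (norm (a x - w t y))\<^sup>2) + 2 * C * (1 + ((norm x)\<^sup>2 + ?n * t))"
            using integral_mono[OF has_bochner_integral_iff[THEN iffD1, OF A, THEN conjunct1]
                has_bochner_integral_iff[THEN iffD1, OF B, THEN conjunct1] pw]
            unfolding has_bochner_integral_integral_eq[OF A] has_bochner_integral_integral_eq[OF B] by simp
          moreover have "1 + ((norm x)\<^sup>2 + ?n * t) \<le> (1 + 2 * ?n) * (1 + (norm x)\<^sup>2)"
          proof -
            have "?n * t \<le> ?n * 2" using t by (intro mult_left_mono) auto
            moreover have "0 \<le> 2 * ?n * (norm x)\<^sup>2" by simp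
            ultimately show ?thesis unfolding distrib_left distrib_right by linarith
          qed
          then have "2 * C * (1 + ((norm x)\<^sup>2 + ?n * t)) \<le> 2 * C * ((1 + 2 * ?n) * (1 + (norm x)\<^sup>2))"
            using C0 by (intro mult_left_mono) auto
          ultimately show ?thesis using False by (simp add: indicator_def mult.assoc)
        qed
      qed
    qed (rule iOa)
    also have "\<dots> = 2 * gap t + 2 * C * (1 + 2 * ?n) * T"
      unfolding T_def gap_def integral_h_times(3)[OF joint_gap[OF t0]] using iG iT by simp
    finally show ?thesis .
  qed
  have \<kappa>: "\<kappa> > 0" unfolding \<kappa>_def by simp
  \<comment> \<open>The overlap of the laws: \<open>|y - x| \<le> R + 1\<close> and
    \<open>t \<ge> 1\<close> give the exponent of \<open>\<kappa>\<close>, and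
    \<open>t \<le> 2\<close> its prefactor.\<close>
  have gk_ge: "\<kappa> \<le> gk t (y - x)" if "norm x \<le> R" "norm y \<le> 1" for x y :: 'a
  proof -
    have n: "norm (y - x) \<le> R + 1" using norm_triangle_ineq4[of y x] that by linarith
    have "(norm (y - x))\<^sup>2 / (2 * t) \<le> (R + 1)\<^sup>2 / 2"
    proof -
      have "(norm (y - x))\<^sup>2 / (2 * t) \<le> (norm (y - x))\<^sup>2 / 2" using t by (intro divide_left_mono) auto
      also have "\<dots> \<le> (R + 1)\<^sup>2 / 2" using n by (intro divide_right_mono power_mono) auto
      finally show ?thesis .
    qed
    moreover have "(4 * pi) powr (- (?n / 2)) \<le> (2 * pi * t) powr (- (?n / 2))"
      using t by (intro powr_mono2') auto
    ultimately show ?thesis unfolding \<kappa>_def gk_def by (intro mult_mono) auto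
  qed
  have each: "A2 \<le> (1 / \<kappa>) * (\<integral>x. gk t (y - x) * (norm (a x - w t y))\<^sup>2 \<partial>\<mu>)
      + (4 * gap t + 4 * C * (2 + 2 * ?n) * T)" if y: "norm y \<le> 1" for y
  proof -
    have iaw: "integrable \<mu> (\<lambda>x. (norm (a x - w t y))\<^sup>2)"
    proof (rule Bochner_Integration.integrable_bound[where f = "\<lambda>x. 2 * (norm (a x))\<^sup>2 + 2 * (norm (w t y))\<^sup>2"])
      show "integrable \<mu> (\<lambda>x. 2 * (norm (a x))\<^sup>2 + 2 * (norm (w t y))\<^sup>2)" using a2 by simp
    qed (use norm_diff_power2_le in auto)
    have igk: "integrable \<mu> (\<lambda>x. gk t (y - x) * (norm (a x - w t y))\<^sup>2)"
      by (rule Bochner_Integration.integrable_bound[OF integrable_mult_right[OF iaw, of "(2 * pi * t) powr (- (?n / 2))"]])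
        (auto simp: abs_mult intro!: mult_right_mono gk_le t0)
    \<comment> \<open>As \<open>a\<close> has mean 0, its second moment is at most its mean squared
      distance from any fixed vector; \<open>w t y\<close> is the vector with which the gap compares
      it.\<close>
    have "A2 \<le> A2 + (norm (w t y))\<^sup>2" by simp
    also have "\<dots> = (\<integral>x. (norm (a x))\<^sup>2 - 2 * (a x \<bullet> w t y) + (norm (w t y))\<^sup>2 \<partial>\<mu>)"
      using a2 integrable_a mean unfolding A2_def by simp
    also have "\<dots> = (\<integral>x. (norm (a x - w t y))\<^sup>2 \<partial>\<mu>)"
      unfolding power2_norm_eq_inner by (simp add: inner_diff_left inner_diff_right inner_commute algebra_simps)
    also have "\<dots> \<le> (\<integral>x. (1 / \<kappa>) * (gk t (y - x) * (norm (a x - w t y))\<^sup>2)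
        + (2 * (?O x * (norm (a x))\<^sup>2) + 2 * (norm (w t y))\<^sup>2 * ?O x) \<partial>\<mu>)"
    proof (rule integral_mono)
      show "integrable \<mu> (\<lambda>x. (1 / \<kappa>) * (gk t (y - x) * (norm (a x - w t y))\<^sup>2)
        + (2 * (?O x * (norm (a x))\<^sup>2) + 2 * (norm (w t y))\<^sup>2 * ?O x))"
        by (intro Bochner_Integration.integrable_add integrable_mult_right igk iOa iO)
      fix x
      have nn: "0 \<le> (1 / \<kappa>) * (gk t (y - x) * (norm (a x - w t y))\<^sup>2)" using \<kappa> by simp
      show "(norm (a x - w t y))\<^sup>2 \<le> (1 / \<kappa>) * (gk t (y - x) * (norm (a x - w t y))\<^sup>2)
        + (2 * (?O x * (norm (a x))\<^sup>2) + 2 * (norm (w t y))\<^sup>2 * ?O x)"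
      proof (cases "x \<in> cball 0 R")
        case True
        then have "\<kappa> \<le> gk t (y - x)" using y by (intro gk_ge) auto
        then have "\<kappa> * (norm (a x - w t y))\<^sup>2 \<le> gk t (y - x) * (norm (a x - w t y))\<^sup>2"
          by (intro mult_right_mono) auto
        then show ?thesis using True \<kappa> by (simp add: field_simps indicator_def)
      next
        case False
        then show ?thesis using norm_diff_power2_le[of "a x" "w t y"] nn by (simp add: indicator_def)
      qed
    qed (rule iaw)
    also have "\<dots> = (1 / \<kappa>) * (\<integral>x. gk t (y - x) * (norm (a x - w t y))\<^sup>2 \<partial>\<mu>)
        + (2 * (\<integral>x. ?O x * (norm (a x))\<^sup>2 \<partial>\<mu>) + 2 * (norm (w t y))\<^sup>2 * (\<integral>x. ?O x \<partial>\<mu>))"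
      using igk iOa iO by simp
    also have "\<dots> \<le> (1 / \<kappa>) * (\<integral>x. gk t (y - x) * (norm (a x - w t y))\<^sup>2 \<partial>\<mu>)
        + (2 * (2 * gap t + 2 * C * (1 + 2 * ?n) * T) + 2 * (2 * C) * T)"
    proof -
      have "(norm (w t y))\<^sup>2 \<le> 2 * C"
      proof -
        have "C * (1 + (norm y)\<^sup>2) \<le> C * 2"
          using y C0 by (intro mult_left_mono) (auto simp: power_le_one)
        then show ?thesis using wC[of y] by simp
      qed
      then have "2 * (norm (w t y))\<^sup>2 * (\<integral>x. ?O x \<partial>\<mu>) \<le> 2 * (2 * C) * T"
        using OT C0 by (intro mult_mono) (auto intro!: integral_nonneg_AE)
      then show ?thesis by (intro add_left_mono add_mono mult_left_mono tail) simp_all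
    qed
    also have "\<dots> = (1 / \<kappa>) * (\<integral>x. gk t (y - x) * (norm (a x - w t y))\<^sup>2 \<partial>\<mu>)
      + (4 * gap t + 4 * C * (2 + 2 * ?n) * T)"
      by (simp add: algebra_simps)
    finally show ?thesis .
  qed
  have V: "V > 0" unfolding V_def by (rule content_cball_pos) simp
  let ?B = "indicat_real (cball (0::'a) 1)"
  let ?D = "4 * gap t + 4 * C * (2 + 2 * ?n) * T"
  have iB: "integrable lborel ?B" by (intro integrable_real_indicator emeasure_bounded_finite) auto
  have iP: "integrable lborel (\<lambda>y. \<integral>x. gk t (y - x) * (norm (a x - w t y))\<^sup>2 \<partial>\<mu>)"
    by (rule integral_h_times(1)[OF joint_gap[OF t0]])
  \<comment> \<open>The bound \<open>each\<close> holds for all \<open>y\<close> in the unit ball;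
    averaging over the ball turns its first term into the gap, at the price of the factor
    \<open>1 / V\<close>.\<close>
  have "V * A2 = (LBINT y. ?B y * A2)" unfolding V_def by simp
  also have "\<dots> \<le> (LBINT y. (1 / \<kappa>) * (\<integral>x. gk t (y - x) * (norm (a x - w t y))\<^sup>2 \<partial>\<mu>) + ?B y * ?D)"
  proof (rule integral_mono)
    fix y
    have "0 \<le> (1 / \<kappa>) * (\<integral>x. gk t (y - x) * (norm (a x - w t y))\<^sup>2 \<partial>\<mu>)" using \<kappa> by simp
    then show "?B y * A2 \<le> (1 / \<kappa>) * (\<integral>x. gk t (y - x) * (norm (a x - w t y))\<^sup>2 \<partial>\<mu>) + ?B y * ?D"
      using each[of y] by (auto simp: indicator_def)
  qed (use iB iP in auto)
  also have "\<dots> = (1 / \<kappa>) * gap t + V * ?D" using iB iP unfolding gap_def V_def by simp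
  finally have "A2 \<le> ((1 / \<kappa>) * gap t + V * ?D) / V" using V by (simp add: field_simps)
  also have "\<dots> = (1 / (\<kappa> * V) + 4) * gap t + 4 * C * (2 + 2 * ?n) * T"
    using V by (simp add: add_divide_distrib distrib_right)
  finally show ?thesis .
qed

end

section \<open>Weak gradients\<close>

lemma has_real_derivative_max_power2:
  "((\<lambda>s::real. (max 0 s)\<^sup>2) has_real_derivative 2 * max 0 s) (at s)"
proof -
  consider "s > 0" | "s < 0" | "s = 0" by linarith
  then show ?thesis
  proof cases
    case 1
    have "((\<lambda>s::real. s\<^sup>2) has_real_derivative 2 * s) (at s)"
      by (auto intro!: derivative_eq_intros)
    then show ?thesis
      by (rule has_field_derivative_transform_within_open[where S = "{0<..}", THEN DERIV_cong])
        (use 1 in \<open>auto simp: max_def\<close>)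
  next
    case 2
    have "((\<lambda>s::real. 0) has_real_derivative 0) (at s)" by simp
    then show ?thesis
      by (rule has_field_derivative_transform_within_open[where S = "{..<0}", THEN DERIV_cong])
        (use 2 in \<open>auto simp: max_def\<close>)
  next
    case 3
    have "((\<lambda>h::real. (max 0 h)\<^sup>2 / h) \<longlongrightarrow> 0) (at 0)"
    proof (rule Lim_null_comparison)
      show "eventually (\<lambda>h::real. norm ((max 0 h)\<^sup>2 / h) \<le> \<bar>h\<bar>) (at 0)"
        by (intro always_eventually allI) (auto simp: max_def power2_eq_square)
      show "((\<lambda>h::real. \<bar>h\<bar>) \<longlongrightarrow> 0) (at 0)" by (auto intro!: tendsto_eq_intros)
    qed
    then show ?thesis unfolding has_field_derivative_iff 3 by simp
  qed
qed

text \<open>A squared positive part is of class C^1, as required of test functions here, and its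
  gradient is explicit. The bump serves as a mollifier for small \<open>r\<close> and as a cutoff
  for large \<open>r\<close>.\<close>

definition bump :: "real \<Rightarrow> 'a::real_inner \<Rightarrow> real" where
  "bump r z = (max 0 (1 - (norm z)\<^sup>2 / r\<^sup>2))\<^sup>2"

definition bump_grad :: "real \<Rightarrow> 'a::real_inner \<Rightarrow> 'a" where
  "bump_grad r z = (- (4 / r\<^sup>2) * max 0 (1 - (norm z)\<^sup>2 / r\<^sup>2)) *\<^sub>R z"

lemma bump_bounds: "0 \<le> bump r z" "bump r z \<le> 1"
  unfolding bump_def by (auto simp: power_le_one)

lemma bump_eq_0: "r > 0 \<Longrightarrow> norm z \<ge> r \<Longrightarrow> bump r z = 0"
  unfolding bump_def using power_mono[of r "norm z" 2] by (simp add: max_def field_simps)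

lemma bump_minus_commute: "bump r (x - y) = bump r (y - x)"
  by (simp add: bump_def norm_minus_commute)

lemma norm_bump_grad_le: "r > 0 \<Longrightarrow> norm (bump_grad r z) \<le> 4 / r"
proof (cases "norm z \<le> r")
  case True
  assume r: "r > 0"
  have "norm (bump_grad r z) = (4 / r\<^sup>2) * (max 0 (1 - (norm z)\<^sup>2 / r\<^sup>2) * norm z)"
    by (simp add: bump_grad_def abs_mult)
  also have "\<dots> \<le> (4 / r\<^sup>2) * (1 * r)" using True r by (intro mult_left_mono mult_mono) auto
  finally show ?thesis using r by (simp add: power2_eq_square)
next
  case False
  assume r: "r > 0"
  have "r\<^sup>2 \<le> (norm z)\<^sup>2" using False r by (intro power_mono) auto
  then show ?thesis using r by (simp add: bump_grad_def max_def field_simps)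
qed

lemma has_derivative_bump:
  "(bump r has_derivative (\<lambda>h. bump_grad r z \<bullet> h)) (at z)"
proof -
  have 1: "((\<lambda>z. 1 - (norm z)\<^sup>2 / r\<^sup>2) has_derivative (\<lambda>h. - (2 * (z \<bullet> h)) / r\<^sup>2)) (at z)"
    unfolding power2_norm_eq_inner
    by (auto intro!: derivative_eq_intros simp: inner_commute divide_inverse)
  show ?thesis
    unfolding bump_def[abs_def]
    by (rule has_derivative_eq_rhs[OF has_derivative_compose[OF 1 has_real_derivative_max_power2[unfolded has_field_derivative_def]]])
      (auto simp: bump_grad_def)
qed

lemma continuous_on_bump [continuous_intros]:
  "continuous_on S f \<Longrightarrow> continuous_on S (\<lambda>x. bump r (f x))"
  "continuous_on S f \<Longrightarrow> continuous_on S (\<lambda>x. bump_grad r (f x))"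
  unfolding bump_def bump_grad_def by (auto intro!: continuous_intros simp: divide_inverse)

lemma test_functionD:
  assumes "test_function \<phi> \<phi>'"
  obtains r where "r > 0" "\<And>x. norm x > r \<Longrightarrow> \<phi> x = 0" "\<And>x. norm x > r \<Longrightarrow> \<phi>' x = 0"
proof -
  let ?K = "closure {x. \<phi> x \<noteq> 0}"
  have d: "(\<phi> has_derivative (\<lambda>h. \<phi>' x \<bullet> h)) (at x)" for x using assms by (simp add: test_function_def)
  have "bounded ?K" using assms unfolding test_function_def by (intro compact_imp_bounded) auto
  then obtain r where r: "r > 0" "?K \<subseteq> cball 0 r"
    using bounded_subset_ballD[of ?K 0] ball_subset_cball by blast
  have 0: "\<phi> x = 0" if "norm x > r" for x
  proof (rule ccontr)
    assume "\<phi> x \<noteq> 0"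
    then have "x \<in> ?K" using closure_subset[of "{x. \<phi> x \<noteq> 0}"] by auto
    then show False using r(2) that by auto
  qed
  have "\<phi>' x = 0" if x: "norm x > r" for x
  proof -
    have "((\<lambda>_. 0::real) has_derivative (\<lambda>h. \<phi>' x \<bullet> h)) (at x)"
    proof (rule has_derivative_transform_within_open[OF d[of x]])
      show "open (- cball 0 r)" by (rule open_Compl) (rule closed_cball)
      show "x \<in> - cball 0 r" using x by simp
    qed (use 0 in auto)
    then have "(\<lambda>h. \<phi>' x \<bullet> h) = (\<lambda>h. 0)"
      by (rule has_derivative_unique) (rule has_derivative_const)
    then have "\<phi>' x \<bullet> \<phi>' x = 0" by (rule fun_cong)
    then show ?thesis by simp
  qed
  then show ?thesis using that[of r] r(1) 0 by blast
qed

lemma test_functionI: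
  assumes "\<And>x. (\<phi> has_derivative (\<lambda>h. \<phi>' x \<bullet> h)) (at x)" "continuous_on UNIV \<phi>'"
    and 0: "\<And>x. norm x > r \<Longrightarrow> \<phi> x = 0"
  shows "test_function \<phi> \<phi>'"
proof -
  have "{x. \<phi> x \<noteq> 0} \<subseteq> cball 0 r" using 0 by (force simp: not_le[symmetric])
  then have "bounded {x. \<phi> x \<noteq> 0}" by (rule bounded_subset[OF bounded_cball])
  then show ?thesis using assms by (simp add: test_function_def compact_closure)
qed

lemma test_function_bounded:
  assumes "test_function \<phi> \<phi>'"
  obtains c where "c > 0" "\<And>x. \<bar>\<phi> x\<bar> \<le> c" "\<And>x. norm (\<phi>' x) \<le> c"
proof -
  obtain r where r: "r > 0" "\<And>x. norm x > r \<Longrightarrow> \<phi> x = 0" "\<And>x. norm x > r \<Longrightarrow> \<phi>' x = 0"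
    using test_functionD[OF assms] by metis
  have c: "continuous_on UNIV \<phi>" "continuous_on UNIV \<phi>'"
    using assms by (auto simp: test_function_def intro!: continuous_at_imp_continuous_on has_derivative_continuous)
  have "bounded (\<phi> ` cball 0 r)" "bounded (\<phi>' ` cball 0 r)"
    by (intro compact_imp_bounded compact_continuous_image continuous_on_subset[OF c(1)] continuous_on_subset[OF c(2)]; simp)+
  then obtain c1 c2 where c1: "\<And>x. x \<in> cball 0 r \<Longrightarrow> norm (\<phi> x) \<le> c1" and c2: "\<And>x. x \<in> cball 0 r \<Longrightarrow> norm (\<phi>' x) \<le> c2"
    unfolding bounded_iff by blast
  have "c1 \<ge> 0" "c2 \<ge> 0" using c1[of 0] c2[of 0] r(1) by (auto intro: order_trans[OF norm_ge_zero] order_trans[OF abs_ge_zero])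
  then show ?thesis
  proof (intro that[of "1 + c1 + c2"])
    show "\<bar>\<phi> x\<bar> \<le> 1 + c1 + c2" if "c1 \<ge> 0" "c2 \<ge> 0" for x
      using c1[of x] r(2)[of x] that by (cases "norm x \<le> r") auto
    show "norm (\<phi>' x) \<le> 1 + c1 + c2" if "c1 \<ge> 0" "c2 \<ge> 0" for x
      using c2[of x] r(3)[of x] that by (cases "norm x \<le> r") auto
  qed auto
qed

lemma test_function_measurable:
  assumes "test_function \<phi> \<phi>'"
  shows "\<phi> \<in> borel_measurable borel" "\<phi>' \<in> borel_measurable borel"
proof -
  have "continuous_on UNIV \<phi>" "continuous_on UNIV \<phi>'"
    using assms by (auto simp: test_function_def intro!: continuous_at_imp_continuous_on has_derivative_continuous)
  then show "\<phi> \<in> borel_measurable borel" "\<phi>' \<in> borel_measurable borel"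
    by (auto intro: borel_measurable_continuous_onI)
qed

lemma test_function_bump:
  assumes r: "r > 0"
  shows "test_function (\<lambda>y. bump r (y - x)) (\<lambda>y. bump_grad r (y - x))"
proof (rule test_functionI)
  show "((\<lambda>y. bump r (y - x)) has_derivative (\<lambda>h. bump_grad r (y - x) \<bullet> h)) (at y)" for y
    by (rule has_derivative_compose[OF _ has_derivative_bump, of "\<lambda>y. y - x" "\<lambda>h. h", simplified])
      (auto intro!: derivative_eq_intros)
  show "continuous_on UNIV (\<lambda>y. bump_grad r (y - x))" by (intro continuous_intros)
  show "bump r (y - x) = 0" if "norm x + r < norm y" for y
    using norm_triangle_ineq2[of y x] that by (intro bump_eq_0 r) linarith
qed

lemma test_function_mult_bump:
  assumes \<psi>: "\<And>x. (\<psi> has_derivative (\<lambda>h. \<psi>' x \<bullet> h)) (at x)" "continuous_on UNIV \<psi>'" and r: "r > 0"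
  shows "test_function (\<lambda>x. \<psi> x * bump r (x - y)) (\<lambda>x. bump r (x - y) *\<^sub>R \<psi>' x + \<psi> x *\<^sub>R bump_grad r (x - y))"
proof (rule test_functionI)
  have c: "continuous_on UNIV \<psi>"
    using \<psi>(1) by (auto intro!: continuous_at_imp_continuous_on has_derivative_continuous)
  have d: "((\<lambda>x. bump r (x - y)) has_derivative (\<lambda>h. bump_grad r (x - y) \<bullet> h)) (at x)" for x
    using test_function_bump[OF r, of y] by (simp add: test_function_def)
  show "((\<lambda>x. \<psi> x * bump r (x - y)) has_derivative
      (\<lambda>h. (bump r (x - y) *\<^sub>R \<psi>' x + \<psi> x *\<^sub>R bump_grad r (x - y)) \<bullet> h)) (at x)" for x
    by (rule has_derivative_eq_rhs[OF has_derivative_mult[OF \<psi>(1) d]]) (auto simp: inner_add_left)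
  show "continuous_on UNIV (\<lambda>x. bump r (x - y) *\<^sub>R \<psi>' x + \<psi> x *\<^sub>R bump_grad r (x - y))"
    by (intro continuous_intros \<psi>(2) c)
  show "\<psi> x * bump r (x - y) = 0" if "norm y + r < norm x" for x
    using norm_triangle_ineq2[of x y] that by (simp add: bump_eq_0[OF r])
qed

lemma abs_mult_le_power2: "\<bar>x * y\<bar> \<le> (x\<^sup>2 + y\<^sup>2) / 2" for x y :: real
proof -
  have "2 * (\<bar>x\<bar> * \<bar>y\<bar>) \<le> \<bar>x\<bar>\<^sup>2 + \<bar>y\<bar>\<^sup>2"
    using sum_squares_bound[of "\<bar>x\<bar>" "\<bar>y\<bar>"] by simp
  then show ?thesis by (simp add: abs_mult)
qed

lemma integrable_mult_L2:
  fixes F G :: "'a::euclidean_space \<Rightarrow> real"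
  assumes [measurable]: "F \<in> borel_measurable borel" "G \<in> borel_measurable borel"
    and F: "integrable lborel (\<lambda>x. (F x)\<^sup>2)" and G: "integrable lborel (\<lambda>x. (G x)\<^sup>2)"
  shows "integrable lborel (\<lambda>x. F x * G x)"
proof (rule Bochner_Integration.integrable_bound)
  show "integrable lborel (\<lambda>x. ((F x)\<^sup>2 + (G x)\<^sup>2) / 2)" using F G by simp
  show "AE x in lborel. norm (F x * G x) \<le> norm (((F x)\<^sup>2 + (G x)\<^sup>2) / 2)"
    using abs_mult_le_power2 by (intro AE_I2) simp
qed measurable

lemma L2_pairing_translation:
  fixes F G :: "'a::euclidean_space \<Rightarrow> real"
  assumes [measurable]: "F \<in> borel_measurable borel" "G \<in> borel_measurable borel"
    and F: "integrable lborel (\<lambda>x. (F x)\<^sup>2)" and G: "integrable lborel (\<lambda>x. (G x)\<^sup>2)" and e: "e > 0"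
  obtains d where "d > 0"
    "\<And>z. norm z < d \<Longrightarrow> \<bar>(LBINT x. F x * G (x + z)) - (LBINT x. F x * G x)\<bar> < e"
proof -
  let ?A = "\<integral>x. (F x)\<^sup>2 \<partial>lborel"
  have A: "?A \<ge> 0" by simp
  \<comment> \<open>The weight in \<open>|F E| \<le> (k / 2) F^2 + E^2 / (2 k)\<close>, with
    \<open>E\<close> the translation error of \<open>G\<close>: the first part contributes less than
    \<open>e / 2\<close>, and so does the second once the integral of \<open>E^2\<close> is below
    \<open>k * e\<close>.\<close>
  define k where "k = e / (?A + 1)"
  have k: "k > 0" using A e by (simp add: k_def add_nonneg_pos)
  have ke: "k * e > 0" using k e by simp
  obtain d where d: "d > 0" "\<And>z. norm z < d \<Longrightarrow> integrable lborel (\<lambda>y. (G (y - z) - G y)\<^sup>2)"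
    "\<And>z. norm z < d \<Longrightarrow> (LBINT y. (G (y - z) - G y)\<^sup>2) < k * e"
    by (rule L2_translation_small[OF G assms(2) ke]) (rule that; blast)
  show ?thesis
  proof (rule that[OF d(1)])
    fix z :: 'a assume "norm z < d"
    then have z: "norm (- z) < d" by simp
    have i1: "integrable lborel (\<lambda>x. (G (x + z) - G x)\<^sup>2)" using d(2)[OF z] by simp
    have i2: "integrable lborel (\<lambda>x. F x * (G (x + z) - G x))"
      by (rule integrable_mult_L2[OF _ _ F i1]) measurable
    have i3: "integrable lborel (\<lambda>x. F x * G x)" by (rule integrable_mult_L2[OF _ _ F G]) measurable
    have "integrable lborel (\<lambda>x. F x * (G (x + z) - G x) + F x * G x)" by (intro Bochner_Integration.integrable_add i2 i3)
    then have i4: "integrable lborel (\<lambda>x. F x * G (x + z))" by (simp add: algebra_simps)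
    have pw: "\<bar>F x * (G (x + z) - G x)\<bar> \<le> (k / 2) * (F x)\<^sup>2 + (1 / (2 * k)) * (G (x + z) - G x)\<^sup>2" for x
    proof -
      have "\<bar>(sqrt k * F x) * ((1 / sqrt k) * (G (x + z) - G x))\<bar>
          \<le> ((sqrt k * F x)\<^sup>2 + ((1 / sqrt k) * (G (x + z) - G x))\<^sup>2) / 2"
        by (rule abs_mult_le_power2)
      moreover have "(sqrt k * A) * ((1 / sqrt k) * D) = A * D" "(sqrt k * A)\<^sup>2 = k * A\<^sup>2"
          "((1 / sqrt k) * D)\<^sup>2 = (1 / k) * D\<^sup>2" for A D
        using k by (simp_all add: power_mult_distrib power_divide)
      ultimately have "\<bar>F x * (G (x + z) - G x)\<bar> \<le> (k * (F x)\<^sup>2 + (1 / k) * (G (x + z) - G x)\<^sup>2) / 2"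
        by (simp only:)
      then show ?thesis by (simp add: add_divide_distrib)
    qed
    have "\<bar>(LBINT x. F x * G (x + z)) - (LBINT x. F x * G x)\<bar> = \<bar>\<integral>x. F x * (G (x + z) - G x) \<partial>lborel\<bar>"
      using i3 i4 by (simp add: right_diff_distrib)
    also have "\<dots> \<le> (LBINT x. \<bar>F x * (G (x + z) - G x)\<bar>)" by (rule integral_abs_bound)
    also have "\<dots> \<le> (LBINT x. (k / 2) * (F x)\<^sup>2 + (1 / (2 * k)) * (G (x + z) - G x)\<^sup>2)"
      using F i1 by (intro integral_mono pw integrable_abs i2 Bochner_Integration.integrable_add integrable_mult_right)
    also have "\<dots> = (k / 2) * ?A + (1 / (2 * k)) * (LBINT x. (G (x + z) - G x)\<^sup>2)" using F i1 by simp
    also have "\<dots> < e"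
    proof -
      have "k * ?A < e"
      proof -
        have "k * ?A < k * (?A + 1)" using k by simp
        also have "\<dots> = e"
        proof -
          have "?A + 1 \<noteq> 0" using A by linarith
          then show ?thesis unfolding k_def by simp
        qed
        finally show ?thesis .
      qed
      moreover have "(1 / (2 * k)) * (LBINT x. (G (x + z) - G x)\<^sup>2) < (1 / (2 * k)) * (k * e)"
        using d(3)[OF z] k by (intro mult_strict_left_mono) auto
      moreover have "(1 / (2 * k)) * (k * e) = e / 2" using k by simp
      ultimately show ?thesis by simp
    qed
    finally show "\<bar>(LBINT x. F x * G (x + z)) - (LBINT x. F x * G x)\<bar> < e" .
  qed
qed

text \<open>Both forms of the double integral, before and after the substitution
  \<open>z = y - x\<close>; the bounded kernel leaves a product of two integrable functions.\<close>

lemma integrable_kernel_product: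
  fixes F G k :: "'a::euclidean_space \<Rightarrow> real"
  assumes [measurable]: "k \<in> borel_measurable borel" and F: "integrable lborel F" and G: "integrable lborel G"
    and k: "\<And>z. \<bar>k z\<bar> \<le> c"
  shows "integrable (lborel \<Otimes>\<^sub>M lborel) (\<lambda>(x, y). k (y - x) * (F x * G y))"
    and "integrable (lborel \<Otimes>\<^sub>M lborel) (\<lambda>(x, z). k z * (F x * G (x + z)))"
proof -
  have [measurable]: "F \<in> borel_measurable borel" "G \<in> borel_measurable borel" using F G by auto
  have bound: "integrable lborel (\<lambda>y. k (y - x) * (F x * G y))"
    "(LBINT y. \<bar>k (y - x) * (F x * G y)\<bar>) \<le> c * (LBINT y. \<bar>G y\<bar>) * \<bar>F x\<bar>" for x
  proof -
    have i: "integrable lborel (\<lambda>y. c * \<bar>F x\<bar> * \<bar>G y\<bar>)" using G by simp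
    have pw: "\<bar>k (y - x) * (F x * G y)\<bar> \<le> c * \<bar>F x\<bar> * \<bar>G y\<bar>" for y
      using mult_right_mono[OF k[of "y - x"], of "\<bar>F x\<bar> * \<bar>G y\<bar>"] by (simp add: abs_mult mult.assoc)
    show 1: "integrable lborel (\<lambda>y. k (y - x) * (F x * G y))"
      by (rule Bochner_Integration.integrable_bound[OF i]) (use pw in \<open>auto intro: order_trans[OF _ abs_ge_self]\<close>)
    have "(LBINT y. \<bar>k (y - x) * (F x * G y)\<bar>) \<le> (LBINT y. c * \<bar>F x\<bar> * \<bar>G y\<bar>)"
      by (intro integral_mono integrable_abs 1 i pw)
    then show "(LBINT y. \<bar>k (y - x) * (F x * G y)\<bar>) \<le> c * (LBINT y. \<bar>G y\<bar>) * \<bar>F x\<bar>"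
      by (simp add: ac_simps)
  qed
  have c0: "c \<ge> 0" using k[of 0] by simp
  have outer: "integrable lborel (\<lambda>x. \<integral>y. \<bar>k (y - x) * (F x * G y)\<bar> \<partial>lborel)"
    by (rule Bochner_Integration.integrable_bound[OF integrable_mult_right[OF integrable_abs[OF F], of "c * (LBINT y. \<bar>G y\<bar>)"]])
      (use bound(2) c0 in \<open>auto intro!: AE_I2 order_trans[OF _ abs_ge_self]\<close>)
  show "integrable (lborel \<Otimes>\<^sub>M lborel) (\<lambda>(x, y). k (y - x) * (F x * G y))"
    by (rule lborel_pair.Fubini_integrable) (use outer bound(1) in auto)
  have tr: "(LBINT z. \<bar>k z * (F x * G (x + z))\<bar>) = (LBINT y. \<bar>k (y - x) * (F x * G y)\<bar>)" for x
    using integral_lborel_translation[of "\<lambda>z. \<bar>k z * (F x * G (x + z))\<bar>" x] by simp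
  have it: "integrable lborel (\<lambda>z. k z * (F x * G (x + z)))" for x
    using integrable_lborel_translation[OF bound(1)[of x], of "- x"] by (simp add: add.commute)
  show "integrable (lborel \<Otimes>\<^sub>M lborel) (\<lambda>(x, z). k z * (F x * G (x + z)))"
    by (rule lborel_pair.Fubini_integrable) (use outer it in \<open>auto simp: tr\<close>)
qed

lemma integral_kernel_product:
  fixes F G k :: "'a::euclidean_space \<Rightarrow> real"
  assumes [measurable]: "k \<in> borel_measurable borel" and F: "integrable lborel F" and G: "integrable lborel G"
    and k: "\<And>z. \<bar>k z\<bar> \<le> c"
  shows "(LBINT x. (LBINT y. k (y - x) * (F x * G y))) = (LBINT y. (LBINT x. k (y - x) * (F x * G y)))"
    and "(LBINT x. (LBINT y. k (y - x) * (F x * G y))) = (LBINT z. k z * (LBINT x. F x * G (x + z)))"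
    and "integrable lborel (\<lambda>z. k z * (LBINT x. F x * G (x + z)))"
    and "integrable lborel (\<lambda>x. \<integral>y. k (y - x) * (F x * G y) \<partial>lborel)"
    and "integrable lborel (\<lambda>y. \<integral>x. k (y - x) * (F x * G y) \<partial>lborel)"
proof -
  have [measurable]: "F \<in> borel_measurable borel" "G \<in> borel_measurable borel" using F G by auto
  note I = integrable_kernel_product[OF assms]
  show "(LBINT x. (LBINT y. k (y - x) * (F x * G y))) = (LBINT y. (LBINT x. k (y - x) * (F x * G y)))"
    using lborel_pair.Fubini_integral[OF I(1)] by simp
  have "(LBINT y. k (y - x) * (F x * G y)) = (LBINT z. k z * (F x * G (x + z)))" for x
    using integral_lborel_translation[of "\<lambda>z. k z * (F x * G (x + z))" x] by simp
  then show "(LBINT x. (LBINT y. k (y - x) * (F x * G y))) = (LBINT z. k z * (LBINT x. F x * G (x + z)))"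
    using lborel_pair.Fubini_integral[OF I(2)] by simp
  show "integrable lborel (\<lambda>z. k z * (LBINT x. F x * G (x + z)))"
    using lborel_pair.integrable_snd[OF I(2)] by simp
  show "integrable lborel (\<lambda>x. \<integral>y. k (y - x) * (F x * G y) \<partial>lborel)"
    using lborel_pair.integrable_fst[OF I(1)] by simp
  show "integrable lborel (\<lambda>y. \<integral>x. k (y - x) * (F x * G y) \<partial>lborel)"
    using lborel_pair.integrable_snd[OF I(1)] by simp
qed

lemma bump_grad_eq_0: "r > 0 \<Longrightarrow> norm z \<ge> r \<Longrightarrow> bump_grad r z = 0"
  unfolding bump_grad_def using power_mono[of r "norm z" 2] by (simp add: max_def field_simps)

lemma bump_grad_minus: "bump_grad r (x - y) = - bump_grad r (y - x)"
  unfolding bump_grad_def norm_minus_commute[of x y] scaleR_minus_right[symmetric] by simp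

lemma bump_measurable [measurable]:
  "bump r \<in> borel_measurable (borel :: 'a::euclidean_space measure)"
  "bump_grad r \<in> borel_measurable (borel :: 'a::euclidean_space measure)"
  by (intro borel_measurable_continuous_onI continuous_intros)+

lemma borel_measurable_vec_nth [measurable (raw)]:
  fixes f :: "'a \<Rightarrow> 'b::real_normed_vector ^ 'n"
  shows "f \<in> borel_measurable M \<Longrightarrow> (\<lambda>x. f x $ i) \<in> borel_measurable M"
  by (rule measurable_compose[of f M borel, OF _ borel_measurable_continuous_onI])
    (auto intro!: continuous_intros)

lemma bump_integral:
  assumes r: "r > 0"
  shows "integrable lborel (bump r :: 'a::euclidean_space \<Rightarrow> real)"
    and "(LBINT z. bump r (z::'a::euclidean_space)) > 0"
proof -
  have fin: "integrable lborel (indicat_real (cball (0::'a) s))" for s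
    by (intro integrable_real_indicator emeasure_bounded_finite) auto
  show i: "integrable lborel (bump r :: 'a \<Rightarrow> real)"
  proof (rule Bochner_Integration.integrable_bound[OF fin[of r]])
    have "norm (bump r z) \<le> norm (indicat_real (cball 0 r) z)" for z :: 'a
      using bump_bounds[of r z] bump_eq_0[OF r, of z] by (auto simp: indicator_def)
    then show "AE z in lborel. norm (bump r (z::'a)) \<le> norm (indicat_real (cball 0 r) z)" by simp
  qed measurable
  have "0 < (9 / 16) * measure lborel (cball (0::'a) (r / 2))"
    using content_cball_pos[of "r / 2" "0::'a"] r by simp
  also have "\<dots> = (LBINT z. (9 / 16) * indicat_real (cball (0::'a) (r / 2)) z)" by simp
  also have "\<dots> \<le> (LBINT z. bump r (z::'a))"
  proof (intro integral_mono i integrable_mult_right fin)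
    fix z :: 'a
    show "(9 / 16) * indicat_real (cball (0::'a) (r / 2)) z \<le> bump r z"
    proof (cases "z \<in> cball 0 (r / 2)")
      case True
      then have "(norm z)\<^sup>2 \<le> (r / 2)\<^sup>2" by (intro power_mono) auto
      then have "(norm z)\<^sup>2 / r\<^sup>2 \<le> 1 / 4" using r by (simp add: field_simps power2_eq_square)
      then have "3 / 4 \<le> max 0 (1 - (norm z)\<^sup>2 / r\<^sup>2)" unfolding le_max_iff_disj by linarith
      then have "(3 / 4)\<^sup>2 \<le> (max 0 (1 - (norm z)\<^sup>2 / r\<^sup>2))\<^sup>2" by (rule power_mono) simp
      moreover have "(3 / 4)\<^sup>2 = (9 / 16 :: real)" by (simp add: power2_eq_square)
      moreover have "indicat_real (cball 0 (r / 2)) z = 1" using True by simp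
      ultimately show ?thesis unfolding bump_def by linarith
    next
      case False
      then show ?thesis using bump_bounds(1)[of r z] by simp
    qed
  qed
  finally show "(LBINT z. bump r (z::'a)) > 0" .
qed

lemma integrable_bounded_mult:
  fixes F k :: "'a \<Rightarrow> real"
  assumes F: "integrable M F" and [measurable]: "k \<in> borel_measurable M" and k: "\<And>x. \<bar>k x\<bar> \<le> c"
  shows "integrable M (\<lambda>x. k x * F x)"
proof (rule Bochner_Integration.integrable_bound[OF integrable_mult_right[OF F, of c]])
  have "\<bar>k x\<bar> * \<bar>F x\<bar> \<le> \<bar>c\<bar> * \<bar>F x\<bar>" for x
    by (intro mult_right_mono order_trans[OF k abs_ge_self]) simp
  then show "AE x in M. norm (k x * F x) \<le> norm (c * F x)" by (simp add: abs_mult)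
  show "(\<lambda>x. k x * F x) \<in> borel_measurable M" using F by measurable
qed

lemma eq_0_if_approximable:
  fixes L :: real
  assumes "\<And>e. e > 0 \<Longrightarrow> \<bar>L\<bar> \<le> e"
  shows "L = 0"
  using field_le_epsilon[of "\<bar>L\<bar>" 0] assms by simp

text \<open>The product rule for \<open>u\<^sup>2\<close>: one factor is evaluated at \<open>x\<close>, the other at \<open>y\<close> with a bump
  function of \<open>y - x\<close> as weight. For fixed \<open>y\<close> or fixed \<open>x\<close> the weights are test functions, and the
  bump is finally concentrated on the diagonal.\<close>

lemma weak_product_rule:
  fixes u g :: "real ^ 'n \<Rightarrow> real"
  assumes um [measurable]: "u \<in> borel_measurable borel" and gm [measurable]: "g \<in> borel_measurable borel"
    and u2: "\<And>s. integrable lborel (\<lambda>x. indicator (cball 0 s) x * (u x)\<^sup>2)"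
    and g2: "\<And>s. integrable lborel (\<lambda>x. indicator (cball 0 s) x * (g x)\<^sup>2)"
    and weak: "\<And>\<phi> \<phi>'. test_function \<phi> \<phi>' \<Longrightarrow>
      (LBINT x. \<phi>' x $ i * u x) = - (LBINT x. \<phi> x * g x)"
    and \<phi>: "test_function \<phi> \<phi>'"
  shows "(LBINT x. \<phi>' x $ i * (u x)\<^sup>2) = - (LBINT x. \<phi> x * (2 * u x * g x))"
proof -
  obtain r where r: "r > 0" "\<And>x. norm x > r \<Longrightarrow> \<phi> x = 0" "\<And>x. norm x > r \<Longrightarrow> \<phi>' x = 0"
    using test_functionD[OF \<phi>] by metis
  obtain c where c: "c > 0" "\<And>x. \<bar>\<phi> x\<bar> \<le> c" "\<And>x. norm (\<phi>' x) \<le> c"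
    using test_function_bounded[OF \<phi>] by metis
  have c': "\<bar>\<phi>' x $ i\<bar> \<le> c" for x using order_trans[OF component_le_norm_cart c(3)] .
  have \<phi>d: "\<And>x. (\<phi> has_derivative (\<lambda>h. \<phi>' x \<bullet> h)) (at x)" "continuous_on UNIV \<phi>'"
    using \<phi> by (auto simp: test_function_def)
  note [measurable] = test_function_measurable[OF \<phi>]
  \<comment> \<open>The radius \<open>r + 1\<close> leaves room for a bump of radius at most 1
    around any point where \<open>\<phi>\<close> lives, so \<open>u\<close> and \<open>g\<close> may
    be replaced by \<open>U\<close> and \<open>G\<close>, which are globally square
    integrable.\<close>
  let ?B = "indicat_real (cball (0::real^'n) (r + 1))"
  have [measurable]: "cball (0::real^'n) (r + 1) \<in> sets borel" by simp
  have iB: "integrable lborel ?B" by (intro integrable_real_indicator emeasure_bounded_finite) auto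
  have B2: "(?B x)\<^sup>2 = ?B x" for x by (simp add: indicator_def)
  define U where "U x = ?B x * u x" for x
  define G where "G x = ?B x * g x" for x
  define P where "P x = \<phi>' x $ i * U x" for x
  define Q where "Q x = \<phi> x * U x" for x
  define S where "S x = \<phi> x * G x" for x
  have [measurable]: "U \<in> borel_measurable borel" "G \<in> borel_measurable borel"
    "P \<in> borel_measurable borel" "Q \<in> borel_measurable borel" "S \<in> borel_measurable borel"
    unfolding U_def[abs_def] G_def[abs_def] P_def[abs_def] Q_def[abs_def] S_def[abs_def] by measurable
  have UG2: "integrable lborel (\<lambda>x. (U x)\<^sup>2)" "integrable lborel (\<lambda>x. (G x)\<^sup>2)"
    using u2 g2 unfolding U_def G_def power_mult_distrib B2 by auto
  have sq: "\<bar>(k::real)\<^sup>2\<bar> \<le> c\<^sup>2" if "\<bar>k\<bar> \<le> c" for k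
    using power_mono[OF that, of 2] by simp
  have PQS2: "integrable lborel (\<lambda>x. (P x)\<^sup>2)" "integrable lborel (\<lambda>x. (Q x)\<^sup>2)" "integrable lborel (\<lambda>x. (S x)\<^sup>2)"
    unfolding P_def Q_def S_def power_mult_distrib
    by (intro integrable_bounded_mult[where c = "c\<^sup>2"] UG2 sq c c'; measurable)+
  have UG1: "integrable lborel U" "integrable lborel G"
  proof -
    have "U = (\<lambda>x. ?B x * U x)" "G = (\<lambda>x. ?B x * G x)" by (auto simp: U_def G_def indicator_def fun_eq_iff)
    moreover have "integrable lborel (\<lambda>x. ?B x * U x)" "integrable lborel (\<lambda>x. ?B x * G x)"
      by (intro integrable_mult_L2 UG2; simp add: B2 iB)+
    ultimately show "integrable lborel U" "integrable lborel G" by simp_all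
  qed
  have PQS1: "integrable lborel P" "integrable lborel Q" "integrable lborel S"
    unfolding P_def[abs_def] Q_def[abs_def] S_def[abs_def]
    by (intro integrable_bounded_mult[where c = c] UG1 c c'; measurable)+
  have ball: "norm x \<le> r \<Longrightarrow> ?B x = 1" for x by simp
  have PQS: "\<phi>' x $ i * u x = P x" "\<phi> x * u x = Q x" "\<phi> x * g x = S x" for x
    using r(2,3)[of x] ball[of x] by (cases "norm x \<le> r"; simp add: P_def Q_def S_def U_def G_def)+
  \<comment> \<open>A correlation function: a double integral with weight \<open>k (y - x)\<close>
    is a single integral of \<open>k\<close> against it, so concentrating the weight evaluates it at
    \<open>z = 0\<close>.\<close>
  define L where "L F H z = (LBINT x. F x * H (x + z))" for F H :: "real^'n \<Rightarrow> real" and z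
  \<comment> \<open>The gradient of the bump blows up as \<open>\<epsilon>\<close> tends to 0. It
    occurs once on testing in \<open>x\<close> (\<open>W1\<close>) and once on testing in
    \<open>y\<close> (\<open>W2\<close>), and is eliminated between the two before the
    limit.\<close>
  have key: "(LBINT z. bump \<epsilon> z * (L P U z + L Q G z + L S U z)) = 0" if \<epsilon>: "0 < \<epsilon>" "\<epsilon> \<le> 1" for \<epsilon>
  proof -
    let ?b = "bump \<epsilon> :: real^'n \<Rightarrow> real" and ?b' = "\<lambda>z::real^'n. bump_grad \<epsilon> z $ i"
    have bb: "\<bar>?b z\<bar> \<le> 1" for z using bump_bounds[of \<epsilon> z] by simp
    have b'b: "\<bar>?b' z\<bar> \<le> 4 / \<epsilon>" for z
      by (rule order_trans[OF component_le_norm_cart norm_bump_grad_le[OF \<epsilon>(1)]])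
    have [measurable]: "?b' \<in> borel_measurable borel" by measurable
    have W1: "(LBINT x. ?b (y - x) * (P x * U y)) - (LBINT x. ?b' (y - x) * (Q x * U y))
        + (LBINT x. ?b (y - x) * (S x * U y)) = 0" for y
    proof -
      have i1: "integrable lborel (\<lambda>x. ?b (y - x) * P x)" "integrable lborel (\<lambda>x. ?b (y - x) * S x)"
        by (intro integrable_bounded_mult[where c = 1] PQS1 bb; measurable)+
      have i2: "integrable lborel (\<lambda>x. ?b' (y - x) * Q x)"
        by (intro integrable_bounded_mult[where c = "4 / \<epsilon>"] PQS1 b'b) measurable
      have "(LBINT x. (bump \<epsilon> (x - y) *\<^sub>R \<phi>' x + \<phi> x *\<^sub>R bump_grad \<epsilon> (x - y)) $ i * u x)
          = - (LBINT x. (\<phi> x * bump \<epsilon> (x - y)) * g x)"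
        by (rule weak[OF test_function_mult_bump[OF \<phi>d \<epsilon>(1)]])
      moreover have "(bump \<epsilon> (x - y) *\<^sub>R \<phi>' x + \<phi> x *\<^sub>R bump_grad \<epsilon> (x - y)) $ i * u x
          = ?b (y - x) * P x - ?b' (y - x) * Q x" for x
        unfolding bump_minus_commute[of \<epsilon> x y] bump_grad_minus[of \<epsilon> x y] PQS[symmetric]
        by (simp add: algebra_simps)
      moreover have "(\<phi> x * bump \<epsilon> (x - y)) * g x = ?b (y - x) * S x" for x
        unfolding bump_minus_commute[of \<epsilon> x y] PQS[symmetric] by simp
      ultimately have "(LBINT x. ?b (y - x) * P x) - (LBINT x. ?b' (y - x) * Q x)
          + (LBINT x. ?b (y - x) * S x) = 0"
        using i1 i2 by simp
      then have "((LBINT x. ?b (y - x) * P x) - (LBINT x. ?b' (y - x) * Q x)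
          + (LBINT x. ?b (y - x) * S x)) * U y = 0 * U y" by simp
      then show ?thesis by (simp add: distrib_right left_diff_distrib mult.assoc[symmetric])
    qed
    \<comment> \<open>If \<open>norm x > r\<close>, the factor \<open>Q x\<close> is 0; otherwise
      the cutoff \<open>?B\<close> equals 1 wherever the bump around \<open>x\<close> is
      nonzero.\<close>
    have W2: "(LBINT y. ?b' (y - x) * (Q x * U y)) = - (LBINT y. ?b (y - x) * (Q x * G y))" for x
    proof (cases "norm x \<le> r")
      case False
      then show ?thesis using r(2)[of x] by (simp add: Q_def)
    next
      case True
      have in_B: "?B y = 1" if "norm (y - x) < \<epsilon>" for y
        using True that \<epsilon>(2) norm_triangle_sub[of y x] by simp
      have "(LBINT y. bump_grad \<epsilon> (y - x) $ i * u y) = - (LBINT y. bump \<epsilon> (y - x) * g y)"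
        by (rule weak[OF test_function_bump[OF \<epsilon>(1)]])
      moreover have "bump_grad \<epsilon> (y - x) $ i * u y = ?b' (y - x) * U y" for y
        using in_B[of y] bump_grad_eq_0[OF \<epsilon>(1), of "y - x"] by (cases "norm (y - x) < \<epsilon>") (auto simp: U_def)
      moreover have "bump \<epsilon> (y - x) * g y = ?b (y - x) * G y" for y
        using in_B[of y] bump_eq_0[OF \<epsilon>(1), of "y - x"] by (cases "norm (y - x) < \<epsilon>") (auto simp: G_def)
      ultimately have "Q x * (LBINT y. ?b' (y - x) * U y) = Q x * - (LBINT y. ?b (y - x) * G y)" by simp
      then show ?thesis by (simp add: mult.left_commute[of _ "Q x"])
    qed
    note IK = integral_kernel_product[OF bump_measurable(1) _ _ bb]
    note IK' = integral_kernel_product[OF \<open>?b' \<in> borel_measurable borel\<close> _ _ b'b]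
    have "0 = (LBINT y. (LBINT x. ?b (y - x) * (P x * U y)) - (LBINT x. ?b' (y - x) * (Q x * U y))
        + (LBINT x. ?b (y - x) * (S x * U y)))"
      unfolding W1 by simp
    also have "\<dots> = (LBINT y. (LBINT x. ?b (y - x) * (P x * U y)))
        - (LBINT y. (LBINT x. ?b' (y - x) * (Q x * U y)))
        + (LBINT y. (LBINT x. ?b (y - x) * (S x * U y)))"
      using IK(5)[OF PQS1(1) UG1(1)] IK(5)[OF PQS1(3) UG1(1)] IK'(5)[OF PQS1(2) UG1(1)] by simp
    also have "(LBINT y. (LBINT x. ?b' (y - x) * (Q x * U y)))
        = (LBINT x. (LBINT y. ?b' (y - x) * (Q x * U y)))"
      by (rule IK'(1)[OF PQS1(2) UG1(1), symmetric])
    also have "\<dots> = - (LBINT x. (LBINT y. ?b (y - x) * (Q x * G y)))" unfolding W2 by simp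
    finally have "0 = (LBINT z. ?b z * L P U z) + (LBINT z. ?b z * L Q G z) + (LBINT z. ?b z * L S U z)"
      unfolding L_def IK(2)[OF PQS1(1) UG1(1), symmetric] IK(2)[OF PQS1(2) UG1(2), symmetric] IK(2)[OF PQS1(3) UG1(1), symmetric]
        IK(1)[OF PQS1(1) UG1(1), symmetric] IK(1)[OF PQS1(3) UG1(1), symmetric] by simp
    then show ?thesis
      using IK(3)[OF PQS1(1) UG1(1)] IK(3)[OF PQS1(2) UG1(2)] IK(3)[OF PQS1(3) UG1(1)]
      unfolding L_def[symmetric] by (simp add: distrib_left)
  qed
  \<comment> \<open>The bump averages in \<open>key\<close> vanish for all
    \<open>\<epsilon>\<close>, and the correlations are continuous at 0 by
    \<open>L2_pairing_translation\<close>.\<close>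
  have "L P U 0 + L Q G 0 + L S U 0 = 0"
  proof (rule eq_0_if_approximable)
    fix e :: real assume e: "e > 0"
    then have e3: "e / 3 > 0" by simp
    obtain d1 where d1: "d1 > 0" "\<And>z. norm z < d1 \<Longrightarrow> \<bar>L P U z - L P U 0\<bar> < e / 3"
      using L2_pairing_translation[OF _ _ PQS2(1) UG2(1) e3] unfolding L_def by auto
    obtain d2 where d2: "d2 > 0" "\<And>z. norm z < d2 \<Longrightarrow> \<bar>L Q G z - L Q G 0\<bar> < e / 3"
      using L2_pairing_translation[OF _ _ PQS2(2) UG2(2) e3] unfolding L_def by auto
    obtain d3 where d3: "d3 > 0" "\<And>z. norm z < d3 \<Longrightarrow> \<bar>L S U z - L S U 0\<bar> < e / 3"
      using L2_pairing_translation[OF _ _ PQS2(3) UG2(1) e3] unfolding L_def by auto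
    define \<epsilon> where "\<epsilon> = min 1 (min d1 (min d2 d3))"
    have \<epsilon>: "0 < \<epsilon>" "\<epsilon> \<le> 1" using d1 d2 d3 by (auto simp: \<epsilon>_def)
    let ?L = "\<lambda>z. L P U z + L Q G z + L S U z"
    let ?I = "\<integral>z. bump \<epsilon> (z::real^'n) \<partial>lborel"
    note bi = bump_integral[OF \<epsilon>(1), where 'a = "real^'n"]
    have close: "\<bar>bump \<epsilon> z * (?L 0 - ?L z)\<bar> \<le> e * bump \<epsilon> z" for z
    proof (cases "norm z < \<epsilon>")
      case True
      then have "norm z < d1" "norm z < d2" "norm z < d3" by (auto simp: \<epsilon>_def)
      then have "\<bar>L P U z - L P U 0\<bar> < e / 3" "\<bar>L Q G z - L Q G 0\<bar> < e / 3" "\<bar>L S U z - L S U 0\<bar> < e / 3"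
        using d1(2) d2(2) d3(2) by auto
      then have "\<bar>?L 0 - ?L z\<bar> \<le> e" by linarith
      from mult_left_mono[OF this bump_bounds(1)[of \<epsilon> z]] show ?thesis
        unfolding abs_mult abs_of_nonneg[OF bump_bounds(1)] by (simp only: mult.commute)
    next
      case False
      then show ?thesis using bump_eq_0[OF \<epsilon>(1), of z] by simp
    qed
    have bb: "\<bar>bump \<epsilon> (z::real^'n)\<bar> \<le> 1" for z using bump_bounds[of \<epsilon> z] by simp
    have iL: "integrable lborel (\<lambda>z. bump \<epsilon> z * ?L z)"
      using integral_kernel_product(3)[OF bump_measurable(1) PQS1(1) UG1(1) bb]
        integral_kernel_product(3)[OF bump_measurable(1) PQS1(2) UG1(2) bb]
        integral_kernel_product(3)[OF bump_measurable(1) PQS1(3) UG1(1) bb]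
      unfolding L_def by (simp add: distrib_left)
    have iD: "integrable lborel (\<lambda>z. bump \<epsilon> z * (?L 0 - ?L z))"
    proof -
      have "integrable lborel (\<lambda>z. bump \<epsilon> z * ?L 0 - bump \<epsilon> z * ?L z)" using iL bi(1) by simp
      then show ?thesis by (simp add: right_diff_distrib)
    qed
    have "?I * ?L 0 = (LBINT z. bump \<epsilon> z * ?L 0 - bump \<epsilon> z * ?L z)"
      using key[OF \<epsilon>] iL bi(1) by simp
    also have "\<dots> = (LBINT z. bump \<epsilon> z * (?L 0 - ?L z))" by (simp add: right_diff_distrib)
    finally have "\<bar>?I * ?L 0\<bar> \<le> (LBINT z. \<bar>bump \<epsilon> z * (?L 0 - ?L z)\<bar>)" by simp
    also have "\<dots> \<le> (LBINT z. e * bump \<epsilon> (z::real^'n))"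
      by (rule integral_mono[OF integrable_abs[OF iD] integrable_mult_right[OF bi(1)] close])
    finally have "?I * \<bar>?L 0\<bar> \<le> ?I * e" using bi(2) by (simp add: abs_mult mult.commute)
    then show "\<bar>?L 0\<bar> \<le> e" using bi(2) by simp
  qed
  moreover have "L P U 0 = (LBINT x. \<phi>' x $ i * (u x)\<^sup>2)"
  proof -
    have "P x * U (x + 0) = \<phi>' x $ i * (u x)\<^sup>2" for x
      using r(3)[of x] ball[of x] by (cases "norm x \<le> r") (auto simp: P_def U_def power2_eq_square)
    then show ?thesis unfolding L_def by simp
  qed
  moreover have "L Q G 0 + L S U 0 = (LBINT x. \<phi> x * (2 * u x * g x))"
  proof -
    have "Q x * G x = \<phi> x * (u x * g x)" "S x * U x = \<phi> x * (u x * g x)" for x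
      using r(2)[of x] ball[of x] by (cases "norm x \<le> r"; simp add: Q_def G_def S_def U_def)+
    then show ?thesis unfolding L_def by (simp add: mult.assoc mult.left_commute[of _ "2::real"])
  qed
  ultimately show ?thesis by simp
qed

text \<open>Bumps of radius \<open>n + 1\<close> reduce this to compact support: they tend to 1, and
  their gradients are at most 4 and tend to 0, with \<open>\<psi> u^2\<close> providing the
  majorant. The extension is made for Gaussian \<open>\<psi>\<close>, which have unbounded
  support.\<close>

lemma weak_product_rule_decaying:
  fixes u g \<psi> :: "real ^ 'n \<Rightarrow> real"
  assumes um [measurable]: "u \<in> borel_measurable borel" and gm [measurable]: "g \<in> borel_measurable borel"
    and u2: "\<And>s. integrable lborel (\<lambda>x. indicator (cball 0 s) x * (u x)\<^sup>2)"
    and g2: "\<And>s. integrable lborel (\<lambda>x. indicator (cball 0 s) x * (g x)\<^sup>2)"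
    and weak: "\<And>\<phi> \<phi>'. test_function \<phi> \<phi>' \<Longrightarrow>
      (LBINT x. \<phi>' x $ i * u x) = - (LBINT x. \<phi> x * g x)"
    and \<psi>: "\<And>x. (\<psi> has_derivative (\<lambda>h. \<psi>' x \<bullet> h)) (at x)" "continuous_on UNIV \<psi>'"
    and i1: "integrable lborel (\<lambda>x. \<psi>' x $ i * (u x)\<^sup>2)"
    and i2: "integrable lborel (\<lambda>x. \<psi> x * (u x)\<^sup>2)"
    and i3: "integrable lborel (\<lambda>x. \<psi> x * (2 * u x * g x))"
  shows "(LBINT x. \<psi>' x $ i * (u x)\<^sup>2) = - (LBINT x. \<psi> x * (2 * u x * g x))"
proof -
  let ?r = "\<lambda>n. real (Suc n)"
  have c: "continuous_on UNIV \<psi>"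
    using \<psi>(1) by (auto intro!: continuous_at_imp_continuous_on has_derivative_continuous)
  have [measurable]: "\<psi> \<in> borel_measurable borel" "\<psi>' \<in> borel_measurable borel"
    using c \<psi>(2) by (auto intro: borel_measurable_continuous_onI)
  have eq: "(LBINT x. bump (?r n) x * (\<psi>' x $ i * (u x)\<^sup>2) + bump_grad (?r n) x $ i * (\<psi> x * (u x)\<^sup>2))
      = - (LBINT x. bump (?r n) x * (\<psi> x * (2 * u x * g x)))" for n
    using weak_product_rule[OF um gm u2 g2 weak test_function_mult_bump[OF \<psi>, where y = 0 and r = "?r n"]]
    by (simp add: algebra_simps)
  have lim_bump: "(\<lambda>n. bump (?r n) x) \<longlonglongrightarrow> 1" for x :: "real^'n"
  proof -
    have *: "(\<lambda>n. (norm x)\<^sup>2 * (1 / ?r n)\<^sup>2) \<longlonglongrightarrow> (norm x)\<^sup>2 * 0\<^sup>2"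
      by (intro tendsto_intros LIMSEQ_Suc[OF lim_1_over_n])
    have "(\<lambda>n. (max 0 (1 - (norm x)\<^sup>2 * (1 / ?r n)\<^sup>2))\<^sup>2) \<longlonglongrightarrow> (max 0 (1 - (norm x)\<^sup>2 * 0\<^sup>2))\<^sup>2"
      by (intro tendsto_power tendsto_max tendsto_diff tendsto_const *)
    then show ?thesis unfolding bump_def by (simp add: power_divide)
  qed
  have lim_grad: "(\<lambda>n. bump_grad (?r n) x $ i) \<longlonglongrightarrow> 0" for x :: "real^'n"
  proof (rule Lim_null_comparison)
    show "eventually (\<lambda>n. norm (bump_grad (?r n) x $ i) \<le> 4 * (1 / ?r n)) sequentially"
      using order_trans[OF component_le_norm_cart norm_bump_grad_le[of "?r n" x for n]]
      by (intro always_eventually allI) simp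
    show "(\<lambda>n. 4 * (1 / ?r n)) \<longlonglongrightarrow> 0"
      using tendsto_mult[OF tendsto_const[of "4::real"] LIMSEQ_Suc[OF lim_1_over_n]] by simp
  qed
  have grad_le: "\<bar>bump_grad (?r n) x $ i\<bar> \<le> 4" for n and x :: "real^'n"
  proof -
    have "\<bar>bump_grad (?r n) x $ i\<bar> \<le> 4 / ?r n"
      using order_trans[OF component_le_norm_cart norm_bump_grad_le[of "?r n" x]] by simp
    also have "\<dots> \<le> 4" by (simp add: divide_le_eq)
    finally show ?thesis .
  qed
  have bump_le: "\<bar>bump (?r n) x\<bar> \<le> 1" for n and x :: "real^'n" using bump_bounds[of "?r n" x] by simp
  have "(\<lambda>n. \<integral>x. bump (?r n) x * (\<psi>' x $ i * (u x)\<^sup>2) + bump_grad (?r n) x $ i * (\<psi> x * (u x)\<^sup>2) \<partial>lborel)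
      \<longlonglongrightarrow> (LBINT x. 1 * (\<psi>' x $ i * (u x)\<^sup>2) + 0 * (\<psi> x * (u x)\<^sup>2))"
  proof (rule integral_dominated_convergence[where w = "\<lambda>x. \<bar>\<psi>' x $ i * (u x)\<^sup>2\<bar> + 4 * \<bar>\<psi> x * (u x)\<^sup>2\<bar>"])
    show "AE x in lborel. (\<lambda>n. bump (?r n) x * (\<psi>' x $ i * (u x)\<^sup>2) + bump_grad (?r n) x $ i * (\<psi> x * (u x)\<^sup>2))
        \<longlonglongrightarrow> 1 * (\<psi>' x $ i * (u x)\<^sup>2) + 0 * (\<psi> x * (u x)\<^sup>2)"
      by (intro AE_I2 tendsto_intros lim_bump lim_grad)
    show "AE x in lborel. norm (bump (?r n) x * (\<psi>' x $ i * (u x)\<^sup>2) + bump_grad (?r n) x $ i * (\<psi> x * (u x)\<^sup>2))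
        \<le> \<bar>\<psi>' x $ i * (u x)\<^sup>2\<bar> + 4 * \<bar>\<psi> x * (u x)\<^sup>2\<bar>" for n
    proof (intro AE_I2)
      fix x
      have "\<bar>bump (?r n) x\<bar> * \<bar>\<psi>' x $ i * (u x)\<^sup>2\<bar> \<le> 1 * \<bar>\<psi>' x $ i * (u x)\<^sup>2\<bar>"
        by (intro mult_right_mono bump_le) simp
      moreover have "\<bar>bump_grad (?r n) x $ i\<bar> * \<bar>\<psi> x * (u x)\<^sup>2\<bar> \<le> 4 * \<bar>\<psi> x * (u x)\<^sup>2\<bar>"
        by (intro mult_right_mono grad_le) simp
      ultimately show "norm (bump (?r n) x * (\<psi>' x $ i * (u x)\<^sup>2) + bump_grad (?r n) x $ i * (\<psi> x * (u x)\<^sup>2))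
        \<le> \<bar>\<psi>' x $ i * (u x)\<^sup>2\<bar> + 4 * \<bar>\<psi> x * (u x)\<^sup>2\<bar>"
        unfolding real_norm_def
        by (intro order_trans[OF abs_triangle_ineq] add_mono) (simp_all only: abs_mult[of "bump _ _"] abs_mult[of "bump_grad _ _ $ _"] mult_1)
    qed
    show "integrable lborel (\<lambda>x. \<bar>\<psi>' x $ i * (u x)\<^sup>2\<bar> + 4 * \<bar>\<psi> x * (u x)\<^sup>2\<bar>)"
      using i1 i2 by (intro Bochner_Integration.integrable_add integrable_mult_right integrable_abs)
  qed measurable
  moreover have "(\<lambda>n. - (LBINT x. bump (?r n) x * (\<psi> x * (2 * u x * g x))))
      \<longlonglongrightarrow> - (LBINT x. 1 * (\<psi> x * (2 * u x * g x)))"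
  proof (intro tendsto_minus integral_dominated_convergence[where w = "\<lambda>x. \<bar>\<psi> x * (2 * u x * g x)\<bar>"])
    show "AE x in lborel. (\<lambda>n. bump (?r n) x * (\<psi> x * (2 * u x * g x))) \<longlonglongrightarrow> 1 * (\<psi> x * (2 * u x * g x))"
      by (intro AE_I2 tendsto_intros lim_bump)
    show "AE x in lborel. norm (bump (?r n) x * (\<psi> x * (2 * u x * g x))) \<le> \<bar>\<psi> x * (2 * u x * g x)\<bar>" for n
      using mult_right_mono[OF bump_le abs_ge_zero] by (intro AE_I2) (simp only: real_norm_def abs_mult[of "bump _ _"] mult_1)
    show "integrable lborel (\<lambda>x. \<bar>\<psi> x * (2 * u x * g x)\<bar>)" using i3 by (rule integrable_abs)
  qed measurable
  ultimately show ?thesis unfolding eq using LIMSEQ_unique by fastforce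
qed

section \<open>Functions with square integrable weak gradient\<close>

lemma has_derivative_gk:
  assumes t: "t > 0"
  shows "(gk t has_derivative (\<lambda>h. (- (gk t z / t) *\<^sub>R z) \<bullet> h)) (at (z::'a::euclidean_space))"
proof -
  have "((\<lambda>z::'a. - ((z \<bullet> z) / (2 * t))) has_derivative (\<lambda>h. - (z \<bullet> h) / t)) (at z)"
    using t by (auto intro!: derivative_eq_intros simp: inner_commute field_simps)
  from has_derivative_mult_right[OF has_derivative_exp[OF this], of "(2 * pi * t) powr (- (real DIM('a) / 2))"]
  show ?thesis
    unfolding gk_def[abs_def] power2_norm_eq_inner by (simp add: field_simps)
qed

text \<open>The variance per coordinate of \<open>dm\<close>, since
  \<open>1 / (2 v) = 2 \<pi>\<close> for this value. Moreover \<open>2 v = 1 / (2 \<pi>)\<close> is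
  the factor of the Dirichlet integral in the deficit.\<close>

abbreviation gauss_v :: real where "gauss_v \<equiv> 1 / (4 * pi)"

lemma gauss_m_eq: "gauss_m = density lborel (\<lambda>x :: real ^ 'n. ennreal (gk gauss_v x))"
proof -
  have "gk gauss_v x = 2 powr (real CARD('n) / 2) * exp (- (2 * pi * (norm x)\<^sup>2))" for x :: "real ^ 'n"
    unfolding gk_def by (simp add: powr_minus powr_divide)
  then show ?thesis by (simp add: gauss_m_def)
qed

lemma sets_gauss_m [simp, measurable_cong]: "sets gauss_m = sets borel"
  by (simp add: gauss_m_eq)

lemma space_gauss_m [simp]: "space gauss_m = UNIV"
  by (simp add: gauss_m_eq)

lemma integrable_gauss_m:
  fixes F :: "real ^ 'n \<Rightarrow> 'b::{banach, second_countable_topology}"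
  assumes "F \<in> borel_measurable borel"
  shows "integrable gauss_m F \<longleftrightarrow> integrable lborel (\<lambda>x. gk gauss_v x *\<^sub>R F x)"
    and "(\<integral>x. F x \<partial>gauss_m) = (LBINT x. gk gauss_v x *\<^sub>R F x)"
  unfolding gauss_m_eq using assms by (simp_all add: integrable_density integral_density)

lemma prob_space_gauss_m: "prob_space (gauss_m :: (real ^ 'n) measure)"
proof (rule prob_spaceI)
  show "emeasure gauss_m (space (gauss_m :: (real ^ 'n) measure)) = 1"
    unfolding gauss_m_eq by (simp add: emeasure_density nn_integral_gk)
qed

lemma integrable_gauss_m_square:
  fixes F :: "real ^ 'n \<Rightarrow> 'b::{banach, second_countable_topology}"
  assumes [measurable]: "F \<in> borel_measurable borel" and F: "integrable gauss_m (\<lambda>x. (norm (F x))\<^sup>2)"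
  shows "integrable gauss_m F"
proof -
  interpret g: prob_space "gauss_m :: (real^'n) measure" by (rule prob_space_gauss_m)
  show ?thesis
  proof (rule Bochner_Integration.integrable_bound)
    show "integrable gauss_m (\<lambda>x. 1 + (norm (F x))\<^sup>2)" using F by simp
    show "AE x in gauss_m. norm (F x) \<le> norm (1 + (norm (F x))\<^sup>2)"
      by (intro AE_I2) (simp add: order_trans[OF norm_le_one_plus_power2])
  qed measurable
qed

lemma gauss_moment2: "integrable gauss_m (\<lambda>x :: real ^ 'n. (norm x)\<^sup>2)"
  by (simp add: integrable_gauss_m integrable_gk_inner(4))

lemma gk_ball_lower:
  assumes "norm (x::'a::euclidean_space) \<le> s" "t > 0"
  shows "(2 * pi * t) powr (- (real DIM('a) / 2)) * exp (- (s\<^sup>2 / (2 * t))) \<le> gk t x"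
  unfolding gk_def using assms
  by (intro mult_left_mono) (auto intro!: divide_right_mono power_mono)

locale weakly_differentiable =
  fixes f :: "real ^ 'n \<Rightarrow> complex" and G :: "real ^ 'n \<Rightarrow> complex ^ 'n"
  assumes wg: "is_weak_gradient f G"
    and f2: "integrable gauss_m (\<lambda>x. (cmod (f x))\<^sup>2)"
    and G2: "integrable gauss_m (\<lambda>x. (norm (G x))\<^sup>2)"
begin

lemma measurable_f_G [measurable]: "f \<in> borel_measurable borel" "G \<in> borel_measurable borel"
  using wg by (auto simp: is_weak_gradient_def)

lemma G_component_le: "(cmod (G x $ i))\<^sup>2 \<le> (norm (G x))\<^sup>2"
  by (intro power_mono Finite_Cartesian_Product.norm_nth_le) simp

lemma f2_lborel: "integrable lborel (\<lambda>x. (cmod (f x))\<^sup>2 * gk gauss_v x)"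
  using f2 by (simp add: integrable_gauss_m mult.commute)

lemma G2_lborel: "integrable lborel (\<lambda>x. (norm (G x))\<^sup>2 * gk gauss_v x)"
  using G2 by (simp add: integrable_gauss_m mult.commute)

text \<open>On a ball the Gaussian weight is bounded below by a positive \<open>k\<close>, so
  weighted square integrability implies the local one.\<close>

lemma local_L2:
  fixes F :: "real ^ 'n \<Rightarrow> real"
  assumes [measurable]: "F \<in> borel_measurable borel" "H \<in> borel_measurable borel"
    and i: "integrable lborel (\<lambda>x. H x * gk gauss_v x)" and le: "\<And>x. (F x)\<^sup>2 \<le> H x"
  shows "integrable lborel (\<lambda>x. indicator (cball 0 s) x * (F x)\<^sup>2)"
proof -
  define k where "k = (2 * pi * gauss_v) powr (- (real DIM(real^'n) / 2)) * exp (- (s\<^sup>2 / (2 * gauss_v)))"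
  have k: "k > 0" unfolding k_def by simp
  have [measurable]: "cball (0::real^'n) s \<in> sets borel" by simp
  show ?thesis
  proof (rule Bochner_Integration.integrable_bound[OF integrable_mult_right[OF i, of "1 / k"]])
    have "norm (indicator (cball 0 s) x * (F x)\<^sup>2) \<le> norm (1 / k * (H x * gk gauss_v x))" for x
    proof (cases "x \<in> cball 0 s")
      case True
      then have "k \<le> gk gauss_v x" unfolding k_def by (intro gk_ball_lower) auto
      then have "(F x)\<^sup>2 * k \<le> H x * gk gauss_v x"
        using le[of x] k by (intro mult_mono) (auto intro: order_trans[OF zero_le_power2])
      then have *: "(F x)\<^sup>2 \<le> 1 / k * (H x * gk gauss_v x)" using k by (simp add: field_simps)
      have "norm (indicator (cball 0 s) x * (F x)\<^sup>2) = (F x)\<^sup>2" using True by simp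
      then show ?thesis unfolding real_norm_def using order_trans[OF * abs_ge_self] by (simp only:)
    qed simp
    then show "AE x in lborel. norm (indicator (cball 0 s) x * (F x)\<^sup>2) \<le> norm (1 / k * (H x * gk gauss_v x))" by simp
  qed measurable
qed

lemma integrable_test_mult:
  fixes F :: "real ^ 'n \<Rightarrow> 'b::{banach, second_countable_topology}"
  assumes F: "loc_integrable F" and [measurable]: "k \<in> borel_measurable borel"
    and k: "\<And>x. \<bar>k x\<bar> \<le> c" and 0: "\<And>x. norm x > r \<Longrightarrow> k x = 0"
  shows "integrable lborel (\<lambda>x. k x *\<^sub>R F x)"
proof -
  have i: "integrable lborel (\<lambda>x. indicator (cball 0 r) x *\<^sub>R F x)"
    using F unfolding loc_integrable_def set_integrable_def by (auto simp: compact_cball)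
  have "integrable lborel (\<lambda>x. k x *\<^sub>R (indicator (cball 0 r) x *\<^sub>R F x))"
  proof (rule Bochner_Integration.integrable_bound[OF integrable_mult_right[OF integrable_norm[OF i], of c]])
    show "(\<lambda>x. k x *\<^sub>R (indicator (cball 0 r) x *\<^sub>R F x)) \<in> borel_measurable lborel"
      using borel_measurable_integrable[OF i] by measurable
    have "norm (k x *\<^sub>R (indicator (cball 0 r) x *\<^sub>R F x)) \<le> norm (c * norm (indicator (cball 0 r) x *\<^sub>R F x))" for x
      unfolding norm_scaleR norm_mult using k[of x] by (intro mult_mono) auto
    then show "AE x in lborel. norm (k x *\<^sub>R (indicator (cball 0 r) x *\<^sub>R F x)) \<le> norm (c * norm (indicator (cball 0 r) x *\<^sub>R F x))" by simp
  qed
  moreover have "k x *\<^sub>R (indicator (cball 0 r) x *\<^sub>R F x) = k x *\<^sub>R F x" for x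
    using 0[of x] by (cases "norm x \<le> r") (auto simp: indicator_def)
  ultimately show ?thesis by (simp only:)
qed

lemma loc_integrable_component:
  assumes "loc_integrable G"
  shows "loc_integrable (\<lambda>x. G x $ i)"
  unfolding loc_integrable_def set_integrable_def
proof safe
  fix K :: "(real ^ 'n) set" assume "compact K"
  then have I: "integrable lborel (\<lambda>x. indicator K x *\<^sub>R G x)"
    using assms by (simp add: loc_integrable_def set_integrable_def)
  have "integrable lborel (\<lambda>x. (indicator K x *\<^sub>R G x) $ i)"
    by (rule integrable_bounded_linear[OF bounded_linear_vec_nth I])
  then show "integrable lborel (\<lambda>x. indicator K x *\<^sub>R G x $ i)" by simp
qed

lemma weak_parts:
  assumes \<phi>: "test_function \<phi> \<phi>'"
  shows "(LBINT x. \<phi>' x $ i * Re (f x)) = - (LBINT x. \<phi> x * Re (G x $ i))"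
    and "(LBINT x. \<phi>' x $ i * Im (f x)) = - (LBINT x. \<phi> x * Im (G x $ i))"
proof -
  obtain r where r: "r > 0" "\<And>x. norm x > r \<Longrightarrow> \<phi> x = 0" "\<And>x. norm x > r \<Longrightarrow> \<phi>' x = 0"
    using test_functionD[OF \<phi>] by metis
  obtain c where c: "c > 0" "\<And>x. \<bar>\<phi> x\<bar> \<le> c" "\<And>x. norm (\<phi>' x) \<le> c"
    using test_function_bounded[OF \<phi>] by metis
  have c': "\<bar>\<phi>' x $ i\<bar> \<le> c" for x using order_trans[OF component_le_norm_cart c(3)] .
  note [measurable] = test_function_measurable[OF \<phi>]
  have loc: "loc_integrable f" "loc_integrable (\<lambda>x. G x $ i)"
    using wg loc_integrable_component by (auto simp: is_weak_gradient_def)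
  have 1: "integrable lborel (\<lambda>x. (\<phi>' x $ i) *\<^sub>R f x)"
    by (rule integrable_test_mult[OF loc(1) _ c', where r = r]) (use r in auto)
  have 2: "integrable lborel (\<lambda>x. \<phi> x *\<^sub>R (G x $ i))"
    by (rule integrable_test_mult[OF loc(2) _ c(2), where r = r]) (use r in auto)
  have eq: "(LINT x|lborel. (\<phi>' x $ i) *\<^sub>R f x) = - (LINT x|lborel. \<phi> x *\<^sub>R (G x $ i))"
    using wg \<phi> by (simp add: is_weak_gradient_def)
  from arg_cong[OF eq, of Re] show "(LBINT x. \<phi>' x $ i * Re (f x)) = - (LBINT x. \<phi> x * Re (G x $ i))"
    using integral_Re[OF 1] integral_Re[OF 2] by simp
  from arg_cong[OF eq, of Im] show "(LBINT x. \<phi>' x $ i * Im (f x)) = - (LBINT x. \<phi> x * Im (G x $ i))"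
    using integral_Im[OF 1] integral_Im[OF 2] by simp
qed

text \<open>The product rule for the real and the imaginary part, added up: the gradient of
  \<open>|f|^2\<close> is \<open>2 Re (cnj f G)\<close>. Differentiating \<open>|f|^2\<close> and
  not its logarithm makes zeros of \<open>f\<close> harmless. The bounds on \<open>\<psi>\<close>
  fit \<open>gk v\<close> and its products with other kernels; a gradient gains a linear factor,
  which \<open>mom\<close> pays for.\<close>

lemma gradient_modulus2:
  assumes mom: "integrable gauss_m (\<lambda>x. (norm x)\<^sup>2 * (cmod (f x))\<^sup>2)"
    and \<psi>: "\<And>x. (\<psi> has_derivative (\<lambda>h. \<psi>' x \<bullet> h)) (at x)" "continuous_on UNIV \<psi>'"
    and b: "\<And>x. \<bar>\<psi> x\<bar> \<le> C * gk gauss_v x" "\<And>x. \<bar>\<psi>' x $ i\<bar> \<le> C * ((1 + (norm x)\<^sup>2) * gk gauss_v x)"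
  shows "(LBINT x. \<psi>' x $ i * (cmod (f x))\<^sup>2) = - (LBINT x. \<psi> x * (2 * Re (cnj (f x) * G x $ i)))"
    and "integrable lborel (\<lambda>x. \<psi>' x $ i * (cmod (f x))\<^sup>2)"
    and "integrable lborel (\<lambda>x. \<psi> x * (2 * Re (cnj (f x) * G x $ i)))"
proof -
  have [measurable]: "\<psi> \<in> borel_measurable borel" "\<psi>' \<in> borel_measurable borel"
    using \<psi> by (auto intro!: borel_measurable_continuous_onI continuous_at_imp_continuous_on has_derivative_continuous)
  have C0: "C \<ge> 0"
  proof -
    have "0 \<le> C * gk gauss_v (0::real^'n)" using b(1)[of 0] by linarith
    moreover have "gk gauss_v (0::real^'n) > 0" by (intro gk_pos) simp
    ultimately show ?thesis by (simp add: zero_le_mult_iff)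
  qed
  have mom': "integrable lborel (\<lambda>x. ((norm x)\<^sup>2 * (cmod (f x))\<^sup>2) * gk gauss_v x)"
    using mom by (simp add: integrable_gauss_m mult.commute)
  have part: "(LBINT x. \<psi>' x $ i * (u x)\<^sup>2) = - (LBINT x. \<psi> x * (2 * u x * g x))
      \<and> integrable lborel (\<lambda>x. \<psi>' x $ i * (u x)\<^sup>2) \<and> integrable lborel (\<lambda>x. \<psi> x * (2 * u x * g x))"
    if [measurable]: "u \<in> borel_measurable borel" "g \<in> borel_measurable borel"
      and u: "\<And>x. (u x)\<^sup>2 \<le> (cmod (f x))\<^sup>2" and g: "\<And>x. (g x)\<^sup>2 \<le> (norm (G x))\<^sup>2"
      and weak: "\<And>\<phi> \<phi>'. test_function \<phi> \<phi>' \<Longrightarrow>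
        (LBINT x. \<phi>' x $ i * u x) = - (LBINT x. \<phi> x * g x)" for u g
  proof -
    have i1: "integrable lborel (\<lambda>x. \<psi>' x $ i * (u x)\<^sup>2)"
    proof (rule Bochner_Integration.integrable_bound)
      show "integrable lborel (\<lambda>x. C * ((cmod (f x))\<^sup>2 * gk gauss_v x + ((norm x)\<^sup>2 * (cmod (f x))\<^sup>2) * gk gauss_v x))"
        by (intro integrable_mult_right Bochner_Integration.integrable_add f2_lborel mom')
      have "norm (\<psi>' x $ i * (u x)\<^sup>2) \<le> norm (C * ((cmod (f x))\<^sup>2 * gk gauss_v x + ((norm x)\<^sup>2 * (cmod (f x))\<^sup>2) * gk gauss_v x))" for x
      proof -
        have "\<bar>\<psi>' x $ i\<bar> * (u x)\<^sup>2 \<le> (C * ((1 + (norm x)\<^sup>2) * gk gauss_v x)) * (cmod (f x))\<^sup>2"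
          using C0 by (intro mult_mono b u) auto
        also have "\<dots> = C * ((cmod (f x))\<^sup>2 * gk gauss_v x + ((norm x)\<^sup>2 * (cmod (f x))\<^sup>2) * gk gauss_v x)"
          by (simp add: algebra_simps)
        also have "\<dots> \<le> \<bar>\<dots>\<bar>" by (rule abs_ge_self)
        finally show ?thesis by (simp only: real_norm_def abs_mult[of "\<psi>' x $ i"] abs_power2)
      qed
      then show "AE x in lborel. norm (\<psi>' x $ i * (u x)\<^sup>2) \<le> norm (C * ((cmod (f x))\<^sup>2 * gk gauss_v x + ((norm x)\<^sup>2 * (cmod (f x))\<^sup>2) * gk gauss_v x))" by simp
    qed measurable
    have i2: "integrable lborel (\<lambda>x. \<psi> x * (u x)\<^sup>2)"
    proof (rule Bochner_Integration.integrable_bound[OF integrable_mult_right[OF f2_lborel, of C]])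
      have "norm (\<psi> x * (u x)\<^sup>2) \<le> norm (C * ((cmod (f x))\<^sup>2 * gk gauss_v x))" for x
      proof -
        have "\<bar>\<psi> x\<bar> * (u x)\<^sup>2 \<le> (C * gk gauss_v x) * (cmod (f x))\<^sup>2"
          using C0 by (intro mult_mono b u) auto
        also have "\<dots> = C * ((cmod (f x))\<^sup>2 * gk gauss_v x)" by simp
        also have "\<dots> \<le> \<bar>\<dots>\<bar>" by (rule abs_ge_self)
        finally show ?thesis by (simp only: real_norm_def abs_mult[of "\<psi> x"] abs_power2)
      qed
      then show "AE x in lborel. norm (\<psi> x * (u x)\<^sup>2) \<le> norm (C * ((cmod (f x))\<^sup>2 * gk gauss_v x))" by simp
    qed measurable
    have i3: "integrable lborel (\<lambda>x. \<psi> x * (2 * u x * g x))"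
    proof (rule Bochner_Integration.integrable_bound)
      show "integrable lborel (\<lambda>x. C * ((cmod (f x))\<^sup>2 * gk gauss_v x + (norm (G x))\<^sup>2 * gk gauss_v x))"
        by (intro integrable_mult_right Bochner_Integration.integrable_add f2_lborel G2_lborel)
      have "norm (\<psi> x * (2 * u x * g x)) \<le> norm (C * ((cmod (f x))\<^sup>2 * gk gauss_v x + (norm (G x))\<^sup>2 * gk gauss_v x))" for x
      proof -
        have "\<bar>2 * u x * g x\<bar> \<le> (cmod (f x))\<^sup>2 + (norm (G x))\<^sup>2"
          using abs_mult_le_power2[of "u x" "g x"] u[of x] g[of x] by (simp add: abs_mult)
        then have "\<bar>\<psi> x\<bar> * \<bar>2 * u x * g x\<bar> \<le> (C * gk gauss_v x) * ((cmod (f x))\<^sup>2 + (norm (G x))\<^sup>2)"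
          using C0 by (intro mult_mono b) auto
        also have "\<dots> = C * ((cmod (f x))\<^sup>2 * gk gauss_v x + (norm (G x))\<^sup>2 * gk gauss_v x)"
          by (simp add: algebra_simps)
        also have "\<dots> \<le> \<bar>\<dots>\<bar>" by (rule abs_ge_self)
        finally show ?thesis by (simp only: real_norm_def abs_mult[of "\<psi> x"])
      qed
      then show "AE x in lborel. norm (\<psi> x * (2 * u x * g x)) \<le> norm (C * ((cmod (f x))\<^sup>2 * gk gauss_v x + (norm (G x))\<^sup>2 * gk gauss_v x))" by simp
    qed measurable
    show ?thesis
      using weak_product_rule_decaying[OF that(1,2) local_L2[OF that(1) _ f2_lborel u] local_L2[OF that(2) _ G2_lborel g] weak \<psi> i1 i2 i3]
        i1 i3 by simp
  qed
  have le: "(Re z)\<^sup>2 \<le> (cmod z)\<^sup>2" "(Im z)\<^sup>2 \<le> (cmod z)\<^sup>2" for z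
    by (simp_all add: cmod_power2)
  have re: "(\<lambda>x. Re (f x)) \<in> borel_measurable borel" "(\<lambda>x. Im (f x)) \<in> borel_measurable borel"
    "(\<lambda>x. Re (G x $ i)) \<in> borel_measurable borel" "(\<lambda>x. Im (G x $ i)) \<in> borel_measurable borel"
    by measurable
  note P1 = part[OF re(1,3) le(1) order_trans[OF le(1) G_component_le] weak_parts(1)]
  note P2 = part[OF re(2,4) le(2) order_trans[OF le(2) G_component_le] weak_parts(2)]
  have e1: "\<psi>' x $ i * (cmod (f x))\<^sup>2 = \<psi>' x $ i * (Re (f x))\<^sup>2 + \<psi>' x $ i * (Im (f x))\<^sup>2" for x
    by (simp add: cmod_power2 distrib_left)
  have e2: "\<psi> x * (2 * Re (cnj (f x) * G x $ i)) = \<psi> x * (2 * Re (f x) * Re (G x $ i)) + \<psi> x * (2 * Im (f x) * Im (G x $ i))" for x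
    by (simp add: algebra_simps)
  show "(LBINT x. \<psi>' x $ i * (cmod (f x))\<^sup>2) = - (LBINT x. \<psi> x * (2 * Re (cnj (f x) * G x $ i)))"
    unfolding e1 e2 using P1 P2 by simp
  show "integrable lborel (\<lambda>x. \<psi>' x $ i * (cmod (f x))\<^sup>2)"
    unfolding e1 using P1 P2 by simp
  show "integrable lborel (\<lambda>x. \<psi> x * (2 * Re (cnj (f x) * G x $ i)))"
    unfolding e2 using P1 P2 by simp
qed

end

locale normalized_weakly_differentiable = weakly_differentiable f G
  for f :: "real ^ 'n \<Rightarrow> complex" and G :: "real ^ 'n \<Rightarrow> complex ^ 'n" +
  assumes norm1: "(\<integral>x. (cmod (f x))\<^sup>2 \<partial>gauss_m) = 1"
    and mom: "integrable gauss_m (\<lambda>x. (norm x)\<^sup>2 * (cmod (f x))\<^sup>2)"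
begin

definition dens :: "real ^ 'n \<Rightarrow> real" where "dens x = (cmod (f x))\<^sup>2 * gk gauss_v x"

definition \<mu> :: "(real ^ 'n) measure" where "\<mu> = density lborel (\<lambda>x. ennreal (dens x))"

text \<open>\<open>v\<close> times the gradient of \<open>ln |f|^2\<close>. At zeros of
  \<open>f\<close> the division by 0 yields 0; \<open>\<mu>\<close> gives them no mass.\<close>

definition a :: "real ^ 'n \<Rightarrow> real ^ 'n" where
  "a x = (\<chi> i. 2 * gauss_v * Re (cnj (f x) * G x $ i) / (cmod (f x))\<^sup>2)"

definition D :: real where "D = (\<integral>x. (norm (G x))\<^sup>2 \<partial>gauss_m)"

lemma dens_measurable [measurable]: "dens \<in> borel_measurable borel"
  unfolding dens_def[abs_def] by measurable

lemma dens_nonneg: "dens x \<ge> 0" by (simp add: dens_def)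

lemma sets_\<mu> [simp]: "sets \<mu> = sets borel" by (simp add: \<mu>_def)

lemma mu_integral:
  fixes F :: "real ^ 'n \<Rightarrow> 'b::{banach, second_countable_topology}"
  assumes [measurable]: "F \<in> borel_measurable borel"
  shows "integrable \<mu> F \<longleftrightarrow> integrable lborel (\<lambda>x. dens x *\<^sub>R F x)"
    and "(\<integral>x. F x \<partial>\<mu>) = (LBINT x. dens x *\<^sub>R F x)"
  unfolding \<mu>_def using dens_nonneg by (simp_all add: integrable_density integral_density)

lemma mu_gauss:
  fixes F :: "real ^ 'n \<Rightarrow> real"
  assumes [measurable]: "F \<in> borel_measurable borel"
  shows "integrable \<mu> F \<longleftrightarrow> integrable gauss_m (\<lambda>x. (cmod (f x))\<^sup>2 * F x)"
    and "(\<integral>x. F x \<partial>\<mu>) = (\<integral>x. (cmod (f x))\<^sup>2 * F x \<partial>gauss_m)"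
  by (simp_all add: mu_integral integrable_gauss_m dens_def ac_simps)

lemma a_measurable [measurable]: "a \<in> borel_measurable borel"
proof -
  have "(\<lambda>x. a x \<bullet> b) \<in> borel_measurable borel" if "b \<in> Basis" for b
  proof -
    obtain j where "b = axis j 1" using \<open>b \<in> Basis\<close> by (auto simp: Basis_vec_def)
    then show ?thesis unfolding a_def by (simp add: inner_axis) 
  qed
  then show ?thesis by (subst borel_measurable_euclidean_space) auto
qed

text \<open>\<open>Re (cnj f G)\<close> keeps just the part of the gradient that changes the
  modulus; the turning of the phase is lost, whence an inequality.\<close>

lemma a2_le: "dens x * (norm (a x))\<^sup>2 \<le> (2 * gauss_v)\<^sup>2 * ((norm (G x))\<^sup>2 * gk gauss_v x)"
proof (cases "f x = 0")
  case True
  then show ?thesis by (simp add: dens_def)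
next
  case False
  let ?c = "cmod (f x)"
  have c: "?c > 0" using False by simp
  have "(norm (a x))\<^sup>2 = (\<Sum>i\<in>UNIV. (a x $ i)\<^sup>2)"
    by (simp add: norm_vec_def L2_set_def sum_nonneg)
  also have "\<dots> \<le> (\<Sum>i\<in>UNIV. (2 * gauss_v)\<^sup>2 * (cmod (G x $ i))\<^sup>2 / ?c\<^sup>2)"
  proof (rule sum_mono)
    fix i
    have "\<bar>Re (cnj (f x) * G x $ i)\<bar> \<le> ?c * cmod (G x $ i)"
      using abs_Re_le_cmod[of "cnj (f x) * G x $ i"] by (simp add: norm_mult)
    then have "(Re (cnj (f x) * G x $ i))\<^sup>2 \<le> (?c * cmod (G x $ i))\<^sup>2"
      by (rule power2_le_iff_abs_le[THEN iffD2, rotated]) simp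
    then have "(2 * gauss_v)\<^sup>2 * (Re (cnj (f x) * G x $ i))\<^sup>2 / (?c\<^sup>2)\<^sup>2 \<le> (2 * gauss_v)\<^sup>2 * (?c * cmod (G x $ i))\<^sup>2 / (?c\<^sup>2)\<^sup>2"
      by (intro divide_right_mono mult_left_mono) auto
    also have "\<dots> = (2 * gauss_v)\<^sup>2 * (cmod (G x $ i))\<^sup>2 / ?c\<^sup>2"
      using c by (simp add: power_mult_distrib power2_eq_square)
    finally show "(a x $ i)\<^sup>2 \<le> (2 * gauss_v)\<^sup>2 * (cmod (G x $ i))\<^sup>2 / ?c\<^sup>2"
      by (simp add: a_def power_mult_distrib power_divide)
  qed
  also have "\<dots> = (2 * gauss_v)\<^sup>2 * (norm (G x))\<^sup>2 / ?c\<^sup>2"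
    by (simp add: norm_vec_def L2_set_def sum_nonneg sum_distrib_left sum_divide_distrib)
  finally have "dens x * (norm (a x))\<^sup>2 \<le> dens x * ((2 * gauss_v)\<^sup>2 * (norm (G x))\<^sup>2 / ?c\<^sup>2)"
    using dens_nonneg[of x] by (rule mult_left_mono)
  also have "\<dots> = (2 * gauss_v)\<^sup>2 * ((norm (G x))\<^sup>2 * gk gauss_v x)"
    using c by (simp add: dens_def)
  finally show ?thesis .
qed

lemma integrable_a2: "integrable lborel (\<lambda>x. dens x * (norm (a x))\<^sup>2)"
  by (rule Bochner_Integration.integrable_bound[OF integrable_mult_right[OF G2_lborel, of "(2 * gauss_v)\<^sup>2"]])
    (use a2_le dens_nonneg in \<open>auto intro!: AE_I2 order_trans[OF _ abs_ge_self] simp del: power_mult_distrib\<close>)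

lemma prob_space_\<mu>: "prob_space \<mu>"
proof (rule prob_spaceI)
  have "(\<integral>\<^sup>+x. ennreal (dens x) \<partial>lborel) = ennreal (LBINT x. dens x)"
    using f2_lborel dens_nonneg by (intro nn_integral_eq_integral) (auto simp: dens_def)
  also have "(LBINT x. dens x) = 1"
    using norm1 by (simp add: integrable_gauss_m dens_def mult.commute)
  finally show "emeasure \<mu> (space \<mu>) = 1"
    unfolding \<mu>_def by (simp add: emeasure_density)
qed

sublocale gaussian_smoothing \<mu>
  by (intro gaussian_smoothing.intro prob_space_\<mu> gaussian_smoothing_axioms.intro)
    (use mom in \<open>simp_all add: mu_gauss mult.commute\<close>)

lemma dens_a: "dens x * a x $ i = gauss_v * (gk gauss_v x * (2 * Re (cnj (f x) * G x $ i)))"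
proof (cases "f x = 0")
  case False
  have key: "(p * g) * (2 * v * r / p) = v * (g * (2 * r))" if "p \<noteq> 0" for p g v r :: real
    using that by simp
  show ?thesis unfolding dens_def a_def vec_lambda_beta by (rule key) (use False in simp)
qed (simp add: dens_def)

text \<open>\<open>gradient_modulus2\<close> for the product of \<open>gk t (y - x)\<close> and
  \<open>gk v x\<close>: the first factor contributes \<open>(y - x) / t\<close> to the logarithmic
  gradient in \<open>x\<close>, the second \<open>- x / v\<close>, and writing \<open>x\<close> as
  \<open>y - (y - x)\<close> gives the right-hand side.\<close>

lemma smoothed_score:
  assumes t: "t > 0"
  shows "(\<integral>x. gk t (y - x) *\<^sub>R a x \<partial>\<mu>) = h t y *\<^sub>R y - ((gauss_v + t) / t) *\<^sub>R m t y"
proof (rule vec_eq_iff[THEN iffD2], rule allI)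
  fix i
  let ?v = gauss_v
  have v: "?v > 0" by simp
  let ?\<psi> = "\<lambda>x. gk t (y - x) * gk ?v x"
  let ?\<psi>' = "\<lambda>x. ?\<psi> x *\<^sub>R ((1 / t) *\<^sub>R (y - x) - (1 / ?v) *\<^sub>R x)"
  have d: "(?\<psi> has_derivative (\<lambda>h. ?\<psi>' x \<bullet> h)) (at x)" for x
  proof -
    have "((\<lambda>x. y - x) has_derivative (\<lambda>h. - h)) (at x)" by (auto intro!: derivative_eq_intros)
    from has_derivative_compose[OF this has_derivative_gk[OF t]]
    have 1: "((\<lambda>x. gk t (y - x)) has_derivative (\<lambda>h. (- (gk t (y - x) / t) *\<^sub>R (y - x)) \<bullet> (- h))) (at x)" .
    show ?thesis
      by (rule has_derivative_eq_rhs[OF has_derivative_mult[OF 1 has_derivative_gk[OF v]]])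
        (auto simp: fun_eq_iff inner_diff_left algebra_simps)
  qed
  have cont: "continuous_on UNIV ?\<psi>'" using t by (intro continuous_intros) auto
  obtain c where c: "c > 0" "\<And>z::real^'n. gk t z \<le> c" "\<And>z::real^'n. gk t z * norm z \<le> c"
    using gk_bounds[OF t] by metis
  define C where "C = c + (c / t + c / ?v)"
  have C: "c \<le> C" "c / t + c / ?v \<le> C" using c(1) t by (auto simp: C_def)
  have b1: "\<bar>?\<psi> x\<bar> \<le> C * gk ?v x" for x
    using c(2)[of "y - x"] C(1) by (simp add: abs_mult mult_right_mono)
  have b2: "\<bar>?\<psi>' x $ i\<bar> \<le> C * ((1 + (norm x)\<^sup>2) * gk ?v x)" for x
  proof -
    have "\<bar>((1 / t) *\<^sub>R (y - x) - (1 / ?v) *\<^sub>R x) $ i\<bar> \<le> norm ((1 / t) *\<^sub>R (y - x) - (1 / ?v) *\<^sub>R x)"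
      by (rule component_le_norm_cart)
    also have "\<dots> \<le> norm (y - x) / t + norm x / ?v"
      using t by (intro order_trans[OF norm_triangle_ineq4]) simp
    finally have "gk t (y - x) * \<bar>((1 / t) *\<^sub>R (y - x) - (1 / ?v) *\<^sub>R x) $ i\<bar> \<le> gk t (y - x) * (norm (y - x) / t + norm x / ?v)"
      by (rule mult_left_mono) simp
    also have "\<dots> = (gk t (y - x) * norm (y - x)) / t + gk t (y - x) * (norm x / ?v)" by (simp add: distrib_left)
    also have "\<dots> \<le> c / t + c * ((1 + (norm x)\<^sup>2) / ?v)"
      using t c(1) by (intro add_mono divide_right_mono mult_mono c norm_le_one_plus_power2) auto
    also have "\<dots> \<le> (c / t) * (1 + (norm x)\<^sup>2) + (c / ?v) * (1 + (norm x)\<^sup>2)"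
    proof (rule add_mono)
      show "c / t \<le> (c / t) * (1 + (norm x)\<^sup>2)"
        using mult_left_mono[of 1 "1 + (norm x)\<^sup>2" "c / t"] t c(1) by simp
    qed simp
    also have "\<dots> = (c / t + c / ?v) * (1 + (norm x)\<^sup>2)" by (rule distrib_right[symmetric])
    also have "\<dots> \<le> C * (1 + (norm x)\<^sup>2)" by (intro mult_right_mono C) simp
    finally have "(gk t (y - x) * \<bar>((1 / t) *\<^sub>R (y - x) - (1 / ?v) *\<^sub>R x) $ i\<bar>) * gk ?v x \<le> (C * (1 + (norm x)\<^sup>2)) * gk ?v x"
      by (rule mult_right_mono) simp
    then show ?thesis by (simp add: abs_mult ac_simps)
  qed
  note GM = gradient_modulus2[OF mom d cont b1 b2]
  have iL: "integrable \<mu> (\<lambda>x. gk t (y - x) *\<^sub>R a x)"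
  proof (rule Bochner_Integration.integrable_bound)
    have "integrable \<mu> (\<lambda>x. (norm (a x))\<^sup>2)" using integrable_a2 by (simp add: mu_integral)
    then show "integrable \<mu> (\<lambda>x. c * (1 + (norm (a x))\<^sup>2))" by simp
    show "(\<lambda>x. gk t (y - x) *\<^sub>R a x) \<in> borel_measurable \<mu>" by measurable
    have "norm (gk t (y - x) *\<^sub>R a x) \<le> norm (c * (1 + (norm (a x))\<^sup>2))" for x
      unfolding norm_scaleR norm_mult using c by (intro mult_mono) (auto intro: norm_le_one_plus_power2 order_trans[OF norm_le_one_plus_power2 abs_ge_self])
    then show "AE x in \<mu>. norm (gk t (y - x) *\<^sub>R a x) \<le> norm (c * (1 + (norm (a x))\<^sup>2))" by simp
  qed
  have comp: "(\<integral>x. F x \<partial>\<mu>) $ i = (\<integral>x. F x $ i \<partial>\<mu>)" if "integrable \<mu> F" for F :: "real^'n \<Rightarrow> real^'n"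
    using integral_bounded_linear[OF bounded_linear_vec_nth that] by simp
  note I = integrable_kernel(1,2)[OF t, of y]
  have "(\<integral>x. gk t (y - x) *\<^sub>R a x \<partial>\<mu>) $ i = (LBINT x. dens x * (gk t (y - x) * a x $ i))"
    using comp[OF iL] by (simp add: mu_integral)
  also have "\<dots> = (LBINT x. ?v * (?\<psi> x * (2 * Re (cnj (f x) * G x $ i))))"
  proof -
    have "dens x * (gk t (y - x) * a x $ i) = ?v * (?\<psi> x * (2 * Re (cnj (f x) * G x $ i)))" for x
      using dens_a[of x i] by (simp add: mult.left_commute[of "dens x"])
    then show ?thesis by simp
  qed
  also have "\<dots> = - (?v * (LBINT x. ?\<psi>' x $ i * (cmod (f x))\<^sup>2))"
    unfolding GM(1) by simp
  also have "\<dots> = (LBINT x. - (?v * (?\<psi>' x $ i * (cmod (f x))\<^sup>2)))" by simp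
  also have "\<dots> = (LBINT x. dens x * (gk t (y - x) * y $ i - ((?v + t) / t) * (gk t (y - x) *\<^sub>R (y - x)) $ i))"
  proof -
    \<comment> \<open>In essence \<open>X - (v / t) (Y - X) = Y - ((v + t) / t) (Y - X)\<close>;
      \<open>p\<close>, \<open>q\<close> and \<open>r\<close> stand for the two kernels and
      \<open>|f|^2\<close>.\<close>
    have "- (?v * (p * q * ((1 / t) * (Y - X) - (1 / ?v) * X) * r)) = r * q * (p * Y - ((?v + t) / t) * (p * (Y - X)))"
      for p q r X Y :: real
    proof -
      have "?v * ((1 / t) * (Y - X) - (1 / ?v) * X) = (?v / t) * (Y - X) - X"
        by (simp only: right_diff_distrib mult.assoc[symmetric]) simp
      moreover have "((?v + t) / t) * (Y - X) = (?v / t) * (Y - X) + (Y - X)"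
        using t by (simp add: add_divide_distrib distrib_right)
      ultimately have "- (?v * ((1 / t) * (Y - X) - (1 / ?v) * X)) = Y - ((?v + t) / t) * (Y - X)" by simp
      moreover have "- (w * (p * q * A * r)) = r * q * (p * Y - c * (p * Z))" if "- (w * A) = Y - c * Z" for w A c Z :: real
      proof -
        have "- (w * (p * q * A * r)) = p * q * r * (- (w * A))" by simp
        also have "\<dots> = r * q * (p * Y - c * (p * Z))" unfolding that by (simp add: algebra_simps)
        finally show ?thesis .
      qed
      ultimately show ?thesis by blast
    qed
    from this[of "gk t (y - x)" "gk ?v x" "y $ i" "x $ i" "(cmod (f x))\<^sup>2" for x]
    show ?thesis by (simp add: dens_def)
  qed
  also have "\<dots> = (\<integral>x. gk t (y - x) * y $ i - ((?v + t) / t) * (gk t (y - x) *\<^sub>R (y - x)) $ i \<partial>\<mu>)"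
    by (simp add: mu_integral)
  also have "\<dots> = h t y * y $ i - ((?v + t) / t) * (m t y $ i)"
    unfolding h_def m_def comp[OF I(2)]
    using I(1) integrable_bounded_linear[OF bounded_linear_vec_nth I(2), of i] by simp
  finally show "(\<integral>x. gk t (y - x) *\<^sub>R a x \<partial>\<mu>) $ i = (h t y *\<^sub>R y - ((?v + t) / t) *\<^sub>R m t y) $ i" by simp
qed

sublocale gaussian_score \<mu> gauss_v a
proof unfold_locales
  show "integrable \<mu> (\<lambda>x. (norm (a x))\<^sup>2)" using integrable_a2 by (simp add: mu_integral)
qed (use smoothed_score in simp_all)

lemma A2_le: "A2 \<le> (2 * gauss_v)\<^sup>2 * D"
proof -
  have "A2 = (LBINT x. dens x * (norm (a x))\<^sup>2)" unfolding A2_def by (simp add: mu_integral)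
  also have "\<dots> \<le> (LBINT x. (2 * gauss_v)\<^sup>2 * ((norm (G x))\<^sup>2 * gk gauss_v x))"
    by (intro integral_mono integrable_a2 integrable_mult_right G2_lborel a2_le)
  also have "\<dots> = (2 * gauss_v)\<^sup>2 * D" unfolding D_def by (simp add: integrable_gauss_m mult.commute)
  finally show ?thesis .
qed

text \<open>\<open>gradient_modulus2\<close> for \<open>gk v\<close>, whose gradient is
  \<open>- x / v\<close> times itself: the mean of \<open>a\<close> under \<open>\<mu>\<close> is
  the mean of \<open>x |f|^2\<close> under \<open>dm\<close>.\<close>

lemma mean_a:
  assumes cen: "(\<integral>x. (cmod (f x))\<^sup>2 *\<^sub>R x \<partial>gauss_m) = 0"
  shows "(\<integral>x. a x \<partial>\<mu>) = 0"
proof (rule vec_eq_iff[THEN iffD2], rule allI)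
  fix i
  let ?v = gauss_v
  have v: "?v > 0" by simp
  let ?\<psi>' = "\<lambda>x. (- (gk ?v x / ?v)) *\<^sub>R x"
  have b1: "\<bar>gk ?v x\<bar> \<le> (1 + 1 / ?v) * gk ?v x" for x :: "real^'n" using v by (simp add: distrib_right)
  have b2: "\<bar>?\<psi>' x $ i\<bar> \<le> (1 + 1 / ?v) * ((1 + (norm x)\<^sup>2) * gk ?v x)" for x :: "real^'n"
  proof -
    have "\<bar>x $ i\<bar> \<le> 1 + (norm x)\<^sup>2" by (rule order_trans[OF component_le_norm_cart norm_le_one_plus_power2])
    then have "(1 / ?v) * (\<bar>x $ i\<bar> * gk ?v x) \<le> (1 + 1 / ?v) * ((1 + (norm x)\<^sup>2) * gk ?v x)"
      by (intro mult_mono mult_right_mono) auto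
    then show ?thesis by (simp add: abs_mult ac_simps)
  qed
  have cont: "continuous_on UNIV ?\<psi>'" using v by (intro continuous_intros) auto
  note GM = gradient_modulus2[OF mom has_derivative_gk[OF v] cont b1 b2]
  have i2: "integrable gauss_m (\<lambda>x. (cmod (f x))\<^sup>2 *\<^sub>R x)"
  proof (rule Bochner_Integration.integrable_bound)
    show "integrable gauss_m (\<lambda>x. (cmod (f x))\<^sup>2 + (norm x)\<^sup>2 * (cmod (f x))\<^sup>2)"
      by (intro Bochner_Integration.integrable_add f2 mom)
    have "norm ((cmod (f x))\<^sup>2 *\<^sub>R x) \<le> norm ((cmod (f x))\<^sup>2 + (norm x)\<^sup>2 * (cmod (f x))\<^sup>2)" for x
      using mult_left_mono[OF norm_le_one_plus_power2[of x], of "(cmod (f x))\<^sup>2"] by (simp add: algebra_simps)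
    then show "AE x in gauss_m. norm ((cmod (f x))\<^sup>2 *\<^sub>R x) \<le> norm ((cmod (f x))\<^sup>2 + (norm x)\<^sup>2 * (cmod (f x))\<^sup>2)" by simp
  qed measurable
  have "(\<integral>x. a x \<partial>\<mu>) $ i = (\<integral>x. a x $ i \<partial>\<mu>)"
    using integral_bounded_linear[OF bounded_linear_vec_nth integrable_a] by simp
  also have "\<dots> = (LBINT x. ?v * (gk ?v x * (2 * Re (cnj (f x) * G x $ i))))"
    by (simp add: mu_integral dens_a)
  also have "\<dots> = - (?v * (LBINT x. (- (gk ?v x / ?v) *\<^sub>R x) $ i * (cmod (f x))\<^sup>2))"
    unfolding GM(1) by simp
  also have "\<dots> = (LBINT x. gk ?v x * ((cmod (f x))\<^sup>2 *\<^sub>R x) $ i)"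
  proof -
    have "- (?v * ((- (gk ?v x / ?v) *\<^sub>R x) $ i * (cmod (f x))\<^sup>2)) = gk ?v x * ((cmod (f x))\<^sup>2 *\<^sub>R x) $ i" for x
      by simp
    then show ?thesis
      unfolding integral_mult_right_zero[symmetric] Bochner_Integration.integral_minus[symmetric] by (simp only:)
  qed
  also have "\<dots> = (\<integral>x. ((cmod (f x))\<^sup>2 *\<^sub>R x) $ i \<partial>gauss_m)"
    by (simp add: integrable_gauss_m)
  also have "\<dots> = (\<integral>x. (cmod (f x))\<^sup>2 *\<^sub>R x \<partial>gauss_m) $ i"
    using integral_bounded_linear[OF bounded_linear_vec_nth i2] by simp
  finally show "(\<integral>x. a x \<partial>\<mu>) $ i = 0 $ i" by (simp add: cen)
qed

end

section \<open>The logarithmic Sobolev inequality with remainder, and its consequences for the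
  Dirichlet integral\<close>

context normalized_weakly_differentiable
begin

text \<open>A bounded substitute for \<open>ln |f|^2\<close>, admissible in the dual inequality.
  Zeros of \<open>f\<close> are treated separately because \<open>ln 0\<close> is 0 by convention,
  and the value 0 there would spoil \<open>exp_trunc_log_le\<close>.\<close>

definition trunc_log :: "nat \<Rightarrow> real ^ 'n \<Rightarrow> real" where
  "trunc_log N x = (if f x = 0 then - real N else max (- real N) (min (real N) (ln ((cmod (f x))\<^sup>2))))"

lemma trunc_log_measurable [measurable]: "trunc_log N \<in> borel_measurable borel"
  unfolding trunc_log_def[abs_def] by measurable

lemma trunc_log_bounded: "\<bar>trunc_log N x\<bar> \<le> real N"
  by (auto simp: trunc_log_def)

lemma exp_trunc_log_le: "exp (trunc_log N x) \<le> (cmod (f x))\<^sup>2 + exp (- real N)"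
proof (cases "f x = 0")
  case False
  then have c: "(cmod (f x))\<^sup>2 > 0" by simp
  have "exp (trunc_log N x) \<le> exp (max (- real N) (ln ((cmod (f x))\<^sup>2)))"
    using False by (auto simp: trunc_log_def)
  also have "\<dots> \<le> (cmod (f x))\<^sup>2 + exp (- real N)"
    using c by (auto simp: max_def)
  finally show ?thesis .
qed (simp add: trunc_log_def)

text \<open>Truncation lifts the exponential above \<open>|f|^2\<close> by at most
  \<open>exp (- N)\<close>, so the normalizing integral is at most \<open>1 + exp (- N)\<close>, and
  its logarithm costs nothing in the limit.\<close>

lemma ln_exp_trunc_log: "ln (LBINT y. exp (trunc_log N y) * gk gauss_v y) \<le> exp (- real N)"
proof -
  let ?Z = "\<integral>y. exp (trunc_log N y) * gk gauss_v y \<partial>lborel"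
  have v: "gauss_v > 0" by simp
  have bd: "exp (- real N) \<le> exp (trunc_log N y)" "exp (trunc_log N y) \<le> exp (real N)" for y
    using trunc_log_bounded[of N y] by auto
  have iZ: "integrable lborel (\<lambda>y::real^'n. exp (trunc_log N y) * gk gauss_v y)"
    by (rule Bochner_Integration.integrable_bound[OF integrable_mult_right[OF integrable_gk[OF v], of "exp (real N)"]])
      (auto intro!: mult_right_mono bd simp del: exp_le_cancel_iff)
  have "exp (- real N) = (LBINT y. exp (- real N) * gk gauss_v (y::real^'n))" by simp
  also have "\<dots> \<le> ?Z"
    by (intro integral_mono iZ integrable_mult_right integrable_gk v mult_right_mono bd) simp
  finally have Z: "?Z > 0" using less_le_trans[OF exp_gt_zero] by blast
  have "?Z \<le> (LBINT y. (cmod (f y))\<^sup>2 * gk gauss_v y + exp (- real N) * gk gauss_v y)"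
  proof (rule integral_mono[OF iZ])
    show "integrable lborel (\<lambda>y. (cmod (f y))\<^sup>2 * gk gauss_v y + exp (- real N) * gk gauss_v y)"
      by (intro Bochner_Integration.integrable_add f2_lborel integrable_mult_right integrable_gk v)
    show "exp (trunc_log N y) * gk gauss_v y \<le> (cmod (f y))\<^sup>2 * gk gauss_v y + exp (- real N) * gk gauss_v y" for y
      using mult_right_mono[OF exp_trunc_log_le[of N y] gk_nonneg[of gauss_v y]] by (simp add: distrib_right)
  qed
  also have "\<dots> = 1 + exp (- real N)"
  proof -
    have "(LBINT y. (cmod (f y))\<^sup>2 * gk gauss_v y) = 1"
      using norm1 by (simp add: integrable_gauss_m mult.commute)
    then show ?thesis using f2_lborel integrable_gk[OF v, where 'a = "real^'n"] by simp
  qed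
  finally have "ln ?Z \<le> ln (1 + exp (- real N))" using Z by (intro ln_mono) (auto intro: add_pos_pos)
  also have "\<dots> \<le> exp (- real N)" by (rule ln_add_one_self_le_self) simp
  finally show ?thesis .
qed

text \<open>The time \<open>r\<close> is chosen before \<open>N\<close>, so one and the same gap
  survives when the truncation is removed.\<close>

lemma trunc_log_integral_le:
  obtains r where "1 < r" "r < 2"
    "\<And>N. (\<integral>x. (cmod (f x))\<^sup>2 * trunc_log N x \<partial>gauss_m) + gap r / (2 * (gauss_v + r)\<^sup>2)
      \<le> A2 / (2 * gauss_v) + exp (- real N)"
proof -
  obtain r where r: "1 < r" "r < 2"
    "\<And>\<psi> N. \<psi> \<in> borel_measurable borel \<Longrightarrow> (\<And>x. \<bar>\<psi> x\<bar> \<le> N) \<Longrightarrow>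
      (\<integral>x. \<psi> x \<partial>\<mu>) - ln (LBINT y. exp (\<psi> y) * gk gauss_v y) + gap r / (2 * (gauss_v + r)\<^sup>2) \<le> A2 / (2 * gauss_v)"
    by (rule dual_lsi_with_gap[OF dens_measurable dens_nonneg \<mu>_def]) (rule that; blast)
  show ?thesis
  proof (rule that[OF r(1,2)])
    show "(\<integral>x. (cmod (f x))\<^sup>2 * trunc_log N x \<partial>gauss_m) + gap r / (2 * (gauss_v + r)\<^sup>2)
      \<le> A2 / (2 * gauss_v) + exp (- real N)" for N
      using r(3)[OF trunc_log_measurable[of N] trunc_log_bounded[of N]] ln_exp_trunc_log[of N] by (simp add: mu_gauss)
  qed
qed

lemma integrable_trunc_log: "integrable gauss_m (\<lambda>x. (cmod (f x))\<^sup>2 * trunc_log N x)"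
  using integrable_bounded[of "trunc_log N" "real N"] trunc_log_bounded by (simp add: mu_gauss)

text \<open>Rests on \<open>t ln t \<ge> 2 (t - \<surd>t)\<close>; the test function of the dual inequality is the truncated
  logarithm of the density.\<close>

lemma hellinger_le: "(\<integral>x. (cmod (f x) - 1)\<^sup>2 \<partial>gauss_m) \<le> 2 * gauss_v * D"
proof -
  interpret g: prob_space "gauss_m :: (real^'n) measure" by (rule prob_space_gauss_m)
  have if1: "integrable gauss_m (\<lambda>x. cmod (f x))"
    by (rule integrable_norm[OF integrable_gauss_m_square]) (use f2 in auto)
  obtain r where r: "1 < r" "r < 2"
    "\<And>N. (\<integral>x. (cmod (f x))\<^sup>2 * trunc_log N x \<partial>gauss_m) + gap r / (2 * (gauss_v + r)\<^sup>2)
      \<le> A2 / (2 * gauss_v) + exp (- real N)"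
    by (rule trunc_log_integral_le) (rule that; blast)
  have gp: "0 \<le> gap r / (2 * (gauss_v + r)\<^sup>2)" using gap_nonneg[of r] by simp
  have "(\<integral>x. (cmod (f x) - 1)\<^sup>2 \<partial>gauss_m) \<le> A2 / (2 * gauss_v) + exp (- real N)" if N: "N \<ge> 2" for N
  proof -
    have pw: "2 * (cmod (f x))\<^sup>2 - 2 * cmod (f x) \<le> (cmod (f x))\<^sup>2 * trunc_log N x" for x
    proof (cases "f x = 0")
      case False
      let ?c = "cmod (f x)"
      have c: "?c > 0" using False by simp
      have "ln (1 / ?c) \<le> 1 / ?c - 1" using c by (intro ln_le_minus_one) simp
      then have l: "1 - 1 / ?c \<le> ln ?c" using c by (simp add: ln_div)
      have "2 * (1 - 1 / ?c) \<le> trunc_log N x"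
      proof -
        have "ln (?c\<^sup>2) = 2 * ln ?c" using c by (simp add: ln_realpow)
        then have b1: "2 * (1 - 1 / ?c) \<le> ln (?c\<^sup>2)" using l by (simp only: mult_left_mono zero_le_numeral)
        \<comment> \<open>Here \<open>N \<ge> 2\<close> matters: the lower bound for the logarithm
          never exceeds 2, so cutting the logarithm at \<open>N\<close> from above preserves it, and
          cutting from below only raises the logarithm.\<close>
        have "2 * (1 - 1 / ?c) \<le> 2" using c by simp
        moreover have "2 \<le> real N" using N by simp
        ultimately have b2: "2 * (1 - 1 / ?c) \<le> real N" by (rule order_trans)
        show ?thesis using False unfolding trunc_log_def
          by (simp only: if_False) (intro max.coboundedI2 min.boundedI b1 b2)
      qed
      then have "?c\<^sup>2 * (2 * (1 - 1 / ?c)) \<le> ?c\<^sup>2 * trunc_log N x" by (intro mult_left_mono) auto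
      moreover have "?c\<^sup>2 * (2 * (1 - 1 / ?c)) = 2 * ?c\<^sup>2 - 2 * ?c"
        using c by (simp add: field_simps power2_eq_square)
      ultimately show ?thesis by simp
    qed simp
    have "(\<integral>x. (cmod (f x) - 1)\<^sup>2 \<partial>gauss_m) = (\<integral>x. (cmod (f x))\<^sup>2 + 1 - 2 * cmod (f x) \<partial>gauss_m)"
      by (simp add: power2_diff)
    also have "\<dots> = 2 - 2 * (\<integral>x. cmod (f x) \<partial>gauss_m)"
      using f2 if1 norm1 g.prob_space by simp
    also have "\<dots> = (\<integral>x. 2 * (cmod (f x))\<^sup>2 - 2 * cmod (f x) \<partial>gauss_m)"
      using f2 if1 norm1 by simp
    also have "\<dots> \<le> (\<integral>x. (cmod (f x))\<^sup>2 * trunc_log N x \<partial>gauss_m)"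
      using f2 if1 by (intro integral_mono pw integrable_trunc_log) auto
    also have "\<dots> \<le> A2 / (2 * gauss_v) + exp (- real N)" using r(3)[of N] gp by linarith
    finally show ?thesis .
  qed
  then have ev: "eventually (\<lambda>N. (\<integral>x. (cmod (f x) - 1)\<^sup>2 \<partial>gauss_m) \<le> A2 / (2 * gauss_v) + exp (- real N)) sequentially"
    by (auto simp: eventually_sequentially)
  have "(\<lambda>N. exp (- real N)) \<longlonglongrightarrow> 0"
    by (intro filterlim_compose[OF exp_at_bot] filterlim_compose[OF filterlim_uminus_at_bot_at_top] filterlim_real_sequentially)
  then have "(\<lambda>N. A2 / (2 * gauss_v) + exp (- real N)) \<longlonglongrightarrow> A2 / (2 * gauss_v) + 0" by (intro tendsto_intros)
  from tendsto_lowerbound[OF this ev] have "(\<integral>x. (cmod (f x) - 1)\<^sup>2 \<partial>gauss_m) \<le> A2 / (2 * gauss_v)" by simp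
  also have "\<dots> \<le> ((2 * gauss_v)\<^sup>2 * D) / (2 * gauss_v)" by (intro divide_right_mono A2_le) simp
  also have "\<dots> = 2 * gauss_v * D" by (simp add: power2_eq_square)
  finally show ?thesis .
qed

text \<open>The truncation is removed by dominated convergence with the modulus of the entropy
  integrand as majorant; at zeros of \<open>f\<close> both integrands are 0.\<close>

lemma entropy_gap_le:
  assumes ent: "integrable gauss_m (\<lambda>x. (cmod (f x))\<^sup>2 * ln ((cmod (f x))\<^sup>2))"
  obtains r where "1 < r" "r < 2"
    "(\<integral>x. (cmod (f x))\<^sup>2 * ln ((cmod (f x))\<^sup>2) \<partial>gauss_m) + gap r / (2 * (gauss_v + r)\<^sup>2) \<le> A2 / (2 * gauss_v)"
proof -
  obtain r where r: "1 < r" "r < 2"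
    "\<And>N. (\<integral>x. (cmod (f x))\<^sup>2 * trunc_log N x \<partial>gauss_m) + gap r / (2 * (gauss_v + r)\<^sup>2)
      \<le> A2 / (2 * gauss_v) + exp (- real N)"
    by (rule trunc_log_integral_le) (rule that; blast)
  have l0: "(\<lambda>N. exp (- real N)) \<longlonglongrightarrow> 0"
    by (intro filterlim_compose[OF exp_at_bot] filterlim_compose[OF filterlim_uminus_at_bot_at_top] filterlim_real_sequentially)
  have l1: "(\<lambda>N. \<integral>x. (cmod (f x))\<^sup>2 * trunc_log N x \<partial>gauss_m) \<longlonglongrightarrow> (\<integral>x. (cmod (f x))\<^sup>2 * ln ((cmod (f x))\<^sup>2) \<partial>gauss_m)"
  proof (rule integral_dominated_convergence[OF _ _ integrable_abs[OF ent]])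
    show "AE x in gauss_m. (\<lambda>N. (cmod (f x))\<^sup>2 * trunc_log N x) \<longlonglongrightarrow> (cmod (f x))\<^sup>2 * ln ((cmod (f x))\<^sup>2)"
    proof (intro AE_I2)
      fix x
      obtain K :: nat where K: "\<bar>ln ((cmod (f x))\<^sup>2)\<bar> \<le> real K" using real_arch_simple by blast
      have "eventually (\<lambda>N. (cmod (f x))\<^sup>2 * trunc_log N x = (cmod (f x))\<^sup>2 * ln ((cmod (f x))\<^sup>2)) sequentially"
        unfolding eventually_sequentially
      proof (intro exI[of _ K] allI impI)
        fix N assume "N \<ge> K"
        then have "\<bar>ln ((cmod (f x))\<^sup>2)\<bar> \<le> real N" using K by linarith
        then show "(cmod (f x))\<^sup>2 * trunc_log N x = (cmod (f x))\<^sup>2 * ln ((cmod (f x))\<^sup>2)"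
          by (auto simp: trunc_log_def max_def min_def)
      qed
      then show "(\<lambda>N. (cmod (f x))\<^sup>2 * trunc_log N x) \<longlonglongrightarrow> (cmod (f x))\<^sup>2 * ln ((cmod (f x))\<^sup>2)"
        by (rule tendsto_eventually)
    qed
    show "AE x in gauss_m. norm ((cmod (f x))\<^sup>2 * trunc_log N x) \<le> \<bar>(cmod (f x))\<^sup>2 * ln ((cmod (f x))\<^sup>2)\<bar>" for N
    proof (intro AE_I2)
      fix x
      show "norm ((cmod (f x))\<^sup>2 * trunc_log N x) \<le> \<bar>(cmod (f x))\<^sup>2 * ln ((cmod (f x))\<^sup>2)\<bar>"
      proof (cases "f x = 0")
        case False
        then have "\<bar>trunc_log N x\<bar> \<le> \<bar>ln ((cmod (f x))\<^sup>2)\<bar>"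
          unfolding trunc_log_def by (auto simp: max_def min_def)
        then show ?thesis unfolding real_norm_def abs_mult by (intro mult_left_mono) auto
      qed simp
    qed
  qed measurable
  have "(\<integral>x. (cmod (f x))\<^sup>2 * ln ((cmod (f x))\<^sup>2) \<partial>gauss_m) + gap r / (2 * (gauss_v + r)\<^sup>2) \<le> A2 / (2 * gauss_v) + 0"
    using r(3) by (intro LIMSEQ_le[OF tendsto_add[OF l1 tendsto_const] tendsto_add[OF tendsto_const l0]]) auto
  then show ?thesis using that[OF r(1,2)] by simp
qed

text \<open>\<open>\<delta>\<close> is the deficit and \<open>B\<close> bounds fourth moments; the second summand on the right is small for
  large \<open>R\<close>, the first one for small \<open>\<delta>\<close> and fixed \<open>R\<close>.\<close>

lemma dirichlet_le:
  assumes ent: "integrable gauss_m (\<lambda>x. (cmod (f x))\<^sup>2 * ln ((cmod (f x))\<^sup>2))"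
    and cen: "(\<integral>x. (cmod (f x))\<^sup>2 *\<^sub>R x \<partial>gauss_m) = 0"
    and m4: "integrable gauss_m (\<lambda>x. (cmod (f x))\<^sup>2 * (1 + (norm x)\<^sup>2)\<^sup>2)"
      "(\<integral>x. (cmod (f x))\<^sup>2 * (1 + (norm x)\<^sup>2)\<^sup>2 \<partial>gauss_m) \<le> B"
    and R: "R \<ge> 0"
  defines "\<delta> \<equiv> 2 * gauss_v * D - (\<integral>x. (cmod (f x))\<^sup>2 * ln ((cmod (f x))\<^sup>2) \<partial>gauss_m)"
    and "\<kappa> \<equiv> (4 * pi) powr (- (real CARD('n) / 2)) * exp (- ((R + 1)\<^sup>2 / 2))"
    and "V \<equiv> measure lborel (cball (0::real^'n) 1)"
  shows "2 * gauss_v * D \<le> (1 + 18 * (1 / (\<kappa> * V) + 4) / (2 * gauss_v)) * \<delta>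
      + 4 * (18 + 16 * B) * (2 + 2 * real CARD('n)) * (B / (1 + R\<^sup>2)) / (2 * gauss_v)"
proof -
  let ?v = gauss_v
  have v: "0 < ?v" "?v \<le> 1" using pi_gt3 by auto
  obtain r where r: "1 < r" "r < 2"
    "(\<integral>x. (cmod (f x))\<^sup>2 * ln ((cmod (f x))\<^sup>2) \<partial>gauss_m) + gap r / (2 * (?v + r)\<^sup>2) \<le> A2 / (2 * ?v)"
    by (rule entropy_gap_le[OF ent])
  have A2D: "A2 / (2 * ?v) \<le> 2 * ?v * D"
  proof -
    have "A2 / (2 * ?v) \<le> ((2 * ?v)\<^sup>2 * D) / (2 * ?v)" by (intro divide_right_mono A2_le) simp
    also have "\<dots> = 2 * ?v * D" by (simp add: power2_eq_square)
    finally show ?thesis .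
  qed
  \<comment> \<open>\<open>v \<le> 1\<close> and \<open>r < 2\<close> bound
    \<open>2 (v + r)^2\<close> by 18.\<close>
  have gap: "gap r \<le> 18 * \<delta>"
  proof -
    have "gap r / (2 * (?v + r)\<^sup>2) \<le> \<delta>" unfolding \<delta>_def using r(3) A2D by linarith
    moreover have "gap r / 18 \<le> gap r / (2 * (?v + r)\<^sup>2)"
    proof (rule divide_left_mono)
      have "(?v + r)\<^sup>2 \<le> 3\<^sup>2" by (rule power_mono) (use v r in linarith)+
      then show "2 * (?v + r)\<^sup>2 \<le> 18" by simp
      have "0 < ?v + r" using v r by linarith
      then show "0 < 18 * (2 * (?v + r)\<^sup>2)" by (simp only: zero_less_mult_iff zero_less_power) simp
    qed (rule gap_nonneg)
    ultimately show ?thesis by simp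
  qed
  have \<mu>4: "integrable \<mu> (\<lambda>x. (1 + (norm x)\<^sup>2)\<^sup>2)" "(\<integral>x. (1 + (norm x)\<^sup>2)\<^sup>2 \<partial>\<mu>) \<le> B"
    using m4 by (simp_all add: mu_gauss)
  have m2B: "m2 \<le> B"
  proof -
    have "m2 \<le> (\<integral>x. (1 + (norm x)\<^sup>2)\<^sup>2 \<partial>\<mu>)" unfolding m2_def
    proof (intro integral_mono moment2 \<mu>4)
      show "(norm x)\<^sup>2 \<le> (1 + (norm x)\<^sup>2)\<^sup>2" for x :: "real^'n"
        using mult_left_mono[of 1 "1 + (norm x)\<^sup>2" "1 + (norm x)\<^sup>2"] by (simp add: power2_eq_square)
    qed
    then show ?thesis using \<mu>4(2) by simp
  qed
  have B0: "B \<ge> 0" using m2B m2_nonneg by simp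
  let ?T = "\<integral>x. indicator (- cball 0 R) x * (1 + (norm x)\<^sup>2) \<partial>\<mu>"
  have R0: "1 + R\<^sup>2 > 0" by (simp add: add_pos_nonneg)
  have T: "?T \<le> B / (1 + R\<^sup>2)"
  proof -
    have i: "integrable \<mu> (\<lambda>x. (1 + (norm x)\<^sup>2)\<^sup>2 / (1 + R\<^sup>2))" using \<mu>4(1) by simp
    \<comment> \<open>Markov's inequality with one more factor \<open>1 + |x|^2\<close>, which
      exceeds \<open>1 + R^2\<close> outside the ball.\<close>
    have pw: "indicator (- cball 0 R) x * (1 + (norm x)\<^sup>2) \<le> (1 + (norm x)\<^sup>2)\<^sup>2 / (1 + R\<^sup>2)" for x :: "real^'n"
    proof (cases "x \<in> cball 0 R")
      case False
      then have "R\<^sup>2 \<le> (norm x)\<^sup>2" using R by (intro power_mono) auto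
      then have "(1 + R\<^sup>2) * (1 + (norm x)\<^sup>2) \<le> (1 + (norm x)\<^sup>2) * (1 + (norm x)\<^sup>2)" by (intro mult_right_mono) auto
      then show ?thesis using False R0 by (simp add: power2_eq_square[of "1 + (norm x)\<^sup>2"] pos_le_divide_eq mult.commute)
    qed (use R0 in simp)
    have "?T \<le> (\<integral>x. (1 + (norm x)\<^sup>2)\<^sup>2 / (1 + R\<^sup>2) \<partial>\<mu>)"
    proof (rule integral_mono[OF _ i pw])
      have "integrable \<mu> (\<lambda>x. 1 + (norm x)\<^sup>2)" using moment2 by simp
      then show "integrable \<mu> (\<lambda>x. indicator (- cball 0 R) x * (1 + (norm x)\<^sup>2))"
        by (rule Bochner_Integration.integrable_bound) (auto simp: indicator_def)
    qed
    also have "\<dots> \<le> B / (1 + R\<^sup>2)" using \<mu>4(2) R0 by (simp add: divide_right_mono)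
    finally show ?thesis .
  qed
  have \<kappa>V: "0 \<le> 1 / (\<kappa> * V) + 4" unfolding \<kappa>_def V_def by simp
  have "A2 \<le> (1 / (\<kappa> * V) + 4) * gap r + 4 * (2 + 4 * (1 + ?v)\<^sup>2 * (1 + m2)) * (2 + 2 * real CARD('n)) * ?T"
    using A2_le_gap[OF mean_a[OF cen] less_imp_le[OF r(1)] less_imp_le[OF r(2)] R] unfolding \<kappa>_def V_def by simp
  also have "\<dots> \<le> (1 / (\<kappa> * V) + 4) * (18 * \<delta>) + 4 * (18 + 16 * B) * (2 + 2 * real CARD('n)) * (B / (1 + R\<^sup>2))"
  proof (rule add_mono[OF mult_left_mono[OF gap \<kappa>V]])
    \<comment> \<open>With \<open>v \<le> 1\<close> and \<open>m2 \<le> B\<close>, the constant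
      \<open>2 + 4 (1 + v)^2 (1 + m2)\<close> of \<open>A2_le_gap\<close> is at most
      \<open>18 + 16 B\<close>.\<close>
    have "(1 + ?v)\<^sup>2 \<le> 2\<^sup>2" by (rule power_mono) (use v in linarith)+
    then have "4 * (1 + ?v)\<^sup>2 * (1 + m2) \<le> 4 * 2\<^sup>2 * (1 + B)" using m2B m2_nonneg by (intro mult_mono) auto
    then have "2 + 4 * (1 + ?v)\<^sup>2 * (1 + m2) \<le> 18 + 16 * B" by simp
    then show "4 * (2 + 4 * (1 + ?v)\<^sup>2 * (1 + m2)) * (2 + 2 * real CARD('n)) * ?T
      \<le> 4 * (18 + 16 * B) * (2 + 2 * real CARD('n)) * (B / (1 + R\<^sup>2))"
      using B0 m2_nonneg by (intro mult_mono T) (auto intro!: integral_nonneg_AE AE_I2)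
  qed
  finally have A: "A2 / (2 * ?v) \<le> ((1 / (\<kappa> * V) + 4) * (18 * \<delta>) + 4 * (18 + 16 * B) * (2 + 2 * real CARD('n)) * (B / (1 + R\<^sup>2))) / (2 * ?v)"
    using v by (intro divide_right_mono) auto
  have "0 \<le> gap r / (2 * (?v + r)\<^sup>2)" using gap_nonneg[of r] by simp
  \<comment> \<open>The entropy is at most \<open>A2 / (2 v)\<close>, so the part of the Dirichlet
    integral that \<open>a\<close> does not see, such as the turning of the phase, is at most
    \<open>\<delta>\<close>.\<close>
  then have "2 * ?v * D \<le> \<delta> + A2 / (2 * ?v)" unfolding \<delta>_def using r(3) by linarith
  then have "2 * ?v * D \<le> \<delta> + ((1 / (\<kappa> * V) + 4) * (18 * \<delta>) + 4 * (18 + 16 * B) * (2 + 2 * real CARD('n)) * (B / (1 + R\<^sup>2))) / (2 * ?v)"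
    using A by linarith
  also have "\<dots> = (1 + 18 * (1 / (\<kappa> * V) + 4) / (2 * ?v)) * \<delta>
      + 4 * (18 + 16 * B) * (2 + 2 * real CARD('n)) * (B / (1 + R\<^sup>2)) / (2 * ?v)"
  proof -
    have "d + (k * (18 * d) + c) / w = (1 + 18 * k / w) * d + c / w" for d k c w :: real
      by (simp add: add_divide_distrib distrib_right)
    then show ?thesis .
  qed
  finally show ?thesis .
qed

end

section \<open>The Poincare inequality through shifts by large constants\<close>

lemma sqrt_quadratic_tendsto:
  fixes p q :: real
  shows "(\<lambda>n. sqrt (q + 2 * real n * p + (real n)\<^sup>2) - real n) \<longlonglongrightarrow> p"
proof -
  have i: "(\<lambda>n. 1 / real n) \<longlonglongrightarrow> 0" by (rule lim_1_over_n)
  \<comment> \<open>The square root after division by \<open>n\<close>; the difference is then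
    rationalized to \<open>(q / n + 2 p) / (?s n + 1)\<close>.\<close>
  let ?s = "\<lambda>n. sqrt (q * (1 / real n)\<^sup>2 + 2 * p * (1 / real n) + 1)"
  have s: "?s \<longlonglongrightarrow> 1"
  proof -
    have "?s \<longlonglongrightarrow> sqrt (q * 0\<^sup>2 + 2 * p * 0 + 1)" by (intro tendsto_intros i)
    then show ?thesis by simp
  qed
  have "(\<lambda>n. (q * (1 / real n) + 2 * p) / (?s n + 1)) \<longlonglongrightarrow> (q * 0 + 2 * p) / (1 + 1)"
    by (intro tendsto_intros i s) auto
  moreover have "eventually (\<lambda>n. (q * (1 / real n) + 2 * p) / (?s n + 1) = sqrt (q + 2 * real n * p + (real n)\<^sup>2) - real n) sequentially"
    using eventually_gt_at_top[of 0] order_tendstoD(1)[OF s zero_less_one]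
  proof eventually_elim
    case (elim n)
    let ?t = "q * (1 / real n)\<^sup>2 + 2 * p * (1 / real n) + 1"
    have n: "real n > 0" using elim by simp
    have t: "?t > 0" using elim(2) by (simp only: real_sqrt_gt_0_iff)
    have e: "q + 2 * real n * p + (real n)\<^sup>2 = (real n)\<^sup>2 * ?t"
      using n by (simp add: power2_eq_square field_simps)
    have "sqrt (q + 2 * real n * p + (real n)\<^sup>2) = real n * ?s n"
      unfolding e real_sqrt_mult using n by simp
    moreover have "(q * (1 / real n) + 2 * p) = (real n * ?s n - real n) * (?s n + 1)"
    proof -
      have "(real n * ?s n - real n) * (?s n + 1) = real n * ((?s n)\<^sup>2 - 1)"
        by (simp only: power2_eq_square) (simp add: algebra_simps)
      also have "(?s n)\<^sup>2 = ?t" using t by simp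
      finally show ?thesis using n by (simp add: power2_eq_square field_simps)
    qed
    moreover have "?s n + 1 \<noteq> 0" using elim(2) by linarith
    ultimately show ?case by (metis nonzero_mult_div_cancel_right)
  qed
  ultimately show ?thesis using tendsto_cong by force
qed

text \<open>Constants have weak gradient 0; consequently \<open>f\<close> and \<open>f + d\<close>
  share their weak gradient.\<close>

lemma integral_test_gradient:
  assumes \<phi>: "test_function \<phi> \<phi>'"
  shows "(LBINT x. \<phi>' x $ i) = 0"
    and "integrable lborel (\<lambda>x. \<phi>' x $ i)"
proof -
  obtain r where r: "r > 0" "\<And>x. norm x > r \<Longrightarrow> \<phi> x = 0" "\<And>x. norm x > r \<Longrightarrow> \<phi>' x = 0"
    using test_functionD[OF \<phi>] by metis
  obtain c where c: "c > 0" "\<And>x. \<bar>\<phi> x\<bar> \<le> c" "\<And>x. norm (\<phi>' x) \<le> c"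
    using test_function_bounded[OF \<phi>] by metis
  note [measurable] = test_function_measurable[OF \<phi>]
  have int: "integrable lborel k" if [measurable]: "k \<in> borel_measurable borel" and b: "\<And>x. \<bar>k x\<bar> \<le> c"
    and 0: "\<And>x. norm x > r \<Longrightarrow> k x = 0" for k :: "real^'a \<Rightarrow> real"
  proof (rule Bochner_Integration.integrable_bound)
    show "integrable lborel (\<lambda>x. c * indicat_real (cball (0::real^'a) r) x)"
      by (intro integrable_mult_right integrable_real_indicator emeasure_bounded_finite) auto
    have "norm (k x) \<le> norm (c * indicat_real (cball (0::real^'a) r) x)" for x
      using b[of x] 0[of x] by (cases "norm x \<le> r") auto
    then show "AE x in lborel. norm (k x) \<le> norm (c * indicat_real (cball (0::real^'a) r) x)" by simp
  qed measurable
  show i': "integrable lborel (\<lambda>x. \<phi>' x $ i)"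
    by (rule int) (use r order_trans[OF component_le_norm_cart c(3)] in auto)
  show "(LBINT x. \<phi>' x $ i) = 0"
  proof (rule integral_directional_derivative_zero[where F = \<phi> and i = "axis i 1"])
    show "integrable lborel \<phi>" by (rule int) (use r c in auto)
    show "((\<lambda>s. \<phi> (y + s *\<^sub>R axis i 1)) has_real_derivative \<phi>' y $ i) (at 0)" for y
    proof -
      have 1: "((\<lambda>s. y + s *\<^sub>R axis i 1) has_derivative (\<lambda>h. h *\<^sub>R axis i 1)) (at 0)"
        by (auto intro!: derivative_eq_intros)
      have 2: "(\<phi> has_derivative (\<lambda>h. \<phi>' y \<bullet> h)) (at (y + 0 *\<^sub>R axis i 1))"
        using \<phi> by (simp add: test_function_def)
      show ?thesis
        using has_derivative_compose[OF 1 2] by (simp add: has_field_derivative_def inner_axis mult.commute[of _ "\<phi>' y $ i"])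
    qed
    have "continuous_on UNIV \<phi>'" using \<phi> by (simp add: test_function_def)
    then show "continuous_on UNIV (\<lambda>y. \<phi>' y $ i)" by (intro continuous_intros)
  qed (rule i')
qed

context weakly_differentiable
begin

lemma is_weak_gradient_affine:
  "is_weak_gradient (\<lambda>x. c *\<^sub>R (f x + d)) (\<lambda>x. c *\<^sub>R G x)"
  unfolding is_weak_gradient_def
proof (intro conjI allI impI)
  have loc: "loc_integrable f" "loc_integrable G" using wg by (auto simp: is_weak_gradient_def)
  have li: "set_integrable lborel K (\<lambda>x. c *\<^sub>R (f x + d))" if "compact K" for K :: "(real^'n) set"
  proof -
    have "set_integrable lborel K f" using loc that by (simp add: loc_integrable_def)
    moreover have "set_integrable lborel K (\<lambda>x. d)"
      unfolding set_integrable_def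
      by (intro integrable_scaleR_left integrable_real_indicator emeasure_bounded_finite)
        (use that in \<open>auto simp: compact_imp_bounded compact_imp_closed\<close>)
    ultimately have "integrable lborel (\<lambda>x. c *\<^sub>R (indicator K x *\<^sub>R f x + indicator K x *\<^sub>R d))"
      unfolding set_integrable_def by (intro integrable_scaleR_right Bochner_Integration.integrable_add)
    then show ?thesis unfolding set_integrable_def by (simp add: scaleR_add_right mult.commute)
  qed
  then show "loc_integrable (\<lambda>x. c *\<^sub>R (f x + d))" by (simp add: loc_integrable_def)
  show "loc_integrable (\<lambda>x. c *\<^sub>R G x)"
    unfolding loc_integrable_def
  proof (intro allI impI)
    fix K :: "(real^'n) set" assume "compact K"
    then have "set_integrable lborel K G" using loc by (simp add: loc_integrable_def)
    then show "set_integrable lborel K (\<lambda>x. c *\<^sub>R G x)"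
      unfolding set_integrable_def using integrable_scaleR_right[of c lborel "\<lambda>x. indicator K x *\<^sub>R G x"] by (simp add: mult.commute)
  qed
  fix \<phi> :: "real^'n \<Rightarrow> real" and \<phi>' i assume \<phi>: "test_function \<phi> \<phi>'"
  obtain r where r: "r > 0" "\<And>x. norm x > r \<Longrightarrow> \<phi> x = 0" "\<And>x. norm x > r \<Longrightarrow> \<phi>' x = 0"
    using test_functionD[OF \<phi>] by metis
  obtain b where b: "b > 0" "\<And>x. \<bar>\<phi> x\<bar> \<le> b" "\<And>x. norm (\<phi>' x) \<le> b"
    using test_function_bounded[OF \<phi>] by metis
  have b': "\<bar>\<phi>' x $ i\<bar> \<le> b" for x using order_trans[OF component_le_norm_cart b(3)] .
  note [measurable] = test_function_measurable[OF \<phi>]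
  have 1: "integrable lborel (\<lambda>x. (\<phi>' x $ i) *\<^sub>R f x)"
    by (rule integrable_test_mult[OF loc(1) _ b', where r = r]) (use r in auto)
  have "(LINT x|lborel. (\<phi>' x $ i) *\<^sub>R c *\<^sub>R (f x + d))
      = (LINT x|lborel. c *\<^sub>R ((\<phi>' x $ i) *\<^sub>R f x + (\<phi>' x $ i) *\<^sub>R d))"
    by (simp add: scaleR_add_right mult.commute)
  also have "\<dots> = c *\<^sub>R ((LINT x|lborel. (\<phi>' x $ i) *\<^sub>R f x) + (LINT x|lborel. \<phi>' x $ i) *\<^sub>R d)"
    using 1 integral_test_gradient(2)[OF \<phi>, of i] by simp
  also have "\<dots> = c *\<^sub>R - (LINT x|lborel. \<phi> x *\<^sub>R (G x $ i))"
    using wg \<phi> integral_test_gradient(1)[OF \<phi>, of i] by (simp add: is_weak_gradient_def)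
  also have "\<dots> = - (LINT x|lborel. \<phi> x *\<^sub>R ((c *\<^sub>R G x) $ i))"
    by (simp add: mult.left_commute scaleR_scaleR[symmetric] scaleR_left_commute del: scaleR_scaleR)
  finally show "(LINT x|lborel. (\<phi>' x $ i) *\<^sub>R c *\<^sub>R (f x + d)) = - (LINT x|lborel. \<phi> x *\<^sub>R ((c *\<^sub>R G x) $ i))" .
qed measurable

end

context normalized_weakly_differentiable
begin

lemma integrable_f: "integrable gauss_m f"
  by (rule integrable_gauss_m_square) (use f2 in auto)

lemma cmod_add_power2: "(cmod (z + of_real L * e))\<^sup>2 = (cmod z)\<^sup>2 + 2 * L * Re (cnj e * z) + L\<^sup>2"
  if "cmod e = 1" for z e :: complex and L :: real
proof -
  have "(Re e)\<^sup>2 + (Im e)\<^sup>2 = 1" using that by (simp add: cmod_power2[symmetric])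
  then have "L\<^sup>2 * ((Re e)\<^sup>2 + (Im e)\<^sup>2) = L\<^sup>2" by simp
  then show ?thesis unfolding cmod_power2 by (simp add: power2_eq_square algebra_simps)
qed

text \<open>\<open>hellinger_le\<close> is applied to \<open>f + L e\<close> divided by its L2 norm.
  The squared norm divides the Dirichlet integral and multiplies back in the conclusion, so the
  bound does not depend on \<open>L\<close>.\<close>

lemma shifted_hellinger:
  assumes e: "cmod e = 1" and L: "L \<ge> 2"
  defines "p \<equiv> \<integral>x. Re (cnj e * f x) \<partial>gauss_m"
  shows "(\<integral>x. (cmod (f x + of_real L * e) - sqrt (1 + 2 * L * p + L\<^sup>2))\<^sup>2 \<partial>gauss_m) \<le> 2 * gauss_v * D"
    and "integrable gauss_m (\<lambda>x. (cmod (f x + of_real L * e) - sqrt (1 + 2 * L * p + L\<^sup>2))\<^sup>2)"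
proof -
  interpret g: prob_space "gauss_m :: (real^'n) measure" by (rule prob_space_gauss_m)
  let ?F = "\<lambda>x. f x + of_real L * e"
  let ?N2 = "1 + 2 * L * p + L\<^sup>2"
  have ip: "integrable gauss_m (\<lambda>x. Re (cnj e * f x))"
    by (intro integrable_Re integrable_mult_right integrable_f)
  have F2: "integrable gauss_m (\<lambda>x. (cmod (?F x))\<^sup>2)" "(\<integral>x. (cmod (?F x))\<^sup>2 \<partial>gauss_m) = ?N2"
    unfolding cmod_add_power2[OF e] using f2 ip norm1 g.prob_space by (simp_all add: p_def)
  \<comment> \<open>\<open>|L e|^2 \<le> 2 |f + L e|^2 + 2 |f|^2\<close> integrates to
    \<open>L^2 / 2 - 1 \<le> ?N2\<close>, which is positive for \<open>L \<ge> 2\<close>.\<close>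
  have N2: "?N2 > 0"
  proof -
    have "L\<^sup>2 / 2 - 1 = (\<integral>x. L\<^sup>2 / 2 - (cmod (f x))\<^sup>2 \<partial>gauss_m)" using f2 norm1 g.prob_space by simp
    also have "\<dots> \<le> (\<integral>x. (cmod (?F x))\<^sup>2 \<partial>gauss_m)"
    proof (intro integral_mono F2(1))
      fix x
      have "L\<^sup>2 = (cmod (?F x - f x))\<^sup>2" using e L by (simp add: norm_mult)
      also have "\<dots> \<le> 2 * (cmod (?F x))\<^sup>2 + 2 * (cmod (f x))\<^sup>2" by (rule norm_diff_power2_le)
      finally show "L\<^sup>2 / 2 - (cmod (f x))\<^sup>2 \<le> (cmod (?F x))\<^sup>2" by simp
    qed (use f2 in simp)
    finally have "L\<^sup>2 / 2 - 1 \<le> ?N2" unfolding F2(2) .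
    moreover have "2\<^sup>2 \<le> L\<^sup>2" using L by (intro power_mono) auto
    ultimately show ?thesis by simp
  qed
  define N where "N = sqrt ?N2"
  have N: "N > 0" "N\<^sup>2 = ?N2" using N2 by (simp_all add: N_def)
  have momF: "integrable gauss_m (\<lambda>x. (norm x)\<^sup>2 * (cmod (?F x))\<^sup>2)"
  proof (rule Bochner_Integration.integrable_bound)
    show "integrable gauss_m (\<lambda>x::real^'n. 2 * ((norm x)\<^sup>2 * (cmod (f x))\<^sup>2) + 2 * L\<^sup>2 * (norm x)\<^sup>2)"
      by (intro Bochner_Integration.integrable_add integrable_mult_right mom gauss_moment2)
    have "(norm x)\<^sup>2 * (cmod (?F x))\<^sup>2 \<le> 2 * ((norm x)\<^sup>2 * (cmod (f x))\<^sup>2) + 2 * L\<^sup>2 * (norm x)\<^sup>2" for x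
    proof -
      have "(cmod (?F x))\<^sup>2 \<le> 2 * (cmod (f x))\<^sup>2 + 2 * L\<^sup>2"
        using norm_diff_power2_le[of "f x" "- (of_real L * e)"] e by (simp add: norm_mult)
      from mult_left_mono[OF this, of "(norm x)\<^sup>2"] show ?thesis by (simp add: algebra_simps)
    qed
    then show "AE x in gauss_m. norm ((norm x)\<^sup>2 * (cmod (?F x))\<^sup>2)
        \<le> norm (2 * ((norm x)\<^sup>2 * (cmod (f x))\<^sup>2) + 2 * L\<^sup>2 * (norm x)\<^sup>2)" by simp
  qed measurable
  interpret F: normalized_weakly_differentiable "\<lambda>x. (1 / N) *\<^sub>R ?F x" "\<lambda>x. (1 / N) *\<^sub>R G x"
  proof unfold_locales
    show "is_weak_gradient (\<lambda>x. (1 / N) *\<^sub>R ?F x) (\<lambda>x. (1 / N) *\<^sub>R G x)" by (rule is_weak_gradient_affine)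
    show "integrable gauss_m (\<lambda>x. (cmod ((1 / N) *\<^sub>R ?F x))\<^sup>2)"
      using F2(1) by (simp add: power_mult_distrib power_divide)
    show "integrable gauss_m (\<lambda>x. (norm ((1 / N) *\<^sub>R G x))\<^sup>2)"
      using G2 by (simp add: power_mult_distrib power_divide)
    show "(\<integral>x. (cmod ((1 / N) *\<^sub>R ?F x))\<^sup>2 \<partial>gauss_m) = 1"
      using F2 N less_imp_neq[OF N2] by (simp add: power_mult_distrib power_divide)
    show "integrable gauss_m (\<lambda>x. (norm x)\<^sup>2 * (cmod ((1 / N) *\<^sub>R ?F x))\<^sup>2)"
      using momF by (simp add: power_mult_distrib power_divide)
  qed
  have FD: "F.D = D / N\<^sup>2"
    unfolding F.D_def D_def by (simp add: power_mult_distrib power_divide)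
  have sq: "(cmod (?F x) - N)\<^sup>2 = N\<^sup>2 * (cmod ((1 / N) *\<^sub>R ?F x) - 1)\<^sup>2" for x
    using N(1) by (simp add: power_mult_distrib[symmetric] right_diff_distrib)
  have "(\<integral>x. (cmod (?F x) - N)\<^sup>2 \<partial>gauss_m) = N\<^sup>2 * (\<integral>x. (cmod ((1 / N) *\<^sub>R ?F x) - 1)\<^sup>2 \<partial>gauss_m)"
    unfolding sq by simp
  also have "\<dots> \<le> N\<^sup>2 * (2 * gauss_v * (D / N\<^sup>2))"
    using F.hellinger_le unfolding FD by (intro mult_left_mono) auto
  also have "\<dots> = 2 * gauss_v * D" using N(1) by simp
  finally show "(\<integral>x. (cmod (?F x) - sqrt ?N2)\<^sup>2 \<partial>gauss_m) \<le> 2 * gauss_v * D" unfolding N_def .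
  have iF: "integrable gauss_m (\<lambda>x. cmod (?F x))" using integrable_f by (intro integrable_norm) simp
  show "integrable gauss_m (\<lambda>x. (cmod (?F x) - sqrt ?N2)\<^sup>2)"
    using F2(1) iF by (simp add: power2_diff)
qed

text \<open>The Poincare inequality as a linearization: as \<open>L \<rightarrow> \<infinity>\<close>, \<open>|f + L e|\<close> minus its \<open>L\<^sup>2\<close> norm
  tends to the fluctuation of \<open>Re (cnj e * f)\<close>.\<close>

lemma poincare_part:
  assumes e: "cmod e = 1"
  defines "p \<equiv> \<integral>x. Re (cnj e * f x) \<partial>gauss_m"
  shows "(\<integral>\<^sup>+x. ennreal ((Re (cnj e * f x) - p)\<^sup>2) \<partial>gauss_m) \<le> ennreal (2 * gauss_v * D)"
proof -
  let ?X = "\<lambda>n x. (cmod (f x + of_real (real n) * e) - sqrt (1 + 2 * real n * p + (real n)\<^sup>2))\<^sup>2"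
  have lim: "(\<lambda>n. ?X n x) \<longlonglongrightarrow> (Re (cnj e * f x) - p)\<^sup>2" for x
  proof -
    have "(\<lambda>n. (sqrt ((cmod (f x))\<^sup>2 + 2 * real n * Re (cnj e * f x) + (real n)\<^sup>2) - real n)
        - (sqrt (1 + 2 * real n * p + (real n)\<^sup>2) - real n)) \<longlonglongrightarrow> Re (cnj e * f x) - p"
      by (intro tendsto_diff sqrt_quadratic_tendsto)
    then have "(\<lambda>n. cmod (f x + of_real (real n) * e) - sqrt (1 + 2 * real n * p + (real n)\<^sup>2)) \<longlonglongrightarrow> Re (cnj e * f x) - p"
      unfolding cmod_add_power2[OF e, symmetric] by simp
    then show ?thesis by (rule tendsto_power)
  qed
  have "(\<integral>\<^sup>+x. ennreal ((Re (cnj e * f x) - p)\<^sup>2) \<partial>gauss_m) = (\<integral>\<^sup>+x. liminf (\<lambda>n. ennreal (?X n x)) \<partial>gauss_m)"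
  proof (intro nn_integral_cong)
    fix x
    have "(\<lambda>n. ennreal (?X n x)) \<longlonglongrightarrow> ennreal ((Re (cnj e * f x) - p)\<^sup>2)"
      by (intro tendsto_ennrealI lim)
    then show "ennreal ((Re (cnj e * f x) - p)\<^sup>2) = liminf (\<lambda>n. ennreal (?X n x))"
      by (rule lim_imp_Liminf[OF trivial_limit_sequentially, symmetric])
  qed
  \<comment> \<open>Fatou's lemma carries the bound, which is uniform in \<open>n\<close>, over to
    the pointwise limit.\<close>
  also have "\<dots> \<le> liminf (\<lambda>n. \<integral>\<^sup>+x. ennreal (?X n x) \<partial>gauss_m)"
    by (intro nn_integral_liminf) measurable
  also have "\<dots> \<le> ennreal (2 * gauss_v * D)"
  proof (rule Liminf_le)
    have "(\<integral>\<^sup>+x. ennreal (?X n x) \<partial>gauss_m) \<le> ennreal (2 * gauss_v * D)" if "n \<ge> 2" for n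
    proof -
      note S = shifted_hellinger[OF e, of "real n", folded p_def]
      have n: "2 \<le> real n" using that by simp
      have "(\<integral>\<^sup>+x. ennreal (?X n x) \<partial>gauss_m) = ennreal (\<integral>x. ?X n x \<partial>gauss_m)"
        by (intro nn_integral_eq_integral S(2) n) simp
      also have "\<dots> \<le> ennreal (2 * gauss_v * D)" by (intro ennreal_leI S(1) n)
      finally show ?thesis .
    qed
    then show "eventually (\<lambda>n. (\<integral>\<^sup>+x. ennreal (?X n x) \<partial>gauss_m) \<le> ennreal (2 * gauss_v * D)) sequentially"
      by (auto simp: eventually_sequentially)
  qed simp
  finally show ?thesis .
qed

text \<open>The directions \<open>e = 1\<close> and \<open>e = \<i>\<close> yield the variances of
  the real and of the imaginary part. Each is bounded by the whole of \<open>2 v D\<close>, hence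
  the factor 4.\<close>

lemma poincare: "1 - (cmod (\<integral>x. f x \<partial>gauss_m))\<^sup>2 \<le> 4 * gauss_v * D"
proof -
  interpret g: prob_space "gauss_m :: (real^'n) measure" by (rule prob_space_gauss_m)
  have D0: "D \<ge> 0" unfolding D_def by simp
  have var: "(\<integral>x. (u x)\<^sup>2 \<partial>gauss_m) - (\<integral>x. u x \<partial>gauss_m)\<^sup>2 \<le> 2 * gauss_v * D"
    if u: "integrable gauss_m u" "integrable gauss_m (\<lambda>x. (u x)\<^sup>2)"
      and le: "(\<integral>\<^sup>+x. ennreal ((u x - (\<integral>x. u x \<partial>gauss_m))\<^sup>2) \<partial>gauss_m) \<le> ennreal (2 * gauss_v * D)"
    for u :: "real^'n \<Rightarrow> real"
  proof -
    let ?p = "\<integral>x. u x \<partial>gauss_m"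
    have i: "integrable gauss_m (\<lambda>x. (u x - ?p)\<^sup>2)" using u by (simp add: power2_diff)
    have "ennreal (\<integral>x. (u x - ?p)\<^sup>2 \<partial>gauss_m) \<le> ennreal (2 * gauss_v * D)"
      using le nn_integral_eq_integral[OF i] by simp
    then have "(\<integral>x. (u x - ?p)\<^sup>2 \<partial>gauss_m) \<le> 2 * gauss_v * D"
      using D0 by (subst (asm) ennreal_le_iff) auto
    moreover have "(\<integral>x. (u x - ?p)\<^sup>2 \<partial>gauss_m) = (\<integral>x. (u x)\<^sup>2 \<partial>gauss_m) - ?p\<^sup>2"
      using u g.prob_space by (simp add: power2_diff) (simp add: power2_eq_square)
    ultimately show ?thesis by simp
  qed
  have le: "(Re z)\<^sup>2 \<le> (cmod z)\<^sup>2" "(Im z)\<^sup>2 \<le> (cmod z)\<^sup>2" for z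
    by (simp_all add: cmod_power2)
  have i2: "integrable gauss_m (\<lambda>x. (Re (f x))\<^sup>2)" "integrable gauss_m (\<lambda>x. (Im (f x))\<^sup>2)"
    by (rule Bochner_Integration.integrable_bound[OF f2]; use le in simp)+
  have r: "(\<integral>x. (Re (f x))\<^sup>2 \<partial>gauss_m) - (\<integral>x. Re (f x) \<partial>gauss_m)\<^sup>2 \<le> 2 * gauss_v * D"
    by (rule var) (use integrable_f i2 poincare_part[of 1] in simp_all)
  have s: "(\<integral>x. (Im (f x))\<^sup>2 \<partial>gauss_m) - (\<integral>x. Im (f x) \<partial>gauss_m)\<^sup>2 \<le> 2 * gauss_v * D"
    by (rule var) (use integrable_f i2 poincare_part[of \<i>] in simp_all)
  have "(\<integral>x. (Re (f x))\<^sup>2 \<partial>gauss_m) + (\<integral>x. (Im (f x))\<^sup>2 \<partial>gauss_m) = 1"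
    using i2 norm1 by (simp add: cmod_power2)
  moreover have "(cmod (\<integral>x. f x \<partial>gauss_m))\<^sup>2 = (\<integral>x. Re (f x) \<partial>gauss_m)\<^sup>2 + (\<integral>x. Im (f x) \<partial>gauss_m)\<^sup>2"
    unfolding cmod_power2 using integrable_f by simp
  ultimately show ?thesis using r s by linarith
qed

end

section \<open>From the hypotheses on the sequence to the convergence\<close>

lemma gauss_square_integrable:
  fixes f :: "real ^ 'n \<Rightarrow> complex"
  assumes [measurable]: "f \<in> borel_measurable borel"
    and norm: "(\<integral>\<^sup>+x. ennreal ((cmod (f x))\<^sup>2) \<partial>gauss_m) = 1"
  shows "integrable gauss_m (\<lambda>x. (cmod (f x))\<^sup>2)" "(\<integral>x. (cmod (f x))\<^sup>2 \<partial>gauss_m) = 1" "integrable gauss_m f"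
proof -
  show 1: "integrable gauss_m (\<lambda>x. (cmod (f x))\<^sup>2)"
    by (rule integrableI_nn_integral_finite[of _ _ 1]) (use norm in auto)
  show "(\<integral>x. (cmod (f x))\<^sup>2 \<partial>gauss_m) = 1"
    by (rule integral_eq_nn_integral[THEN trans]) (use norm in auto)
  show "integrable gauss_m f" by (rule integrable_gauss_m_square) (use 1 in auto)
qed

text \<open>The distance of two functions of norm 1 is determined by their inner product, which for
  a constant is the mean up to phase. So convergence reduces to the modulus of the mean tending to 1
  and to the choice of the phase.\<close>

lemma nn_integral_dist_const:
  fixes f :: "real ^ 'n \<Rightarrow> complex"
  assumes "f \<in> borel_measurable borel" and "(\<integral>\<^sup>+x. ennreal ((cmod (f x))\<^sup>2) \<partial>gauss_m) = 1" and z: "cmod z = 1"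
  shows "(\<integral>\<^sup>+x. ennreal ((cmod (f x - z))\<^sup>2) \<partial>gauss_m) = ennreal (2 - 2 * Re (cnj z * (\<integral>x. f x \<partial>gauss_m)))"
proof -
  interpret g: prob_space "gauss_m :: (real^'n) measure" by (rule prob_space_gauss_m)
  note F = gauss_square_integrable[OF assms(1,2)]
  define r where "r x = Re (cnj z * f x)" for x
  have i: "integrable gauss_m r" unfolding r_def[abs_def] by (intro integrable_Re integrable_mult_right F(3))
  have e: "(cmod (f x - z))\<^sup>2 = (cmod (f x))\<^sup>2 + 1 - 2 * r x" for x
  proof -
    have "(Re z)\<^sup>2 + (Im z)\<^sup>2 = 1" using z by (simp add: cmod_power2[symmetric])
    then show ?thesis unfolding cmod_power2 r_def by (simp add: power2_diff)
  qed
  have "(\<integral>\<^sup>+x. ennreal ((cmod (f x - z))\<^sup>2) \<partial>gauss_m) = ennreal (\<integral>x. (cmod (f x - z))\<^sup>2 \<partial>gauss_m)"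
  proof (rule nn_integral_eq_integral)
    show "integrable gauss_m (\<lambda>x. (cmod (f x - z))\<^sup>2)"
      unfolding e by (intro Bochner_Integration.integrable_diff Bochner_Integration.integrable_add integrable_mult_right F(1) i) simp
  qed simp
  also have "(\<integral>x. (cmod (f x - z))\<^sup>2 \<partial>gauss_m) = 2 - 2 * (\<integral>x. r x \<partial>gauss_m)"
    unfolding e using F(1,2) i g.prob_space by simp
  also have "(\<integral>x. r x \<partial>gauss_m) = Re (\<integral>x. cnj z * f x \<partial>gauss_m)"
    unfolding r_def by (rule integral_Re) (intro integrable_mult_right F(3))
  also have "\<dots> = Re (cnj z * (\<integral>x. f x \<partial>gauss_m))" by (simp only: integral_mult_right_zero)
  finally show ?thesis .
qed

text \<open>With \<open>c = min 1 (\<epsilon> / 2)\<close> and \<open>u = |x|^2\<close>, \<open>c (1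
  + u) \<le> 1 + \<epsilon> u / 2 \<le> exp (\<epsilon> u / 2)\<close>. Squaring trades
  \<open>(1 + u)^2\<close> for the factor \<open>exp (\<epsilon> u)\<close> by which the weight in
  the hypothesis exceeds the Gaussian one. \<open>max 0 M\<close> reflects that
  \<open>ennreal\<close> sends a negative \<open>M\<close> to 0.\<close>

lemma exponential_moment:
  fixes f :: "real ^ 'n \<Rightarrow> complex"
  assumes [measurable]: "f \<in> borel_measurable borel" and \<epsilon>: "\<epsilon> > 0"
    and M: "(\<integral>\<^sup>+x. ennreal ((cmod (f x))\<^sup>2 * exp (- ((2 * pi - \<epsilon>) * (norm x)\<^sup>2))) \<partial>lborel) \<le> ennreal M"
  defines "B \<equiv> 2 powr (real CARD('n) / 2) / (min 1 (\<epsilon> / 2))\<^sup>2 * max 0 M"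
  shows "integrable gauss_m (\<lambda>x. (cmod (f x))\<^sup>2 * (1 + (norm x)\<^sup>2)\<^sup>2)"
    and "(\<integral>x. (cmod (f x))\<^sup>2 * (1 + (norm x)\<^sup>2)\<^sup>2 \<partial>gauss_m) \<le> B"
proof -
  let ?c = "min 1 (\<epsilon> / 2)" and ?P = "2 powr (real CARD('n) / 2)"
  let ?w = "\<lambda>x::real^'n. ?P * exp (- (2 * pi * (norm x)\<^sup>2))"
  have c: "?c > 0" using \<epsilon> by simp
  have pw: "?w x * ((cmod (f x))\<^sup>2 * (1 + (norm x)\<^sup>2)\<^sup>2)
      \<le> (?P / ?c\<^sup>2) * ((cmod (f x))\<^sup>2 * exp (- ((2 * pi - \<epsilon>) * (norm x)\<^sup>2)))" for x
  proof -
    let ?u = "(norm x)\<^sup>2"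
    have "?c * (1 + ?u) \<le> 1 + (\<epsilon> / 2) * ?u" unfolding distrib_left by (intro add_mono mult_right_mono) auto
    also have "\<dots> \<le> exp ((\<epsilon> / 2) * ?u)" by (rule exp_ge_add_one_self)
    finally have "(?c * (1 + ?u))\<^sup>2 \<le> (exp ((\<epsilon> / 2) * ?u))\<^sup>2" using c by (intro power_mono) auto
    also have "\<dots> = exp (\<epsilon> * ?u)" by (simp add: exp_double[symmetric] mult.assoc[symmetric])
    finally have "(1 + ?u)\<^sup>2 \<le> exp (\<epsilon> * ?u) / ?c\<^sup>2" using c by (simp add: power_mult_distrib pos_le_divide_eq mult.commute)
    then have "(?w x * (cmod (f x))\<^sup>2) * (1 + ?u)\<^sup>2 \<le> (?w x * (cmod (f x))\<^sup>2) * (exp (\<epsilon> * ?u) / ?c\<^sup>2)"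
      by (intro mult_left_mono) auto
    also have "\<dots> = (?P / ?c\<^sup>2) * ((cmod (f x))\<^sup>2 * (exp (- (2 * pi * ?u)) * exp (\<epsilon> * ?u)))" by simp
    also have "exp (- (2 * pi * ?u)) * exp (\<epsilon> * ?u) = exp (- ((2 * pi - \<epsilon>) * ?u))"
      unfolding exp_add[symmetric] by (simp add: algebra_simps)
    finally show ?thesis by (simp only: mult.assoc)
  qed
  have "(\<integral>\<^sup>+x. ennreal ((cmod (f x))\<^sup>2 * (1 + (norm x)\<^sup>2)\<^sup>2) \<partial>gauss_m)
      = (\<integral>\<^sup>+x. ennreal (?w x * ((cmod (f x))\<^sup>2 * (1 + (norm x)\<^sup>2)\<^sup>2)) \<partial>lborel)"
    unfolding gauss_m_def by (subst nn_integral_density) (auto simp: ennreal_mult'[symmetric])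
  also have "\<dots> \<le> (\<integral>\<^sup>+x. ennreal (?P / ?c\<^sup>2) * ennreal ((cmod (f x))\<^sup>2 * exp (- ((2 * pi - \<epsilon>) * (norm x)\<^sup>2))) \<partial>lborel)"
    using pw by (intro nn_integral_mono) (simp add: ennreal_mult'[symmetric] ennreal_leI)
  also have "\<dots> = ennreal (?P / ?c\<^sup>2) * (\<integral>\<^sup>+x. ennreal ((cmod (f x))\<^sup>2 * exp (- ((2 * pi - \<epsilon>) * (norm x)\<^sup>2))) \<partial>lborel)"
    by (intro nn_integral_cmult) measurable
  also have "\<dots> \<le> ennreal (?P / ?c\<^sup>2) * ennreal (max 0 M)"
    using M by (intro mult_left_mono) (auto simp: max_def ennreal_neg split: if_splits)
  also have "\<dots> = ennreal B" unfolding B_def by (rule ennreal_mult'[symmetric]) simp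
  finally have nn: "(\<integral>\<^sup>+x. ennreal ((cmod (f x))\<^sup>2 * (1 + (norm x)\<^sup>2)\<^sup>2) \<partial>gauss_m) \<le> ennreal B" .
  show i: "integrable gauss_m (\<lambda>x. (cmod (f x))\<^sup>2 * (1 + (norm x)\<^sup>2)\<^sup>2)"
    by (rule integrableI_bounded) (use le_less_trans[OF nn ennreal_less_top] in \<open>auto simp: abs_mult\<close>)
  have "ennreal (\<integral>x. (cmod (f x))\<^sup>2 * (1 + (norm x)\<^sup>2)\<^sup>2 \<partial>gauss_m) \<le> ennreal B"
    using nn nn_integral_eq_integral[OF i] by simp
  then show "(\<integral>x. (cmod (f x))\<^sup>2 * (1 + (norm x)\<^sup>2)\<^sup>2 \<partial>gauss_m) \<le> B"
    by (subst (asm) ennreal_le_iff) (simp_all add: B_def)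
qed

text \<open>Replaces the extended-valued definitions by Bochner integrals. The negative part of the
  entropy integrand is at most 1 and \<open>dm\<close> has mass 1, so only the positive part could
  diverge; as the Dirichlet integral is finite, the deficit would then be
  \<open>-\<infinity>\<close>.\<close>

lemma finite_deficit:
  fixes f :: "real ^ 'n \<Rightarrow> complex"
  assumes [measurable]: "f \<in> borel_measurable borel"
    and fin: "\<bar>deficit_c f\<bar> \<noteq> \<infinity>"
  obtains G where "is_weak_gradient f G" "integrable gauss_m (\<lambda>x. (norm (G x))\<^sup>2)"
    "integrable gauss_m (\<lambda>x. (cmod (f x))\<^sup>2 * ln ((cmod (f x))\<^sup>2))"
    "deficit_c f = ereal (2 * gauss_v * (\<integral>x. (norm (G x))\<^sup>2 \<partial>gauss_m)
      - (\<integral>x. (cmod (f x))\<^sup>2 * ln ((cmod (f x))\<^sup>2) \<partial>gauss_m))"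
proof -
  interpret g: prob_space "gauss_m :: (real^'n) measure" by (rule prob_space_gauss_m)
  let ?g = "\<lambda>x. (cmod (f x))\<^sup>2 * ln ((cmod (f x))\<^sup>2)"
  let ?P = "\<integral>\<^sup>+x. ennreal (?g x) \<partial>gauss_m" and ?N = "\<integral>\<^sup>+x. ennreal (- ?g x) \<partial>gauss_m"
  let ?G = "weak_gradient f"
  have dfin: "dirichlet f \<noteq> \<infinity>" using fin by (auto simp: deficit_c_def)
  then have ex: "\<exists>g. is_weak_gradient f g" by (rule contrapos_np) (simp add: dirichlet_def)
  then have wg: "is_weak_gradient f ?G" unfolding weak_gradient_def by (rule someI_ex)
  have dir: "dirichlet f = (\<integral>\<^sup>+x. ennreal ((norm (?G x))\<^sup>2) \<partial>gauss_m)"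
    using ex by (simp add: dirichlet_def)
  have [measurable]: "?G \<in> borel_measurable borel" using wg by (simp add: is_weak_gradient_def)
  have iG: "integrable gauss_m (\<lambda>x. (norm (?G x))\<^sup>2)"
    by (rule integrableI_bounded) (use dfin dir in \<open>auto simp: less_top\<close>)
  have dirD: "dirichlet f = ennreal (\<integral>x. (norm (?G x))\<^sup>2 \<partial>gauss_m)"
    unfolding dir by (rule nn_integral_eq_integral[OF iG]) simp
  have low: "- ?g x \<le> 1" for x
  proof (cases "f x = 0")
    case False
    then have p: "(cmod (f x))\<^sup>2 > 0" by simp
    have "ln (1 / (cmod (f x))\<^sup>2) \<le> 1 / (cmod (f x))\<^sup>2 - 1" using p by (intro ln_le_minus_one) simp
    then have "(cmod (f x))\<^sup>2 * ln (1 / (cmod (f x))\<^sup>2) \<le> (cmod (f x))\<^sup>2 * (1 / (cmod (f x))\<^sup>2 - 1)"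
      using p by (intro mult_left_mono) auto
    also have "\<dots> = 1 - (cmod (f x))\<^sup>2" using p by (simp add: right_diff_distrib)
    also have "\<dots> \<le> 1" by simp
    finally show ?thesis using p by (simp add: ln_div)
  qed simp
  have "?N \<le> (\<integral>\<^sup>+x. 1 \<partial>(gauss_m :: (real^'n) measure))"
    using low by (intro nn_integral_mono) (auto intro!: ennreal_leI simp flip: ennreal_1)
  also have "\<dots> = 1" using g.emeasure_space_1 by simp
  finally have N: "?N \<noteq> \<infinity>" by (auto simp: top_unique)
  then obtain nr where nr: "nr \<ge> 0" "?N = ennreal nr" by (cases ?N) auto
  have P: "?P \<noteq> \<infinity>"
  proof
    assume "?P = \<infinity>"
    then have "entropy_m f = \<infinity>" unfolding entropy_m_def nr(2) using nr(1) by simp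
    then have "deficit_c f = -\<infinity>" unfolding deficit_c_def using dfin by (simp add: dirD)
    then show False using fin by simp
  qed
  then obtain pr where pr: "pr \<ge> 0" "?P = ennreal pr" by (cases ?P) auto
  have ig: "integrable gauss_m ?g" unfolding real_integrable_def using N P by simp
  have "(\<integral>x. ?g x \<partial>gauss_m) = pr - nr"
    using real_lebesgue_integral_def[OF ig] pr nr by simp
  then have ent: "entropy_m f = ereal (\<integral>x. ?g x \<partial>gauss_m)"
    unfolding entropy_m_def pr(2) nr(2) using pr(1) nr(1) by simp
  have "deficit_c f = ereal (2 * gauss_v * (\<integral>x. (norm (?G x))\<^sup>2 \<partial>gauss_m) - (\<integral>x. ?g x \<partial>gauss_m))"
    unfolding deficit_c_def ent using dfin by (simp add: dirD)
  then show ?thesis by (rule that[OF wg iG ig])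
qed

text \<open>\<open>poincare\<close> bounds the defect of the squared mean by the Dirichlet integral.
  The order of choices matters: \<open>R\<close> is fixed first, to make the tail term of
  \<open>dirichlet_le\<close> small; then \<open>k\<close> is large enough for the deficit to beat
  the factor \<open>K\<close>, which depends on \<open>R\<close>.\<close>

lemma mean_modulus_tendsto:
  fixes f :: "nat \<Rightarrow> real ^ 'n \<Rightarrow> complex"
  assumes \<epsilon>: "\<epsilon> > 0"
    and fm: "\<And>k. f k \<in> borel_measurable borel"
    and norm: "\<And>k. (\<integral>\<^sup>+ x. ennreal ((cmod (f k x))\<^sup>2) \<partial>gauss_m) = 1"
    and cen: "\<And>k. (LINT x|gauss_m. (cmod (f k x))\<^sup>2 *\<^sub>R x) = 0"
    and M: "\<And>k. (\<integral>\<^sup>+ x. ennreal ((cmod (f k x))\<^sup>2 * exp (- ((2 * pi - \<epsilon>) * (norm x)\<^sup>2))) \<partial>lborel) \<le> ennreal M"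
    and def0: "(\<lambda>k. deficit_c (f k)) \<longlonglongrightarrow> 0"
  shows "(\<lambda>k. (cmod (\<integral>x. f k x \<partial>gauss_m))\<^sup>2) \<longlonglongrightarrow> 1"
proof (rule tendstoI)
  fix e :: real assume e: "e > 0"
  let ?v = gauss_v
  define B where "B = 2 powr (real CARD('n) / 2) / (min 1 (\<epsilon> / 2))\<^sup>2 * max 0 M"
  \<comment> \<open>Twice the constant in \<open>dirichlet_le\<close>, as in \<open>K\<close> below,
    because \<open>poincare\<close> involves \<open>4 v D\<close> whereas
    \<open>dirichlet_le\<close> bounds \<open>2 v D\<close>.\<close>
  define C where "C = 2 * (4 * (18 + 16 * B) * (2 + 2 * real CARD('n)) * B / (2 * ?v))"
  have B0: "B \<ge> 0" by (simp add: B_def)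
  have C0: "C \<ge> 0" using B0 by (simp add: C_def)
  \<comment> \<open>Chosen such that \<open>e / 2 * R^2 = C\<close>; the 1 in \<open>1 + R^2\<close>
    then makes the tail strictly smaller than \<open>e / 2\<close>.\<close>
  define R where "R = sqrt (2 * C / e)"
  have R: "R \<ge> 0" "R\<^sup>2 = 2 * C / e" using C0 e by (simp_all add: R_def)
  have tail: "C / (1 + R\<^sup>2) < e / 2"
  proof -
    have "C < e / 2 * (1 + R\<^sup>2)" unfolding R(2) using e by (simp add: distrib_left)
    moreover have "0 < 1 + R\<^sup>2" by (simp add: add_pos_nonneg)
    ultimately show ?thesis by (simp add: pos_divide_less_eq)
  qed
  define K where "K = 2 * (1 + 18 * (1 / ((4 * pi) powr (- (real CARD('n) / 2)) * exp (- ((R + 1)\<^sup>2 / 2)) * measure lborel (cball (0::real^'n) 1)) + 4) / (2 * ?v))"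
  have K: "K > 0" unfolding K_def by (intro mult_pos_pos add_pos_nonneg divide_nonneg_pos mult_nonneg_nonneg) auto
  have "eventually (\<lambda>k. deficit_c (f k) < ereal (e / (2 * K))) sequentially"
    by (rule order_tendstoD(2)[OF def0]) (use e K in simp)
  \<comment> \<open>A real lower bound excludes the value \<open>-\<infinity>\<close>, so that
    \<open>finite_deficit\<close> applies.\<close>
  moreover have "eventually (\<lambda>k. deficit_c (f k) > ereal (-1)) sequentially"
    by (rule order_tendstoD(1)[OF def0]) simp
  ultimately show "eventually (\<lambda>k. dist ((cmod (\<integral>x. f k x \<partial>gauss_m))\<^sup>2) 1 < e) sequentially"
  proof eventually_elim
    case (elim k)
    have fin: "\<bar>deficit_c (f k)\<bar> \<noteq> \<infinity>" using elim by auto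
    obtain G where G: "is_weak_gradient (f k) G" "integrable gauss_m (\<lambda>x. (norm (G x))\<^sup>2)"
      "integrable gauss_m (\<lambda>x. (cmod (f k x))\<^sup>2 * ln ((cmod (f k x))\<^sup>2))"
      "deficit_c (f k) = ereal (2 * ?v * (\<integral>x. (norm (G x))\<^sup>2 \<partial>gauss_m)
        - (\<integral>x. (cmod (f k x))\<^sup>2 * ln ((cmod (f k x))\<^sup>2) \<partial>gauss_m))"
      by (rule finite_deficit[OF fm fin])
    note F = gauss_square_integrable[OF fm norm, of k]
    note E = exponential_moment[OF fm \<epsilon> M, of k, folded B_def]
    note [measurable] = fm[of k]
    interpret normalized_weakly_differentiable "f k" G
    proof unfold_locales
      show "integrable gauss_m (\<lambda>x. (norm x)\<^sup>2 * (cmod (f k x))\<^sup>2)"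
      proof (rule Bochner_Integration.integrable_bound[OF E(1)])
        have "(norm x)\<^sup>2 \<le> (1 + (norm x)\<^sup>2)\<^sup>2" for x :: "real^'n"
          using mult_left_mono[of 1 "1 + (norm x)\<^sup>2" "1 + (norm x)\<^sup>2"] by (simp add: power2_eq_square)
        from mult_right_mono[OF this, of "(cmod (f k x))\<^sup>2" for x]
        show "AE x in gauss_m. norm ((norm x)\<^sup>2 * (cmod (f k x))\<^sup>2) \<le> norm ((cmod (f k x))\<^sup>2 * (1 + (norm x)\<^sup>2)\<^sup>2)"
          by (simp add: abs_mult mult.commute)
      qed measurable
    qed (use G F in auto)
    define \<delta> where "\<delta> = 2 * ?v * D - (\<integral>x. (cmod (f k x))\<^sup>2 * ln ((cmod (f k x))\<^sup>2) \<partial>gauss_m)"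
    have \<delta>: "\<delta> < e / (2 * K)" using elim(1) unfolding G(4) \<delta>_def D_def by simp
    have "2 * (2 * ?v * D) \<le> K * \<delta> + C / (1 + R\<^sup>2)"
      using mult_left_mono[OF dirichlet_le[OF G(3) cen E R(1)], of 2]
      unfolding K_def C_def \<delta>_def by (simp add: ring_distribs mult.assoc)
    also have "\<dots> < e / 2 + e / 2"
    proof (rule add_strict_mono[OF _ tail])
      have "K * \<delta> < K * (e / (2 * K))" using \<delta> K by (rule mult_strict_left_mono)
      also have "\<dots> = e / 2" using K by simp
      finally show "K * \<delta> < e / 2" .
    qed
    finally have "4 * ?v * D < e" by simp
    then have lower: "1 - (cmod (\<integral>x. f k x \<partial>gauss_m))\<^sup>2 < e" using poincare by linarith
    have upper: "(cmod (\<integral>x. f k x \<partial>gauss_m))\<^sup>2 \<le> 1"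
    proof -
      interpret g: prob_space "gauss_m :: (real^'n) measure" by (rule prob_space_gauss_m)
      have "cmod (\<integral>x. f k x \<partial>gauss_m) \<le> (\<integral>x. cmod (f k x) \<partial>gauss_m)" by (rule integral_norm_bound)
      also have "\<dots> \<le> (\<integral>x. ((cmod (f k x))\<^sup>2 + 1) / 2 \<partial>gauss_m)"
      proof (rule integral_mono)
        show "cmod (f k x) \<le> ((cmod (f k x))\<^sup>2 + 1) / 2" for x
          using abs_mult_le_power2[of "cmod (f k x)" 1] by simp
      qed (use F in auto)
      also have "\<dots> = 1" using F g.prob_space by simp
      finally show ?thesis by (simp add: power_le_one)
    qed
    show ?case using lower upper by (simp add: dist_real_def)
  qed
qed

text \<open>Every constant of modulus 1 has deficit 0, so complex functions can approach 1 only
  after a rotation, which may depend on \<open>k\<close>; a nonnegative function has the right phase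
  already. Either way the distance is computed from the mean, whose modulus tends to 1.\<close>

theorem theorem1p9:
  fixes f :: "nat \<Rightarrow> real ^ 'n \<Rightarrow> complex" and \<epsilon> M :: real
  assumes "\<epsilon> > 0"
    and "\<And>k. f k \<in> borel_measurable borel"
    and "\<And>k. (\<integral>\<^sup>+ x. ennreal ((cmod (f k x))\<^sup>2) \<partial>gauss_m) = 1"
    and "\<And>k. (LINT x|gauss_m. (cmod (f k x))\<^sup>2 *\<^sub>R x) = 0"
    and "\<And>k. (\<integral>\<^sup>+ x. ennreal ((cmod (f k x))\<^sup>2 * exp (- ((2 * pi - \<epsilon>) * (norm x)\<^sup>2))) \<partial>lborel)
               \<le> ennreal M"
    and "(\<lambda>k. deficit_c (f k)) \<longlonglongrightarrow> 0"
  shows "((\<forall>k. AE x in gauss_m. f k x \<in> \<real>\<^sub>\<ge>\<^sub>0) \<longrightarrow> tendsto_L2m f (\<lambda>x. 1))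
    \<and> (\<exists>c :: nat \<Rightarrow> complex.
          (\<forall>k. cmod (c k) = 1) \<and> tendsto_L2m (\<lambda>k x. c k * f k x) (\<lambda>x. 1))"
proof -
  define I where "I k = (\<integral>x. f k x \<partial>gauss_m)" for k
  have "(\<lambda>k. (cmod (I k))\<^sup>2) \<longlonglongrightarrow> 1"
    unfolding I_def by (rule mean_modulus_tendsto[OF assms])
  then have "(\<lambda>k. sqrt ((cmod (I k))\<^sup>2)) \<longlonglongrightarrow> sqrt 1" by (rule tendsto_real_sqrt)
  then have "(\<lambda>k. 2 - 2 * cmod (I k)) \<longlonglongrightarrow> 2 - 2 * 1" by (intro tendsto_intros) simp
  then have lim: "(\<lambda>k. ennreal (2 - 2 * cmod (I k))) \<longlonglongrightarrow> 0"
    using tendsto_ennrealI by fastforce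
  show ?thesis
  proof (intro conjI impI)
    assume nn: "\<forall>k. AE x in gauss_m. f k x \<in> \<real>\<^sub>\<ge>\<^sub>0"
    have "Re (cnj 1 * I k) = cmod (I k)" for k
    proof -
      note F = gauss_square_integrable[OF assms(2,3), of k]
      have eq: "AE x in gauss_m. f k x = complex_of_real (cmod (f k x))"
        using nn[rule_format, of k] by eventually_elim (auto elim!: nonneg_Reals_cases)
      have [measurable]: "f k \<in> borel_measurable gauss_m"
        using assms(2)[of k] by (simp cong: measurable_cong_sets)
      have "I k = (\<integral>x. complex_of_real (cmod (f k x)) \<partial>gauss_m)"
        unfolding I_def by (intro integral_cong_AE eq measurable_compose[OF _ borel_measurable_of_real]) measurable
      also have "\<dots> = complex_of_real (\<integral>x. cmod (f k x) \<partial>gauss_m)" by (rule integral_complex_of_real)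
      finally show ?thesis by simp
    qed
    then show "tendsto_L2m f (\<lambda>x. 1)"
      unfolding tendsto_L2m_def using lim nn_integral_dist_const[OF assms(2,3), of 1] by (simp add: I_def)
  next
    \<comment> \<open>The phase of the mean; the value 1 for a vanishing mean preserves both
      \<open>z\<close> and \<open>zI\<close>.\<close>
    define z where "z k = (if I k = 0 then 1 else I k / of_real (cmod (I k)))" for k
    have z: "cmod (z k) = 1" for k by (simp add: z_def norm_divide)
    have zI: "Re (cnj (z k) * I k) = cmod (I k)" for k
    proof (cases "I k = 0")
      case False
      have "cnj (I k) * I k = of_real ((cmod (I k))\<^sup>2)" using complex_norm_square[of "I k"] by (simp add: mult.commute)
      then have "cnj (z k) * I k = of_real (cmod (I k))"
        using False by (simp add: z_def power2_eq_square)
      then show ?thesis by simp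
    qed simp
    have zz: "cnj (z k) * z k = 1" for k
      using z[of k] by (simp add: complex_norm_square[symmetric] mult.commute)
    have "cmod (cnj (z k) * f k x - 1) = cmod (f k x - z k)" for k x
    proof -
      have "cnj (z k) * f k x - 1 = cnj (z k) * (f k x - z k)" using zz[of k] by (simp add: right_diff_distrib)
      then show ?thesis using z[of k] by (simp add: norm_mult)
    qed
    moreover have "(\<integral>\<^sup>+x. ennreal ((cmod (f k x - z k))\<^sup>2) \<partial>gauss_m) = ennreal (2 - 2 * cmod (I k))" for k
      unfolding zI[symmetric] unfolding I_def by (rule nn_integral_dist_const[OF assms(2,3) z])
    ultimately have "tendsto_L2m (\<lambda>k x. cnj (z k) * f k x) (\<lambda>x. 1)"
      unfolding tendsto_L2m_def using lim by simp
    then show "\<exists>c. (\<forall>k. cmod (c k) = 1) \<and> tendsto_L2m (\<lambda>k x. c k * f k x) (\<lambda>x. 1)"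
      using z by (intro exI[of _ "\<lambda>k. cnj (z k)"]) simp
  qed
qed

end
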